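(* Let $\epsilon_1$ be the threshold of the existence property (E) in the context. If $\phi_{1_b}(t),\phi_{2_b}(t)$ are $C^1$ functions satisfying $$\phi_{i_b}(t+T_* )=\phi_{i_b}(t)\quad(t>0,\ i=1,2),\qquad \|\phi_{i_b}\|_{C^1(\mathbb{R}_+)}\le\epsilon\quad(i=1,2),$$ and possess further $W^{2,\infty}$ regularity with $$\max_{i=1,2}\|\phi_{i_b}''(t)\|_{L^\infty}\le M_2<+\infty,$$ then there exist constants $C_R>0$ and $\epsilon_4\in(0,\epsilon_1)$ such that for any given $\epsilon\in(0,\epsilon_4)$, the time-periodic solution $\phi=\phi^{(T_* )}(t,x)$ of (IBVP) provided by (E) is also a $W^{2,\infty}$ function with $$\max\{\|\partial_t^2\phi^{(T_* )}\|_{L^\infty},\ \|\partial_t\partial_x\phi^{(T_* )}\|_{L^\infty},\ \|\partial_x^2\phi^{(T_* )}\|_{L^\infty}\}\le(1+A_0)^2C_R<+\infty .$$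
   Context: Setting. $\gamma>1$, $\underline\rho>0$, $L>0$, $T_*>0$, $\beta_*<0$ and $\kappa_1,\kappa_2$ with $|\kappa_1|<1$, $|\kappa_2|<1$ are constants; $D=\{(t,x):t\in\mathbb{R}_+,\ x\in[0,L]\}$. For $(m,n)\in\mathbb{R}^2$, $\lambda_1(m,n)=\frac{\gamma+1}{2}m+\frac{3-\gamma}{2}n$ and $\lambda_2(m,n)=\frac{3-\gamma}{2}m+\frac{\gamma+1}{2}n$. $\Phi=(\underline m,\underline n)^\top$ with $-\underline m=\underline n=\frac{\sqrt\gamma}{\gamma-1}\underline\rho^{\frac{\gamma-1}{2}}$, so that $\lambda_1(\Phi)<0<\lambda_2(\Phi)$; $\Psi$ is a small neighborhood of $0\in\mathbb{R}^2$ such that $\lambda_1(\phi+\Phi)<0<\lambda_2(\phi+\Phi)$ for all $\phi\in\Psi$, and $A_0>0$ is a constant with $\max_{i=1,2}\sup_{\phi\in\Psi}|\lambda_i(\phi+\Phi)^{-1}|\le A_0$. The damping coefficient $\beta=\beta(t,x)$ is a $C^2$ function on $D$ satisfying, with the same small constant $\epsilon$ as in the statements, $$\beta_*\le\beta(t,x)\le0,\qquad |\partial_t\beta|,|\partial_x\beta|\le\epsilon,\qquad \beta(t+T_*,x)=\beta(t,x).$$ The $C^1$ norm is the maximum, over components, of the sup norms of the function and its first-order derivatives. (IBVP): for $\phi=(\phi_1,\phi_2)^\top$, $$\partial_t\phi_i+\lambda_i(\phi+\Phi)\partial_x\phi_i=\tfrac{\beta}{2}(\phi_1+\phi_2)\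 \text{ on } D,\quad i=1,2,$$ $$\phi(0,x)=\phi_0(x),\qquad \phi_2(t,0)=\phi_{2_b}(t)+\kappa_2\phi_1(t,0),\qquad \phi_1(t,L)=\phi_{1_b}(t)+\kappa_1\phi_2(t,L)\quad(t\ge0).$$ (E) Existence property, which fixes $\epsilon_1$ and $C_E$: there exist a small enough constant $\epsilon_1>0$ and a constant $C_E>0$ such that for any $0<\epsilon<\epsilon_1$ and any $C^1$ functions $\phi_{i_b}$ $(i=1,2)$ with $\phi_{i_b}(t+T_* )=\phi_{i_b}(t)$ for $t>0$ and $\|\phi_{i_b}\|_{C^1(\mathbb{R}_+)}\le\epsilon$, there exists a $C^1$ function $\phi_0$ with $\|\phi_0\|_{C^1([0,L])}\le C_E\epsilon$ such that (IBVP) admits a $C^1$ solution $\phi^{(T_* )}$ on $D$ with $\phi^{(T_* )}(t+T_*,x)=\phi^{(T_* )}(t,x)$ on $D$ and $\|\phi^{(T_* )}\|_{C^1(D)}\le C_E\epsilon$.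
   Formalization: The constant C_R may depend on a bound B for the second derivatives of the damping coefficient β (every periodic C² β has one); a C_R uniform over all admissible β does not exist, as rapidly oscillating resonant β show. ε_4 does not depend on β. *)

theory Defs
  imports "HOL-Analysis.Analysis" "HOL-Probability.Essential_Supremum"
begin

section \<open>Classical derivatives on closed domains, and their norms\<close>

text \<open>
  The derivative of f in direction b, taken relative to S. At boundary points of a closed interval
  or rectangle with nonempty interior it is the one-sided derivative. (At a point x that is isolated
  in the intersection of S with the line through x in direction b the value is meaningless; this
  never happens for the sets S used below.) Points of the half strip are pairs (t, x), so Basis
  consists of (1, 0), the direction of t, and (0, 1), the direction of x.
\<close>

definition pderiv_on :: "'a::euclidean_space set \<Rightarrow> 'a \<Rightarrow> ('a \<Rightarrow> real) \<Rightarrow> 'a \<Rightarrow> real" where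
  "pderiv_on S b f x =
     vector_derivative (\<lambda>h. f (x + h *\<^sub>R b)) (at 0 within {h. x + h *\<^sub>R b \<in> S})"

fun Ck_on :: "nat \<Rightarrow> 'a::euclidean_space set \<Rightarrow> ('a \<Rightarrow> real) \<Rightarrow> bool" where
  "Ck_on 0 S f \<longleftrightarrow> continuous_on S f"
| "Ck_on (Suc k) S f \<longleftrightarrow> continuous_on S f \<and>
     (\<forall>b\<in>Basis.
        (\<forall>x\<in>S. (\<lambda>h. f (x + h *\<^sub>R b)) differentiable (at 0 within {h. x + h *\<^sub>R b \<in> S})) \<and>
        Ck_on k S (pderiv_on S b f))"

definition sup_norm :: "'a set \<Rightarrow> ('a \<Rightarrow> real) \<Rightarrow> ereal" where
  "sup_norm S f = (SUP x\<in>S. ereal \<bar>f x\<bar>)"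

definition C1_norm :: "'a::euclidean_space set \<Rightarrow> ('a \<Rightarrow> real) \<Rightarrow> ereal" where
  "C1_norm S f = max (sup_norm S f) (SUP b\<in>Basis. sup_norm S (pderiv_on S b f))"


section \<open>Weak derivatives and the Sobolev spaces $W^{k,\infty}$\<close>

text \<open>A list of basis vectors plays the role of a multi-index; its length is the order.\<close>

definition iter_pderiv :: "'a::euclidean_space list \<Rightarrow> ('a \<Rightarrow> real) \<Rightarrow> 'a \<Rightarrow> real" where
  "iter_pderiv bs f = foldr (pderiv_on UNIV) bs f"

definition test_function :: "'a::euclidean_space set \<Rightarrow> ('a \<Rightarrow> real) \<Rightarrow> bool" where
  "test_function U \<psi> \<longleftrightarrow> (\<forall>k. Ck_on k UNIV \<psi>) \<and>
     compact (closure {x. \<psi> x \<noteq> 0}) \<and> closure {x. \<psi> x \<noteq> 0} \<subseteq> U"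

definition locally_integrable :: "'a::euclidean_space set \<Rightarrow> ('a \<Rightarrow> real) \<Rightarrow> bool" where
  "locally_integrable U f \<longleftrightarrow> (\<forall>K. compact K \<and> K \<subseteq> U \<longrightarrow> integrable (lebesgue_on K) f)"

definition has_weak_deriv ::
  "'a::euclidean_space set \<Rightarrow> 'a list \<Rightarrow> ('a \<Rightarrow> real) \<Rightarrow> ('a \<Rightarrow> real) \<Rightarrow> bool" where
  "has_weak_deriv U bs f g \<longleftrightarrow> locally_integrable U f \<and> locally_integrable U g \<and>
     (\<forall>\<psi>. test_function U \<psi> \<longrightarrow>
        (LINT x|lebesgue_on U. f x * iter_pderiv bs \<psi> x) =
        (-1) ^ length bs * (LINT x|lebesgue_on U. g x * \<psi> x))"

definition Linf_norm :: "'a::euclidean_space set \<Rightarrow> ('a \<Rightarrow> real) \<Rightarrow> ereal" where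
  "Linf_norm U g = esssup (lebesgue_on U) (\<lambda>x. ereal \<bar>g x\<bar>)"

definition Wk_inf :: "nat \<Rightarrow> 'a::euclidean_space set \<Rightarrow> ('a \<Rightarrow> real) \<Rightarrow> bool" where
  "Wk_inf k U f \<longleftrightarrow> (\<forall>bs. set bs \<subseteq> Basis \<and> length bs \<le> k \<longrightarrow>
     (\<exists>g. has_weak_deriv U bs f g \<and> Linf_norm U g < \<infinity>))"

text \<open>
  The weak derivative along bs exists and has norm at most C in the space $L^\infty$. Weak
  derivatives are unique almost everywhere, so it does not matter which one is taken.
\<close>

definition weak_deriv_Linf_le ::
  "'a::euclidean_space set \<Rightarrow> 'a list \<Rightarrow> ('a \<Rightarrow> real) \<Rightarrow> real \<Rightarrow> bool" where
  "weak_deriv_Linf_le U bs f C \<longleftrightarrow> (\<exists>g. has_weak_deriv U bs f g \<and> Linf_norm U g \<le> ereal C)"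


section \<open>The initial-boundary value problem\<close>

definition lam1 :: "real \<Rightarrow> real \<times> real \<Rightarrow> real" where
  "lam1 \<gamma> = (\<lambda>(m, n). (\<gamma> + 1) / 2 * m + (3 - \<gamma>) / 2 * n)"

definition lam2 :: "real \<Rightarrow> real \<times> real \<Rightarrow> real" where
  "lam2 \<gamma> = (\<lambda>(m, n). (3 - \<gamma>) / 2 * m + (\<gamma> + 1) / 2 * n)"

definition background :: "real \<Rightarrow> real \<Rightarrow> real \<times> real" where
  "background \<gamma> \<rho> =
     (let n = sqrt \<gamma> / (\<gamma> - 1) * \<rho> powr ((\<gamma> - 1) / 2) in (- n, n))"

definition strip :: "real \<Rightarrow> (real \<times> real) set" where
  "strip L = {0..} \<times> {0..L}"

definition strip_interior :: "real \<Rightarrow> (real \<times> real) set" where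
  "strip_interior L = {0<..} \<times> {0<..<L}"

definition damping :: "real \<Rightarrow> real \<Rightarrow> real \<Rightarrow> real \<Rightarrow> (real \<times> real \<Rightarrow> real) \<Rightarrow> bool" where
  "damping L T \<beta>\<^sub>0 \<epsilon> \<beta> \<longleftrightarrow> Ck_on 2 (strip L) \<beta> \<and>
     (\<forall>p\<in>strip L. \<beta>\<^sub>0 \<le> \<beta> p \<and> \<beta> p \<le> 0 \<and>
        \<bar>pderiv_on (strip L) (1, 0) \<beta> p\<bar> \<le> \<epsilon> \<and> \<bar>pderiv_on (strip L) (0, 1) \<beta> p\<bar> \<le> \<epsilon>) \<and>
     (\<forall>(t, x)\<in>strip L. \<beta> (t + T, x) = \<beta> (t, x))"

definition boundary_datum :: "real \<Rightarrow> real \<Rightarrow> (real \<Rightarrow> real) \<Rightarrow> bool" where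
  "boundary_datum T \<epsilon> b \<longleftrightarrow>
     Ck_on 1 {0..} b \<and> (\<forall>t>0. b (t + T) = b t) \<and> C1_norm {0..} b \<le> ereal \<epsilon>"

text \<open>
  Arguments: the damping coefficient, the boundary data b1 (imposed on the first component at
  x = L) and b2 (imposed on the second component at x = 0), the components f1, f2 of the initial
  datum, and the components u1, u2 of the unknown.
\<close>

definition ibvp ::
  "real \<Rightarrow> real \<Rightarrow> real \<Rightarrow> real \<Rightarrow> real \<Rightarrow> (real \<times> real \<Rightarrow> real) \<Rightarrow>
   (real \<Rightarrow> real) \<Rightarrow> (real \<Rightarrow> real) \<Rightarrow> (real \<Rightarrow> real) \<Rightarrow> (real \<Rightarrow> real) \<Rightarrow>
   (real \<times> real \<Rightarrow> real) \<Rightarrow> (real \<times> real \<Rightarrow> real) \<Rightarrow> bool" where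
  "ibvp \<gamma> \<rho> L \<kappa>\<^sub>1 \<kappa>\<^sub>2 \<beta> b1 b2 f1 f2 u1 u2 \<longleftrightarrow>
     (\<forall>p\<in>strip L.
        pderiv_on (strip L) (1, 0) u1 p +
          lam1 \<gamma> ((u1 p, u2 p) + background \<gamma> \<rho>) * pderiv_on (strip L) (0, 1) u1 p
          = \<beta> p / 2 * (u1 p + u2 p) \<and>
        pderiv_on (strip L) (1, 0) u2 p +
          lam2 \<gamma> ((u1 p, u2 p) + background \<gamma> \<rho>) * pderiv_on (strip L) (0, 1) u2 p
          = \<beta> p / 2 * (u1 p + u2 p)) \<and>
     (\<forall>x\<in>{0..L}. u1 (0, x) = f1 x \<and> u2 (0, x) = f2 x) \<and>
     (\<forall>t\<ge>0. u2 (t, 0) = b2 t + \<kappa>\<^sub>2 * u1 (t, 0) \<and> u1 (t, L) = b1 t + \<kappa>\<^sub>1 * u2 (t, L))"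

text \<open>
  What the existence property provides: an initial datum (f1, f2) and a time-periodic solution
  (u1, u2), both with C1 norm at most K (which will be the constant of the existence property
  times epsilon).
\<close>

definition periodic_solution ::
  "real \<Rightarrow> real \<Rightarrow> real \<Rightarrow> real \<Rightarrow> real \<Rightarrow> real \<Rightarrow> real \<Rightarrow> (real \<times> real \<Rightarrow> real) \<Rightarrow>
   (real \<Rightarrow> real) \<Rightarrow> (real \<Rightarrow> real) \<Rightarrow> (real \<Rightarrow> real) \<Rightarrow> (real \<Rightarrow> real) \<Rightarrow>
   (real \<times> real \<Rightarrow> real) \<Rightarrow> (real \<times> real \<Rightarrow> real) \<Rightarrow> bool" where
  "periodic_solution \<gamma> \<rho> L T \<kappa>\<^sub>1 \<kappa>\<^sub>2 K \<beta> b1 b2 f1 f2 u1 u2 \<longleftrightarrow>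
     Ck_on 1 {0..L} f1 \<and> Ck_on 1 {0..L} f2 \<and>
     max (C1_norm {0..L} f1) (C1_norm {0..L} f2) \<le> ereal K \<and>
     Ck_on 1 (strip L) u1 \<and> Ck_on 1 (strip L) u2 \<and>
     ibvp \<gamma> \<rho> L \<kappa>\<^sub>1 \<kappa>\<^sub>2 \<beta> b1 b2 f1 f2 u1 u2 \<and>
     (\<forall>(t, x)\<in>strip L. u1 (t + T, x) = u1 (t, x) \<and> u2 (t + T, x) = u2 (t, x)) \<and>
     max (C1_norm (strip L) u1) (C1_norm (strip L) u2) \<le> ereal K"

text \<open>
  The damping coefficient is constrained by the same epsilon as the boundary data, so it is
  quantified after epsilon; the threshold and the constant do not depend on it.
\<close>

definition existence_property ::
  "real \<Rightarrow> real \<Rightarrow> real \<Rightarrow> real \<Rightarrow> real \<Rightarrow> real \<Rightarrow> real \<Rightarrow> real \<Rightarrow> real \<Rightarrow> bool" where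
  "existence_property \<gamma> \<rho> L T \<beta>\<^sub>0 \<kappa>\<^sub>1 \<kappa>\<^sub>2 \<epsilon>\<^sub>1 C\<^sub>E \<longleftrightarrow> \<epsilon>\<^sub>1 > 0 \<and> C\<^sub>E > 0 \<and>
     (\<forall>\<epsilon> \<beta> b1 b2. 0 < \<epsilon> \<and> \<epsilon> < \<epsilon>\<^sub>1 \<and> damping L T \<beta>\<^sub>0 \<epsilon> \<beta> \<and>
        boundary_datum T \<epsilon> b1 \<and> boundary_datum T \<epsilon> b2 \<longrightarrow>
        (\<exists>f1 f2 u1 u2. periodic_solution \<gamma> \<rho> L T \<kappa>\<^sub>1 \<kappa>\<^sub>2 (C\<^sub>E * \<epsilon>) \<beta> b1 b2 f1 f2 u1 u2))"

text \<open>
  A bound on the second derivatives of the damping coefficient. Every periodic C2 coefficient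
  satisfies one.
\<close>

definition second_derivs_le :: "real \<Rightarrow> (real \<times> real \<Rightarrow> real) \<Rightarrow> real \<Rightarrow> bool" where
  "second_derivs_le L \<beta> B \<longleftrightarrow>
     (\<forall>b\<in>Basis. \<forall>c\<in>Basis.
        sup_norm (strip L) (pderiv_on (strip L) b (pderiv_on (strip L) c \<beta>)) \<le> ereal B)"

end

theory Submission
  imports Defs
begin

text \<open>
  Write w = u_t for a component u of the solution, a for the reciprocal of its characteristic speed
  and F for a \<beta> (u1 + u2)/2, so that u_x + a w = F. The difference quotients of u in t are C1 and solve
  a transport equation with the same a, whose source converges uniformly to F_t - a_t w; hence neither
  second derivatives of u nor characteristics are needed. One maximises the doubled differences
  W_i(t, x) - W_i(s, x) of these quotients, divided by p_i(x) sqrt((t - s)^2 + \<eta>^2), over i, t, s, x.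
  By periodicity the maximum is attained at interior times, where the first order conditions express the
  transport operator applied to W_i through p_i and the penalty. As the damping is dissipative for the
  maximum norm, as |\<kappa>_i| < 1, and as the quadratic terms carry a factor \<epsilon>, the maximum is bounded
  independently of \<eta> and of the step of the quotients, and w is Lipschitz in t. The equation and the
  symmetry of mixed differences then give the Lipschitz bounds for u_t and u_x in both variables.

  The boundary data enter through the Lipschitz constant of b_i', which is obtained by testing the weak
  second derivative against the difference of two smooth steps. Conversely, a function f that is
  Lipschitz in t has a bounded weak t-derivative: the pullback of Lebesgue measure under the monotone
  change of variable t + c f is absolutely continuous, and its Radon-Nikodym density is 1 + c f_t.
\<close>

section \<open>Bounded weak derivatives of Lipschitz functions\<close>

text \<open>With x as evolution variable, the damping is only weakly dissipative in the maximum
  norm: it lets no maximum grow, but leaves no margin to absorb the quadratic terms. The margin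
  comes from the weights p1 = 1 - \<delta> exp(m x) and p2 = 1 + \<delta> exp(m x), each growing in
  the direction in which its component travels. This costs twice: as the weights differ, the damping
  leaves a remainder of the wrong sign, paid by a large m; and at x = L the reflection passes from
  the larger weight to the smaller, paid by 1 - |\<kappa>1|. So m and \<delta> are fixed first, from
  \<open>A\<^sub>0\<close>, the bound of \<beta>, L and the reflection coefficients, and the
  threshold on \<epsilon> follows from \<delta>. Second derivatives of \<beta> and of the data enter
  only as additive multiples of |t - s|: they raise the final constant but do not lower the
  threshold. The quotients approximate w up to an error that the penalty, which is at least \<eta>,
  has to dominate; an error \<eta>^2 has a share that vanishes with \<eta>.\<close>

lemma derivative_of_locally_constant:
  fixes f :: "real \<Rightarrow> real"
  assumes "(f has_real_derivative D) (at t)" "open U" "t \<in> U" "\<And>s. s \<in> U \<Longrightarrow> f s = c"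
  shows "D = 0"
proof -
  have "eventually (\<lambda>y. y \<in> U) (nhds t)"
    using assms(2,3) by (rule eventually_nhds_in_open)
  then have "eventually (\<lambda>y. f y = (\<lambda>_. c) y) (nhds t)"
    by eventually_elim (rule assms(4))
  then have "(f has_real_derivative D) (at t) \<longleftrightarrow> ((\<lambda>_. c) has_real_derivative D) (at t)"
    by (intro DERIV_cong_ev) auto
  then show ?thesis using assms(1) DERIV_unique[OF _ DERIV_const] by blast
qed

lemma derivative_zero_outside:
  fixes \<psi> \<psi>' :: "real \<Rightarrow> real"
  assumes "(\<psi> has_real_derivative \<psi>' t) (at t)"
    and supp: "\<And>t. \<psi> t \<noteq> 0 \<Longrightarrow> \<bar>t\<bar> < R" and "\<bar>t\<bar> > R"
  shows "\<psi>' t = 0"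
proof (rule derivative_of_locally_constant[OF assms(1)])
  show "open {t::real. \<bar>t\<bar> > R}" by (intro open_Collect_less continuous_intros)
  show "\<psi> s = 0" if "s \<in> {t. \<bar>t\<bar> > R}" for s using that supp[of s] by force
qed (use assms in simp)

section \<open>Test functions of the first variable and fibrewise pullbacks of Lebesgue
  measure\<close>

lemma integrable_continuous_support:
  fixes q v :: "real \<times> real \<Rightarrow> real"
  assumes "continuous_on UNIV q" "continuous_on UNIV v"
    and "\<And>p. p \<notin> {-R..R} \<times> {-R..R} \<Longrightarrow> v p = 0"
  shows "integrable lborel (\<lambda>p. q p * v p)"
proof -
  let ?K = "{-R..R} \<times> {-R..R}"
  have "compact ?K" by (intro compact_Times) auto
  then have "integrable lborel (\<lambda>p. indicator ?K p *\<^sub>R (q p * v p))"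
    by (rule borel_integrable_compact)
      (intro continuous_intros continuous_on_subset[OF assms(1)] continuous_on_subset[OF assms(2)], auto)
  moreover have "(\<lambda>p. indicator ?K p *\<^sub>R (q p * v p)) = (\<lambda>p. q p * v p)"
    using assms(3) by (fastforce simp: indicator_def)
  ultimately show ?thesis by simp
qed

text \<open>Regularity is asked in the first variable only, and the derivative is supplied as data;
  the second variable is then reached by composing with \<open>prod.swap\<close>, without a second
  copy of the theory.\<close>

definition fst_test :: "real \<Rightarrow> (real \<times> real \<Rightarrow> real) \<Rightarrow> (real \<times> real \<Rightarrow> real) \<Rightarrow> bool" where
  "fst_test R \<psi> \<psi>' \<longleftrightarrow> (\<forall>t x. ((\<lambda>t. \<psi> (t, x)) has_real_derivative \<psi>' (t, x)) (at t)) \<and>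
     continuous_on UNIV \<psi> \<and> continuous_on UNIV \<psi>' \<and>
     (\<forall>p. \<psi> p \<noteq> 0 \<longrightarrow> \<bar>fst p\<bar> < R \<and> \<bar>snd p\<bar> < R)"

lemma fst_test_zero:
  assumes "fst_test R \<psi> \<psi>'" "p \<notin> {-R..R} \<times> {-R..R}"
  shows "\<psi> p = 0" "\<psi>' p = 0"
proof -
  obtain t x where p: "p = (t, x)" by (cases p)
  show "\<psi> p = 0" using assms by (auto simp: fst_test_def p) force+
  have der: "((\<lambda>t. \<psi> (t, x)) has_real_derivative \<psi>' (t, x)) (at t)"
    using assms by (auto simp: fst_test_def)
  show "\<psi>' p = 0"
  proof (cases "x \<in> {-R..R}")
    case False
    then have "\<psi> (s, x) = 0" for s using assms(1) by (force simp: fst_test_def)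
    then show ?thesis using der DERIV_unique[OF _ DERIV_const] by (simp add: p)
  next
    case True
    then show ?thesis
      using derivative_zero_outside[of "\<lambda>t. \<psi> (t, x)" "\<lambda>t. \<psi>' (t, x)" t R] assms der
      by (force simp: p fst_test_def)
  qed
qed

text \<open>F is the new coordinate on the fibre over x. It is used with (t + f/c)/2 and (t -
  f/c)/2, where f/c has Lipschitz constant 1/2 in t: the slopes lie in [1/4, 3/4], hence the 1/4.
  The lower bound makes each fibre map a bijection of the line without any
  differentiability.\<close>

locale fibre_expansion =
  fixes F :: "real \<Rightarrow> real \<Rightarrow> real"
  assumes cont: "continuous_on UNIV (\<lambda>p. F (fst p) (snd p))"
    and grow: "\<And>a b x. a \<le> b \<Longrightarrow> (b - a) / 4 \<le> F b x - F a x"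
begin

definition fibre_inv :: "real \<Rightarrow> real \<Rightarrow> real" where
  "fibre_inv s x = (THE t. F t x = s)"

text \<open>This measure gives the fibre interval (a, b) the length F b x - F a x, integrated over
  x. Formally it is the t-derivative of F times Lebesgue measure, so its density is a candidate for
  the weak derivative.\<close>

definition fibre_measure :: "(real \<times> real) measure" where
  "fibre_measure = distr lborel borel (\<lambda>p. (fibre_inv (fst p) (snd p), snd p))"

lemma strict: "a < b \<Longrightarrow> F a x < F b x"
  using grow[of a b x] by simp

lemma less_iff: "F a x < F b x \<longleftrightarrow> a < b"
  by (metis strict less_asym linorder_cases)

lemma fibre_cont: "continuous_on A (\<lambda>t. F t x)"
proof -
  have "continuous_on A ((\<lambda>p. F (fst p) (snd p)) \<circ> (\<lambda>t. (t, x)))"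
    by (intro continuous_on_compose continuous_on_subset[OF cont] continuous_intros) auto
  then show ?thesis by (simp add: o_def)
qed

lemma base_cont: "continuous_on A (F t)"
proof -
  have "continuous_on A ((\<lambda>p. F (fst p) (snd p)) \<circ> (\<lambda>x. (t, x)))"
    by (intro continuous_on_compose continuous_on_subset[OF cont] continuous_intros) auto
  then show ?thesis by (simp add: o_def)
qed

lemma fibre_inv_right: "F (fibre_inv s x) x = s"
proof -
  \<comment> \<open>Over a length r the growth bound moves F by at least r/4, the distance from F 0
    x to s, so [-r, r] brackets a solution.\<close>
  define r where "r = 4 * \<bar>s - F 0 x\<bar>"
  have "r \<ge> 0" by (simp add: r_def)
  have "F (- r) x \<le> s" "s \<le> F r x"
    using grow[of "- r" 0 x] grow[of 0 r x] \<open>r \<ge> 0\<close> by (auto simp: r_def)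
  then obtain t where "F t x = s"
    using IVT'[of "\<lambda>t. F t x" "- r" s r] fibre_cont \<open>r \<ge> 0\<close> by auto
  moreover have "u = t" if "F u x = s" "F t x = s" for u t
    using less_iff[of u x t] less_iff[of t x u] that by linarith
  ultimately show ?thesis
    unfolding fibre_inv_def by (intro theI[of "\<lambda>t. F t x = s"]) auto
qed

lemma fibre_inv_le_iff: "fibre_inv s x \<le> t \<longleftrightarrow> s \<le> F t x"
  using less_iff[of t x "fibre_inv s x"] fibre_inv_right[of s x] by force

lemma fibre_inv_less_iff: "fibre_inv s x < t \<longleftrightarrow> s < F t x"
  using less_iff[of "fibre_inv s x" x t] fibre_inv_right[of s x] by force

lemma F_measurable[measurable]: "(\<lambda>p. F (fst p) (snd p)) \<in> borel_measurable borel"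
  using cont by (rule borel_measurable_continuous_onI)

lemma F_base_measurable[measurable]: "F t \<in> borel_measurable borel"
  using base_cont by (rule borel_measurable_continuous_onI)

text \<open>The sublevel sets of the inverse are the closed sets s \<le> F t x, so joint
  measurability needs no continuity of the inverse.\<close>

lemma fibre_inv_measurable[measurable]:
  "(\<lambda>p. fibre_inv (fst p) (snd p)) \<in> borel_measurable borel"
proof (rule borel_measurableI_le)
  fix t
  have "{p. fst p \<le> F t (snd p)} \<in> sets (borel :: (real \<times> real) measure)"
    using continuous_on_compose2[OF base_cont[of UNIV t] continuous_on_snd[OF continuous_on_id]]
    by (intro borel_closed closed_Collect_le continuous_on_fst continuous_on_id) auto
  then show "{p \<in> space borel. fibre_inv (fst p) (snd p) \<le> t} \<in> sets borel"
    by (simp add: fibre_inv_le_iff)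
qed

lemma fibre_map_measurable[measurable]:
  "(\<lambda>p. (fibre_inv (fst p) (snd p), snd p)) \<in> borel \<rightarrow>\<^sub>M borel"
proof -
  have "(\<lambda>p. snd p) \<in> borel_measurable (borel :: (real \<times> real) measure)"
    unfolding borel_prod[symmetric] by measurable
  then have "(\<lambda>p. (fibre_inv (fst p) (snd p), snd p)) \<in> borel \<rightarrow>\<^sub>M borel \<Otimes>\<^sub>M borel"
    by (intro measurable_Pair fibre_inv_measurable)
  then show ?thesis by (simp add: borel_prod)
qed

lemma sets_fibre_measure[simp]: "sets fibre_measure = sets borel"
  by (simp add: fibre_measure_def)

lemma emeasure_fibre_box:
  assumes "a \<le> b"
  shows "emeasure fibre_measure (box (a, c) (b, d)) =
    (\<integral>\<^sup>+x\<in>{c<..<d}. ennreal (F b x - F a x) \<partial>lborel)"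
proof -
  have *: "box (a, c) (b, d) = {a<..<b} \<times> {c<..<d}"
    by (auto simp: box_def Basis_prod_def)
  let ?S = "(\<lambda>p. (fibre_inv (fst p) (snd p), snd p)) -` (box (a, c) (b, d))"
  have meas: "?S \<in> sets (lborel \<Otimes>\<^sub>M lborel)"
    using measurable_sets[OF fibre_map_measurable, of "box (a, c) (b, d)"]
    unfolding lborel_prod by (simp add: borel_open)
  have gr: "F a x < fst (s, x) \<longleftrightarrow> a < fibre_inv s x" for s x
    by (simp add: fibre_inv_le_iff flip: not_le)
  have "emeasure fibre_measure (box (a, c) (b, d)) = emeasure (lborel \<Otimes>\<^sub>M lborel) ?S"
    unfolding fibre_measure_def by (subst emeasure_distr) (auto simp: lborel_prod borel_open)
  also have "\<dots> = (\<integral>\<^sup>+x. emeasure lborel ((\<lambda>s. (s, x)) -` ?S) \<partial>lborel)"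
    by (rule lborel_pair.emeasure_pair_measure_alt2[OF meas])
  also have "\<dots> = (\<integral>\<^sup>+x\<in>{c<..<d}. ennreal (F b x - F a x) \<partial>lborel)"
  proof (rule nn_integral_cong)
    fix x
    have "(\<lambda>s. (s, x)) -` ?S = (if x \<in> {c<..<d} then {F a x<..<F b x} else {})"
      using gr by (auto simp: * fibre_inv_less_iff)
    moreover have "F a x \<le> F b x" using grow[OF assms, of x] assms by simp
    ultimately show "emeasure lborel ((\<lambda>s. (s, x)) -` ?S) =
        ennreal (F b x - F a x) * indicator {c<..<d} x"
      by simp
  qed
  finally show ?thesis .
qed

text \<open>Write \<phi> at \<open>fibre_inv s x\<close> as minus the integral of \<phi>' from there
  up to R. In terms of s the range of r is s < F r x, so exchanging the integrals and integrating in
  s from F(-R) x to F r x leaves \<phi>' r times F r x - F(-R) x; the constant drops out because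
  \<phi>' has integral 0.\<close>

lemma fibre_by_parts:
  assumes der: "\<And>t. (\<phi> has_real_derivative \<phi>' t) (at t)" and cd: "continuous_on UNIV \<phi>'"
    and supp: "\<And>t. \<phi> t \<noteq> 0 \<Longrightarrow> \<bar>t\<bar> < R"
  shows "(\<integral>s. \<phi> (fibre_inv s x) \<partial>lborel) = - (\<integral>t. F t x * \<phi>' t \<partial>lborel)"
proof (cases "R > 0")
  case False
  then have 0: "\<phi> t = 0" for t using supp[of t] by force
  then have "\<phi> = (\<lambda>_. 0)" by auto
  then have "\<phi>' t = 0" for t using der[of t] DERIV_unique[of "\<lambda>_. 0" "\<phi>' t" t 0] by simp
  with 0 show ?thesis by simp
next
  case R: True
  let ?s0 = "F (- R) x" and ?s1 = "F R x"
  have d0: "\<phi>' t = 0" if "\<bar>t\<bar> > R" for t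
    using derivative_zero_outside[of \<phi> \<phi>' t R] der supp that by blast
  have ftc: "(\<integral>r. \<phi>' r * indicator {a..R} r \<partial>lborel) = \<phi> R - \<phi> a" if "a \<le> R" for a
  proof -
    have "(\<phi>' has_integral (\<phi> R - \<phi> a)) {a..R}"
      by (rule fundamental_theorem_of_calculus[OF that])
        (use der in \<open>auto simp: has_real_derivative_iff_has_vector_derivative[symmetric] intro: has_field_derivative_at_within\<close>)
    moreover have "set_integrable lborel {a..R} \<phi>'"
      by (rule borel_integrable_atLeastAtMost') (use cd continuous_on_subset in blast)
    ultimately show ?thesis
      using set_borel_integral_eq_integral(2)[of "{a..R}" \<phi>'] 
      by (auto simp: set_lebesgue_integral_def mult.commute integral_unique)
  qed
  have phR: "\<phi> R = 0" "\<phi> (-R) = 0" using supp[of R] supp[of "-R"] R by fastforce+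
  have indp: "\<phi> (fibre_inv s x) = - (\<integral>r. \<phi>' r * indicator {-R..R} r * indicator {..<F r x} s * indicator {?s0..?s1} s \<partial>lborel)"
    for s
  proof (cases "s \<in> {?s0..?s1}")
    case False
    then have "\<bar>fibre_inv s x\<bar> \<ge> R"
      using fibre_inv_le_iff[of s x "-R"] fibre_inv_less_iff[of s x R] fibre_inv_less_iff[of s x "-R"] R by auto
    then have "\<phi> (fibre_inv s x) = 0" using supp by force
    with False show ?thesis by simp
  next
    case True
    then have le: "fibre_inv s x \<le> R" and ge: "- R \<le> fibre_inv s x"
      using fibre_inv_le_iff[of s x R] fibre_inv_less_iff[of s x "-R"] by auto
    have "(\<integral>r. \<phi>' r * indicator {-R..R} r * indicator {..<F r x} s * indicator {?s0..?s1} s \<partial>lborel) =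
        (\<integral>r. \<phi>' r * indicator {fibre_inv s x..R} r \<partial>lborel)"
    \<comment> \<open>The integrands differ at most at r = \<open>fibre_inv s x\<close>, which the
      closed interval contains although s < F r x fails there.\<close>
    proof (rule integral_cong_AE)
      show "AE r in lborel. \<phi>' r * indicator {-R..R} r * indicator {..<F r x} s * indicator {?s0..?s1} s =
          \<phi>' r * indicator {fibre_inv s x..R} r"
        using AE_lborel_singleton[of "fibre_inv s x"]
      proof eventually_elim
        case (elim r)
        then have "s < F r x \<longleftrightarrow> fibre_inv s x \<le> r"
          using fibre_inv_less_iff[of s x r] by auto
        then show ?case using True ge by (auto simp: indicator_def)
      qed
      have [measurable]: "\<phi>' \<in> borel_measurable borel" "(\<lambda>r. F r x) \<in> borel_measurable borel"
        using cd fibre_cont by (auto intro: borel_measurable_continuous_onI)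
      have "(\<lambda>r. indicator {..<F r x} s :: real) = indicator {r. s < F r x}"
        by (auto simp: indicator_def)
      then have [measurable]: "(\<lambda>r. indicator {..<F r x} s :: real) \<in> borel_measurable borel"
        by simp
      show "(\<lambda>r. \<phi>' r * indicator {-R..R} r * indicator {..<F r x} s * indicator {?s0..?s1} s) \<in> borel_measurable lborel"
        by measurable
      show "(\<lambda>r. \<phi>' r * indicator {fibre_inv s x..R} r) \<in> borel_measurable lborel"
        by measurable
    qed
    with ftc[OF le] phR show ?thesis by simp
  qed
  let ?g = "\<lambda>s r. \<phi>' r * indicator {-R..R} r * indicator {..<F r x} s * indicator {?s0..?s1} s"
  obtain B where B: "\<And>r. r \<in> {-R..R} \<Longrightarrow> \<bar>\<phi>' r\<bar> \<le> B"
    using compact_imp_bounded[OF compact_continuous_image[OF continuous_on_subset[OF cd subset_UNIV] compact_Icc]]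
    unfolding bounded_iff by (metis imageI real_norm_def)
  have [measurable]: "\<phi>' \<in> borel_measurable borel" "(\<lambda>r. F r x) \<in> borel_measurable borel"
    using cd fibre_cont by (auto intro: borel_measurable_continuous_onI)
  have ind2: "(\<lambda>(s, r). ?g s r) = (\<lambda>(s, r). \<phi>' r * indicator {-R..R} r * (if s < F r x then 1 else 0) * indicator {?s0..?s1} s)"
    by (auto simp: indicator_def)
  have gm: "(\<lambda>(s, r). ?g s r) \<in> borel_measurable (lborel \<Otimes>\<^sub>M lborel)"
    unfolding ind2 by measurable
  \<comment> \<open>Confining s to [\<open>?s0\<close>, \<open>?s1\<close>] makes the integrand
    bounded with bounded support, as Fubini requires. Nothing is lost, since \<phi> vanishes at
    \<open>fibre_inv s x\<close> for all other s.\<close>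
  have int: "integrable (lborel \<Otimes>\<^sub>M lborel) (\<lambda>(s, r). ?g s r)"
  proof (rule Bochner_Integration.integrable_bound[OF _ gm])
    show "integrable (lborel \<Otimes>\<^sub>M lborel) (\<lambda>p. B * indicator ({?s0..?s1} \<times> {-R..R}) p)"
      by (intro integrable_mult_right integrable_real_indicator)
        (auto simp: lborel.emeasure_pair_measure_Times ennreal_mult_less_top emeasure_lborel_Icc_eq)
    show "AE p in lborel \<Otimes>\<^sub>M lborel. norm (case p of (s, r) \<Rightarrow> ?g s r) \<le> norm (B * indicator ({?s0..?s1} \<times> {-R..R}) p)"
    proof (intro AE_I2)
      fix p :: "real \<times> real"
      obtain s r where p: "p = (s, r)" by (cases p)
      show "norm (case p of (s, r) \<Rightarrow> ?g s r) \<le> norm (B * indicator ({?s0..?s1} \<times> {-R..R}) p)"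
        using B[of r] by (auto simp: p indicator_def abs_mult)
    qed
  qed
  have "(\<integral>s. \<phi> (fibre_inv s x) \<partial>lborel) = - (\<integral>s. (\<integral>r. ?g s r \<partial>lborel) \<partial>lborel)"
    by (simp add: indp)
  also have "\<dots> = - (\<integral>r. (\<integral>s. ?g s r \<partial>lborel) \<partial>lborel)"
    using lborel_pair.Fubini_integral[OF int] by simp
  also have "(\<lambda>r. \<integral>s. ?g s r \<partial>lborel) = (\<lambda>r. F r x * \<phi>' r - ?s0 * (\<phi>' r * indicator {-R..R} r))"
  proof
    fix r
    show "(\<integral>s. ?g s r \<partial>lborel) = F r x * \<phi>' r - ?s0 * (\<phi>' r * indicator {-R..R} r)"
    proof (cases "r \<in> {-R..R}")
      case True
      then have le: "?s0 \<le> F r x" "F r x \<le> ?s1"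
        using less_iff[of r x "-R"] less_iff[of R x r] by force+
      then have "(\<lambda>s. ?g s r) = (\<lambda>s. \<phi>' r * indicator {?s0..<F r x} s)"
        using True by (auto simp: indicator_def fun_eq_iff)
      then show ?thesis using le True by (simp add: algebra_simps)
    next
      case False
      then have "\<bar>r\<bar> > R" by auto
      then show ?thesis using d0[of r] False by simp
    qed
  qed
  also have "(\<integral>r. F r x * \<phi>' r - ?s0 * (\<phi>' r * indicator {-R..R} r) \<partial>lborel) =
      (\<integral>r. F r x * \<phi>' r \<partial>lborel) - ?s0 * (\<integral>r. \<phi>' r * indicator {-R..R} r \<partial>lborel)"
  proof -
    have "set_integrable lborel {-R..R} (\<lambda>r. F r x * \<phi>' r)"
      by (intro borel_integrable_atLeastAtMost' continuous_intros fibre_cont continuous_on_subset[OF cd]) auto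
    moreover have "(\<lambda>r. indicator {-R..R} r *\<^sub>R (F r x * \<phi>' r)) = (\<lambda>r. F r x * \<phi>' r)"
    proof
      fix r
      show "indicator {-R..R} r *\<^sub>R (F r x * \<phi>' r) = F r x * \<phi>' r"
        using d0[of r] by (cases "\<bar>r\<bar> > R") (auto simp: indicator_def)
    qed
    ultimately have 1: "integrable lborel (\<lambda>r. F r x * \<phi>' r)" by (simp add: set_integrable_def)
    have "set_integrable lborel {-R..R} \<phi>'"
      by (intro borel_integrable_atLeastAtMost' continuous_on_subset[OF cd]) auto
    then have 2: "integrable lborel (\<lambda>r. \<phi>' r * indicator {-R..R} r)"
      by (simp add: set_integrable_def mult.commute)
    show ?thesis using 1 2 by simp
  qed
  also have "\<dots> = (\<integral>r. F r x * \<phi>' r \<partial>lborel)"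
    using ftc[of "-R"] R phR by simp
  finally show ?thesis .
qed

lemma fibre_measure_by_parts:
  assumes test: "fst_test R \<psi> \<psi>'" and int: "integrable fibre_measure \<psi>"
  shows "integral\<^sup>L fibre_measure \<psi> = - (\<integral>p. F (fst p) (snd p) * \<psi>' p \<partial>lborel)"
proof -
  have c: "continuous_on UNIV \<psi>" "continuous_on UNIV \<psi>'" and
    der: "\<And>t x. ((\<lambda>t. \<psi> (t, x)) has_real_derivative \<psi>' (t, x)) (at t)" and
    supp: "\<And>p. \<psi> p \<noteq> 0 \<Longrightarrow> \<bar>fst p\<bar> < R \<and> \<bar>snd p\<bar> < R"
    using test by (auto simp: fst_test_def)
  have [measurable]: "\<psi> \<in> borel_measurable borel"
    using c by (auto intro: borel_measurable_continuous_onI)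
  have i: "integrable lborel (\<lambda>p. \<psi> (fibre_inv (fst p) (snd p), snd p))"
    using int unfolding fibre_measure_def by (subst (asm) integrable_distr_eq) auto
  have "integral\<^sup>L fibre_measure \<psi> = (\<integral>p. \<psi> (fibre_inv (fst p) (snd p), snd p) \<partial>lborel)"
    unfolding fibre_measure_def by (subst integral_distr) auto
  also have "\<dots> = (\<integral>x. \<integral>s. \<psi> (fibre_inv s x, x) \<partial>lborel \<partial>lborel)"
    using lborel_pair.integral_snd[of "\<lambda>s x. \<psi> (fibre_inv s x, x)"] i
    unfolding lborel_prod by (simp add: case_prod_unfold)
  also have "\<dots> = (\<integral>x. - (\<integral>t. F t x * \<psi>' (t, x) \<partial>lborel) \<partial>lborel)"
  proof (intro Bochner_Integration.integral_cong refl)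
    fix x
    have "continuous_on UNIV (\<lambda>t. \<psi>' (t, x))"
      by (intro continuous_on_compose2[OF c(2)] continuous_intros) auto
    then show "(\<integral>s. \<psi> (fibre_inv s x, x) \<partial>lborel) = - (\<integral>t. F t x * \<psi>' (t, x) \<partial>lborel)"
      by (intro fibre_by_parts[of "\<lambda>t. \<psi> (t, x)" _ R]) (use der supp in auto)
  qed
  also have "\<dots> = - (\<integral>p. F (fst p) (snd p) * \<psi>' p \<partial>lborel)"
  proof -
    have "integrable lborel (\<lambda>p. F (fst p) (snd p) * \<psi>' p)"
      by (rule integrable_continuous_support[OF cont c(2)]) (rule fst_test_zero[OF test])
    then show ?thesis
      using lborel_pair.integral_snd[of "\<lambda>t x. F t x * \<psi>' (t, x)"]
      unfolding lborel_prod by (simp add: case_prod_unfold)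
  qed
  finally show ?thesis .
qed

end

section \<open>Lebesgue measure as the sum of two pullbacks\<close>

lemma emeasure_add_measure:
  fixes M N :: "'a measure"
  assumes "sets M = sets N" "A \<in> sets M"
  shows "emeasure (measure_of (space M) (sets M) (\<lambda>A. emeasure M A + emeasure N A)) A =
    emeasure M A + emeasure N A"
proof (rule emeasure_measure_of_sigma[OF sets.sigma_algebra_axioms _ _ assms(2)])
  show "positive (sets M) (\<lambda>A. emeasure M A + emeasure N A)"
    by (simp add: positive_def)
  show "countably_additive (sets M) (\<lambda>A. emeasure M A + emeasure N A)"
  proof (rule countably_additiveI)
    fix A :: "nat \<Rightarrow> 'a set"
    assume A: "range A \<subseteq> sets M" "disjoint_family A"
    then have "(\<Sum>i. emeasure M (A i)) = emeasure M (\<Union>i. A i)"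
        "(\<Sum>i. emeasure N (A i)) = emeasure N (\<Union>i. A i)"
      using assms(1) by (auto intro!: suminf_emeasure)
    then show "(\<Sum>i. emeasure M (A i) + emeasure N (A i)) = emeasure M (\<Union>i. A i) + emeasure N (\<Union>i. A i)"
      by (subst suminf_add[symmetric]) auto
  qed
qed

text \<open>The two stretched coordinates (t + f/c)/2 and (t - f/c)/2 add up to t, so their pullbacks of
  Lebesgue measure add up to Lebesgue measure; the density of the first one encodes the derivative.\<close>

lemma bounded_weak_derivative_fst:
  fixes f :: "real \<times> real \<Rightarrow> real"
  assumes cf: "continuous_on UNIV f"
    and lip: "\<And>t s x. \<bar>f (t, x) - f (s, x)\<bar> \<le> C * \<bar>t - s\<bar>"
  shows "\<exists>g. g \<in> borel_measurable borel \<and> (\<forall>p. \<bar>g p\<bar> \<le> 2 * (\<bar>C\<bar> + 1)) \<and>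
    (\<forall>\<psi> \<psi>' R. fst_test R \<psi> \<psi>' \<longrightarrow>
      (\<integral>p. f p * \<psi>' p \<partial>lborel) = - (\<integral>p. g p * \<psi> p \<partial>lborel))"
proof -
  \<comment> \<open>This makes f/c Lipschitz in t with constant 1/2, and keeps c positive even for C
    = 0.\<close>
  define c where "c = 2 * (\<bar>C\<bar> + 1)"
  have c: "c > 0" "2 * \<bar>C\<bar> \<le> c" by (auto simp: c_def)
  define F where "F = (\<lambda>t x. (t + f (t, x) / c) / 2)"
  define G where "G = (\<lambda>t x. (t - f (t, x) / c) / 2)"
  have slope: "\<bar>f (b, x) / c - f (a, x) / c\<bar> \<le> (b - a) / 2" if "a \<le> b" for a b x
  proof -
    have "\<bar>f (b, x) - f (a, x)\<bar> \<le> C * (b - a)" using lip[of b x a] that by simp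
    also have "\<dots> \<le> (c / 2) * (b - a)" using c that by (intro mult_right_mono) auto
    finally show ?thesis using c
      by (simp add: field_simps flip: diff_divide_distrib)
  qed
  interpret F: fibre_expansion F
  proof
    show "continuous_on UNIV (\<lambda>p. F (fst p) (snd p))"
      unfolding F_def using c by (auto intro!: continuous_intros cf)
    show "(b - a) / 4 \<le> F b x - F a x" if "a \<le> b" for a b x
      using slope[OF that, of x] by (simp add: F_def abs_le_iff) argo
  qed
  interpret G: fibre_expansion G
  proof
    show "continuous_on UNIV (\<lambda>p. G (fst p) (snd p))"
      unfolding G_def using c by (auto intro!: continuous_intros cf)
    show "(b - a) / 4 \<le> G b x - G a x" if "a \<le> b" for a b x
      using slope[OF that, of x] by (simp add: G_def abs_le_iff) argo
  qed
  \<comment> \<open>With the identity as fibre map the pullback is Lebesgue measure itself; it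
    yields the integration by parts against the bare coordinate t in fact \<open>B\<close>.\<close>
  interpret I: fibre_expansion "\<lambda>t x. t"
    by standard (auto intro!: continuous_intros)
  define N where "N = measure_of (space F.fibre_measure) (sets F.fibre_measure)
    (\<lambda>A. emeasure F.fibre_measure A + emeasure G.fibre_measure A)"
  have N: "emeasure N A = emeasure F.fibre_measure A + emeasure G.fibre_measure A" if "A \<in> sets borel" for A
    unfolding N_def using that by (intro emeasure_add_measure) auto
  have setsN: "sets N = sets borel"
    using sets.sets_measure_of_eq[of F.fibre_measure] unfolding N_def by simp
  have lN: "lborel = N"
  proof (rule lborel_eqI[OF _ setsN])
    fix l u :: "real \<times> real" assume lu: "\<And>b. b \<in> Basis \<Longrightarrow> l \<bullet> b \<le> u \<bullet> b"
    obtain a c where l: "l = (a, c)" by (cases l)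
    obtain b d where u: "u = (b, d)" by (cases u)
    have ab: "a \<le> b" "c \<le> d" using lu[of "(1, 0)"] lu[of "(0, 1)"] by (auto simp: l u Basis_prod_def)
    have ab': "F a x \<le> F b x" "G a x \<le> G b x" for x
      using F.grow[OF ab(1), of x] G.grow[OF ab(1), of x] ab by auto
    have "emeasure N (box l u) = (\<integral>\<^sup>+x\<in>{c<..<d}. ennreal (F b x - F a x) \<partial>lborel) +
        (\<integral>\<^sup>+x\<in>{c<..<d}. ennreal (G b x - G a x) \<partial>lborel)"
      using F.emeasure_fibre_box[OF ab(1)] G.emeasure_fibre_box[OF ab(1)]
      by (subst N) (auto simp: l u borel_open)
    also have "\<dots> = (\<integral>\<^sup>+x. ennreal (F b x - F a x) * indicator {c<..<d} x +
        ennreal (G b x - G a x) * indicator {c<..<d} x \<partial>lborel)"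
      by (subst nn_integral_add) auto
    also have "\<dots> = (\<integral>\<^sup>+x. ennreal (b - a) * indicator {c<..<d} x \<partial>lborel)"
    proof (rule nn_integral_cong)
      fix x
      have "F b x - F a x + (G b x - G a x) = b - a"
        by (simp add: F_def G_def diff_divide_distrib add_divide_distrib)
      then have "ennreal (F b x - F a x) + ennreal (G b x - G a x) = ennreal (b - a)"
        using ab'[of x] by (subst ennreal_plus[symmetric]) auto
      then show "ennreal (F b x - F a x) * indicator {c<..<d} x + ennreal (G b x - G a x) * indicator {c<..<d} x
          = ennreal (b - a) * indicator {c<..<d} x"
        by (simp add: indicator_def)
    qed
    also have "\<dots> = ennreal (b - a) * ennreal (d - c)"
      using ab by (subst nn_integral_cmult_indicator) auto
    also have "\<dots> = ennreal (\<Prod>b\<in>Basis. (u - l) \<bullet> b)"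
    proof -
      have "(\<Prod>b\<in>Basis. (u - l) \<bullet> b) = (b - a) * (d - c)"
        unfolding Basis_prod_def by (subst prod.union_disjoint) (auto simp: l u)
      then show ?thesis using ab by (simp add: ennreal_mult)
    qed
    finally show "emeasure N (box l u) = ennreal (\<Prod>b\<in>Basis. (u - l) \<bullet> b)" .
  qed
  have le1: "emeasure F.fibre_measure A \<le> emeasure lborel A" "emeasure G.fibre_measure A \<le> emeasure lborel A"
    if "A \<in> sets borel" for A
    using N[OF that] by (auto simp: lN)
  have ac: "absolutely_continuous lborel F.fibre_measure" "absolutely_continuous lborel G.fibre_measure"
    using le1 unfolding absolutely_continuous_def null_sets_def
    by simp_all (metis (mono_tags, lifting) le_zero_eq mem_Collect_eq subsetI)+
  obtain h where h[measurable]: "h \<in> borel_measurable lborel" and hF: "density lborel h = F.fibre_measure"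
    using sigma_finite_measure.Radon_Nikodym[OF sigma_finite_lborel ac(1)] by auto
  obtain k where k[measurable]: "k \<in> borel_measurable lborel" and kG: "density lborel k = G.fibre_measure"
    using sigma_finite_measure.Radon_Nikodym[OF sigma_finite_lborel ac(2)] by auto
  \<comment> \<open>Uniqueness of densities gives h + k = 1 almost everywhere, which confines h to
    [0, 1]. This is the source of the bound on g.\<close>
  have "density lborel (\<lambda>p. h p + k p) = density lborel (\<lambda>_. 1)"
  proof (rule measure_eqI)
    fix A assume "A \<in> sets (density lborel (\<lambda>p. h p + k p))"
    then have A[measurable]: "A \<in> sets borel" by simp
    have "emeasure (density lborel (\<lambda>p. h p + k p)) A =
        (\<integral>\<^sup>+p. h p * indicator A p + k p * indicator A p \<partial>lborel)"
      by (subst emeasure_density) (auto simp: distrib_right)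
    also have "\<dots> = emeasure (density lborel h) A + emeasure (density lborel k) A"
      by (subst nn_integral_add) (auto simp: emeasure_density)
    also have "\<dots> = emeasure N A" using N[OF A] by (simp add: hF kG)
    also have "\<dots> = emeasure (density lborel (\<lambda>_. 1)) A" by (simp add: lN[symmetric] density_1)
    finally show "emeasure (density lborel (\<lambda>p. h p + k p)) A = emeasure (density lborel (\<lambda>_. 1)) A" .
  qed simp
  then have "AE p in lborel. h p + k p = 1"
    by (intro sigma_finite_measure.density_unique[OF sigma_finite_lborel]) auto
  then have hle: "AE p in lborel. h p \<le> 1"
    by eventually_elim (metis le_iff_add)
  \<comment> \<open>The truncation at 1 makes the bounds hold at every point and not merely almost
    everywhere, and the real version finite.\<close>
  define w where "w = (\<lambda>p. enn2real (min 1 (h p)))"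
  have w[measurable]: "w \<in> borel_measurable borel" unfolding w_def by simp
  have w01: "0 \<le> w p" "w p \<le> 1" for p
    using enn2real_mono[of "min 1 (h p)" 1] by (auto simp: w_def)
  have wF: "density lborel (\<lambda>p. ennreal (w p)) = F.fibre_measure"
  proof -
    have "density lborel (\<lambda>p. ennreal (w p)) = density lborel h"
    proof (rule density_cong)
      show "AE p in lborel. ennreal (w p) = h p"
        using hle by eventually_elim (auto simp: w_def min_def ennreal_enn2real_if top_unique)
    qed auto
    then show ?thesis using hF by simp
  qed
  \<comment> \<open>The density w of the first pullback is formally (1 + f_t/c)/2; solved for f_t
    this is c (2 w - 1).\<close>
  define g where "g = (\<lambda>p. c * (2 * w p - 1))"
  have main: "(\<integral>p. f p * \<psi>' p \<partial>lborel) = - (\<integral>p. g p * \<psi> p \<partial>lborel)"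
    if test: "fst_test R \<psi> \<psi>'" for \<psi> \<psi>' R
  proof -
    have c\<psi>: "continuous_on UNIV \<psi>" "continuous_on UNIV \<psi>'"
      using test by (auto simp: fst_test_def)
    note int = integrable_continuous_support[of _ _ R]
    have m[measurable]: "\<psi> \<in> borel_measurable borel" "\<psi>' \<in> borel_measurable borel"
      using c\<psi> by (auto intro: borel_measurable_continuous_onI)
    have i\<psi>: "integrable lborel \<psi>"
      using int[of "\<lambda>_. 1" \<psi>] c\<psi> fst_test_zero[OF test] by auto
    have iw: "integrable lborel (\<lambda>p. w p * \<psi> p)"
    proof (rule Bochner_Integration.integrable_bound[OF i\<psi>])
      show "AE p in lborel. norm (w p * \<psi> p) \<le> norm (\<psi> p)"
        using w01 by (intro AE_I2) (auto simp: abs_mult intro: mult_left_le_one_le)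
    qed simp
    have iF: "integrable F.fibre_measure \<psi>"
      unfolding wF[symmetric] using iw w01 by (subst integrable_density) auto
    have "(\<integral>p. w p * \<psi> p \<partial>lborel) = integral\<^sup>L F.fibre_measure \<psi>"
      unfolding wF[symmetric] using w01 by (subst integral_density) auto
    also have "\<dots> = - (\<integral>p. F (fst p) (snd p) * \<psi>' p \<partial>lborel)"
      by (rule F.fibre_measure_by_parts[OF test iF])
    also have "(\<lambda>p. F (fst p) (snd p) * \<psi>' p) = (\<lambda>p. fst p * \<psi>' p / 2 + f p * \<psi>' p / (2 * c))"
      by (auto simp: F_def fun_eq_iff field_simps)
    also have "(\<integral>p. fst p * \<psi>' p / 2 + f p * \<psi>' p / (2 * c) \<partial>lborel) =
        (\<integral>p. fst p * \<psi>' p \<partial>lborel) / 2 + (\<integral>p. f p * \<psi>' p \<partial>lborel) / (2 * c)"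
      using int[OF cf c\<psi>(2)] int[OF continuous_on_fst[OF continuous_on_id] c\<psi>(2)] fst_test_zero[OF test] by simp
    finally have A: "(\<integral>p. w p * \<psi> p \<partial>lborel) =
      - ((\<integral>p. fst p * \<psi>' p \<partial>lborel) / 2 + (\<integral>p. f p * \<psi>' p \<partial>lborel) / (2 * c))" .
    have B: "(\<integral>p. fst p * \<psi>' p \<partial>lborel) = - (\<integral>p. \<psi> p \<partial>lborel)"
    proof -
      have id: "I.fibre_inv s x = s" for s x
        using I.fibre_inv_right .
      have "I.fibre_measure = distr lborel borel id"
        unfolding I.fibre_measure_def id by (simp add: id_def)
      then have eq: "I.fibre_measure = lborel"
        by (simp add: id_def distr_id2)
      show ?thesis
        using I.fibre_measure_by_parts[OF test] i\<psi> unfolding eq by simp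
    qed
    have "(\<integral>p. g p * \<psi> p \<partial>lborel) = (\<integral>p. 2 * c * (w p * \<psi> p) - c * \<psi> p \<partial>lborel)"
      by (simp add: g_def algebra_simps)
    also have "\<dots> = 2 * c * (\<integral>p. w p * \<psi> p \<partial>lborel) - c * (\<integral>p. \<psi> p \<partial>lborel)"
      using iw i\<psi> by simp
    finally show ?thesis using c A B by (simp add: field_simps)
  qed
  have gb: "\<bar>g p\<bar> \<le> c" for p
    using w01[of p] c by (auto simp: g_def abs_mult)
  have gm: "g \<in> borel_measurable borel" unfolding g_def by simp
  show ?thesis
    unfolding c_def[symmetric] using gm gb main by blast
qed

section \<open>Weak second derivatives on the half line\<close>

lemma shift_within_iff:
  fixes f :: "real \<Rightarrow> real"
  shows "((\<lambda>h. f (t + h)) has_vector_derivative D) (at 0 within {h. t + h \<in> A}) \<longleftrightarrow>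
    (f has_real_derivative D) (at t within A)"
proof -
  have "(+) t ` {h. t + h \<in> A} = A"
    by (auto simp: image_iff) (metis add.commute diff_add_cancel)
  then show ?thesis
    using DERIV_at_within_shift[of f D t 0 "{h. t + h \<in> A}"]
    by (simp add: has_real_derivative_iff_has_vector_derivative)
qed

lemma pderiv_on_UNIV_real:
  fixes f :: "real \<Rightarrow> real"
  assumes "(f has_real_derivative D) (at t)"
  shows "pderiv_on UNIV 1 f t = D" "(\<lambda>h. f (t + h)) differentiable (at 0)"
proof -
  have 1: "((\<lambda>h. f (t + h)) has_vector_derivative D) (at 0)"
    using assms shift_within_iff[of f t D UNIV] by simp
  show "pderiv_on UNIV 1 f t = D"
    unfolding pderiv_on_def using 1 vector_derivative_at by simp
  show "(\<lambda>h. f (t + h)) differentiable (at 0)"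
    using 1 by (auto simp: has_vector_derivative_def differentiable_def)
qed

lemma Ck_on_Suc_real:
  assumes "Ck_on (Suc k) A f" "t \<in> A"
  shows "(f has_real_derivative pderiv_on A 1 f t) (at t within A)"
  using assms vector_derivative_works[of "\<lambda>h. f (t + h)" "at 0 within {h. t + h \<in> A}"] shift_within_iff[of f t _ A]
  by (auto simp: pderiv_on_def)

lemma Ck_on_Suc_fst:
  fixes S :: "(real \<times> real) set"
  assumes "Ck_on (Suc k) S f" "(t, x) \<in> S"
  shows "((\<lambda>t. f (t, x)) has_real_derivative pderiv_on S (1, 0) f (t, x)) (at t within {t. (t, x) \<in> S})"
proof -
  have "(1, 0) \<in> (Basis :: (real \<times> real) set)" by (simp add: Basis_prod_def)
  then have "(\<lambda>h. f ((t, x) + h *\<^sub>R (1, 0))) differentiable (at 0 within {h. (t, x) + h *\<^sub>R (1, 0) \<in> S})"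
    using assms unfolding Ck_on.simps by blast
  then have "((\<lambda>h. f (t + h, x)) has_vector_derivative pderiv_on S (1, 0) f (t, x)) (at 0 within {h. t + h \<in> {t. (t, x) \<in> S}})"
    unfolding pderiv_on_def by (subst (asm) vector_derivative_works) simp
  then show ?thesis by (subst (asm) shift_within_iff)
qed

lemma Ck_on_Suc_snd:
  fixes S :: "(real \<times> real) set"
  assumes "Ck_on (Suc k) S f" "(t, x) \<in> S"
  shows "((\<lambda>x. f (t, x)) has_real_derivative pderiv_on S (0, 1) f (t, x)) (at x within {x. (t, x) \<in> S})"
proof -
  have "(0, 1) \<in> (Basis :: (real \<times> real) set)" by (simp add: Basis_prod_def)
  then have "(\<lambda>h. f ((t, x) + h *\<^sub>R (0, 1))) differentiable (at 0 within {h. (t, x) + h *\<^sub>R (0, 1) \<in> S})"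
    using assms unfolding Ck_on.simps by blast
  then have "((\<lambda>h. f (t, x + h)) has_vector_derivative pderiv_on S (0, 1) f (t, x)) (at 0 within {h. x + h \<in> {x. (t, x) \<in> S}})"
    unfolding pderiv_on_def by (subst (asm) vector_derivative_works) simp
  then show ?thesis by (subst (asm) shift_within_iff)
qed

text \<open>Membership passes to the derivative, so induction on k gives smoothness of all orders
  without formulas for iterated derivatives.\<close>

lemma Ck_on_closed_family:
  fixes S :: "(real \<Rightarrow> real) set"
  assumes closed: "\<And>f. f \<in> S \<Longrightarrow> \<exists>f'\<in>S. \<forall>x. (f has_real_derivative f' x) (at x)"
  shows "f \<in> S \<Longrightarrow> Ck_on k UNIV f"
proof (induction k arbitrary: f)
  case 0
  then obtain f' where "\<And>x. (f has_real_derivative f' x) (at x)" using closed by blast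
  then show ?case by (auto simp: continuous_on_eq_continuous_at intro: DERIV_isCont)
next
  case (Suc k)
  then obtain f' where f': "\<And>x. (f has_real_derivative f' x) (at x)" "f' \<in> S" using closed by blast
  have "pderiv_on UNIV 1 f = f'" using pderiv_on_UNIV_real(1)[OF f'(1)] by auto
  then show ?case
    using Suc.IH[OF f'(2)] pderiv_on_UNIV_real(2)[OF f'(1)] DERIV_isCont[OF f'(1)]
    by (auto simp: continuous_on_eq_continuous_at)
qed

section \<open>Smooth steps built from exp(-1/x)\<close>

definition flat_exp :: "real poly \<Rightarrow> real \<Rightarrow> real" where
  "flat_exp p x = (if x > 0 then poly p (1 / x) * exp (- 1 / x) else 0)"

lemma flat_exp_tendsto: "((\<lambda>y. poly p y * exp (- y)) \<longlongrightarrow> (0::real)) at_top"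
proof -
  have "((\<lambda>y::real. \<Sum>i\<le>degree p. coeff p i * (y ^ i / exp y)) \<longlongrightarrow> (\<Sum>i\<le>degree p. coeff p i * 0)) at_top"
    by (intro tendsto_sum tendsto_mult tendsto_const tendsto_power_div_exp_0)
  then show ?thesis
    by (simp add: poly_altdef exp_minus sum_distrib_right divide_inverse mult.assoc)
qed

text \<open>The polynomial factor is there to make the family stable under differentiation: with y =
  1/x, the x-derivative of p(y) exp(-y) is y^2 (p - p')(y) exp(-y), and \<open>[:0, 0, 1:]\<close>
  is y^2.\<close>

lemma flat_exp_deriv:
  "(flat_exp p has_real_derivative flat_exp ([:0, 0, 1:] * (p - pderiv p)) x) (at x)"
proof -
  consider "x > 0" | "x < 0" | "x = 0" by linarith
  then show ?thesis
  proof cases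
    case 1
    have "((\<lambda>x. poly p (1 / x)) has_real_derivative poly (pderiv p) (1 / x) * (- 1 / x\<^sup>2)) (at x)"
      using 1 by (intro DERIV_chain2[OF poly_DERIV]) (auto intro!: derivative_eq_intros simp: power2_eq_square)
    moreover have "((\<lambda>x. exp (- 1 / x)) has_real_derivative exp (- 1 / x) * (1 / x\<^sup>2)) (at x)"
      using 1 by (auto intro!: derivative_eq_intros simp: power2_eq_square)
    ultimately have "((\<lambda>x. poly p (1 / x) * exp (- 1 / x)) has_real_derivative
        poly (pderiv p) (1 / x) * (- 1 / x\<^sup>2) * exp (- 1 / x) + exp (- 1 / x) * (1 / x\<^sup>2) * poly p (1 / x)) (at x)"
      by (rule DERIV_mult)
    also have "poly (pderiv p) (1 / x) * (- 1 / x\<^sup>2) * exp (- 1 / x) + exp (- 1 / x) * (1 / x\<^sup>2) * poly p (1 / x) =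
        flat_exp ([:0, 0, 1:] * (p - pderiv p)) x"
      using 1 by (simp add: flat_exp_def field_simps power2_eq_square)
    finally have "((\<lambda>x. poly p (1 / x) * exp (- 1 / x)) has_real_derivative
        flat_exp ([:0, 0, 1:] * (p - pderiv p)) x) (at x)" .
    note d = this
    have "eventually (\<lambda>y. y \<in> {0<..}) (nhds x)"
      using 1 by (intro eventually_nhds_in_open) auto
    then have ev: "eventually (\<lambda>y. flat_exp p y = poly p (1 / y) * exp (- 1 / y)) (nhds x)"
      by eventually_elim (auto simp: flat_exp_def)
    show ?thesis by (subst DERIV_cong_ev[OF refl ev refl]) (rule d)
  next
    case 2
    have "((\<lambda>x. 0) has_real_derivative flat_exp ([:0, 0, 1:] * (p - pderiv p)) x) (at x)"
      using 2 by (auto simp: flat_exp_def)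
    note d = this
    have "eventually (\<lambda>y. y \<in> {..<0}) (nhds x)"
      using 2 by (intro eventually_nhds_in_open) auto
    then have ev: "eventually (\<lambda>y. flat_exp p y = 0) (nhds x)"
      by eventually_elim (auto simp: flat_exp_def)
    show ?thesis by (subst DERIV_cong_ev[OF refl ev refl]) (rule d)
  next
    case 3
    \<comment> \<open>The difference quotient at 0 is y p(y) exp(-y) with y = 1/h, and y p(y) is the
      polynomial \<open>pCons 0 p\<close>; so differentiability at 0 is again a limit of the kind in
      \<open>flat_exp_tendsto\<close>.\<close>
    have "((\<lambda>h. poly (pCons 0 p) (inverse h) * exp (- inverse h)) \<longlongrightarrow> 0) (at_right 0)"
      by (rule filterlim_compose[OF flat_exp_tendsto filterlim_inverse_at_top_right])
    then have "((\<lambda>h. flat_exp p h / h) \<longlongrightarrow> 0) (at_right 0)"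
    proof (rule Lim_transform_eventually)
      show "eventually (\<lambda>h. poly (pCons 0 p) (inverse h) * exp (- inverse h) = flat_exp p h / h) (at_right 0)"
        using eventually_at_right_less[of "0::real"]
        by eventually_elim (auto simp: flat_exp_def field_simps)
    qed
    moreover have "((\<lambda>h. flat_exp p h / h) \<longlongrightarrow> 0) (at_left 0)"
    proof (rule Lim_transform_eventually[OF tendsto_const])
      show "eventually (\<lambda>h. 0 = flat_exp p h / h) (at_left 0)"
        using eventually_at_left_real[OF neg_less_0_iff_less[THEN iffD2, OF zero_less_one]]
        by eventually_elim (auto simp: flat_exp_def)
    qed
    ultimately have "((\<lambda>h. flat_exp p h / h) \<longlongrightarrow> 0) (at 0)"
      by (simp add: filterlim_split_at)
    then show ?thesis using 3 by (simp add: DERIV_def flat_exp_def)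
  qed
qed

text \<open>The generators are those needed to write \<open>smooth_step\<close>. Since derivatives
  stay in the set, smoothness comes from \<open>Ck_on_closed_family\<close> alone.\<close>

inductive_set smooth_family :: "(real \<Rightarrow> real) set" where
  flat: "(\<lambda>x. flat_exp p (a + c * x)) \<in> smooth_family"
| const: "(\<lambda>x. c) \<in> smooth_family"
| add: "f \<in> smooth_family \<Longrightarrow> g \<in> smooth_family \<Longrightarrow> (\<lambda>x. f x + g x) \<in> smooth_family"
| mult: "f \<in> smooth_family \<Longrightarrow> g \<in> smooth_family \<Longrightarrow> (\<lambda>x. f x * g x) \<in> smooth_family"
| inv: "f \<in> smooth_family \<Longrightarrow> (\<And>x. f x \<noteq> 0) \<Longrightarrow> (\<lambda>x. inverse (f x)) \<in> smooth_family"

lemma smooth_family_deriv: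
  "f \<in> smooth_family \<Longrightarrow> \<exists>f'\<in>smooth_family. \<forall>x. (f has_real_derivative f' x) (at x)"
proof (induction rule: smooth_family.induct)
  case (flat p a c)
  have "((\<lambda>x. flat_exp p (a + c * x)) has_real_derivative flat_exp ([:0, 0, 1:] * (p - pderiv p)) (a + c * x) * c) (at x)" for x
    by (rule DERIV_chain2[OF flat_exp_deriv]) (auto intro!: derivative_eq_intros)
  moreover have "(\<lambda>x. flat_exp ([:0, 0, 1:] * (p - pderiv p)) (a + c * x) * c) \<in> smooth_family"
    by (intro smooth_family.intros)
  ultimately show ?case
    by (intro bexI[of _ "\<lambda>x. flat_exp ([:0, 0, 1:] * (p - pderiv p)) (a + c * x) * c"]) auto
next
  case (const c)
  then show ?case by (intro bexI[of _ "\<lambda>x. 0"]) (auto intro: smooth_family.intros)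
next
  case (add f g)
  then obtain f' g' where fg: "f' \<in> smooth_family" "g' \<in> smooth_family"
    and d: "\<And>x. (f has_real_derivative f' x) (at x)" "\<And>x. (g has_real_derivative g' x) (at x)" by auto
  show ?case
    by (intro bexI[of _ "\<lambda>x. f' x + g' x"] allI DERIV_add d smooth_family.add fg)
next
  case (mult f g)
  then obtain f' g' where fg: "f' \<in> smooth_family" "g' \<in> smooth_family"
    and d: "\<And>x. (f has_real_derivative f' x) (at x)" "\<And>x. (g has_real_derivative g' x) (at x)" by auto
  show ?case
    by (intro bexI[of _ "\<lambda>x. f' x * g x + g' x * f x"] allI DERIV_mult d smooth_family.add smooth_family.mult fg mult)
next
  case (inv f)
  then obtain f' where f: "f' \<in> smooth_family"
    and d: "\<And>x. (f has_real_derivative f' x) (at x)" by auto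
  have "((\<lambda>x. inverse (f x)) has_real_derivative (- 1) * (f' x * (inverse (f x) * inverse (f x)))) (at x)" for x
    using DERIV_inverse_fun[OF d[of x] inv(2)] by (simp add: power2_eq_square mult.assoc)
  moreover have "(\<lambda>x. (- 1) * (f' x * (inverse (f x) * inverse (f x)))) \<in> smooth_family"
    by (intro smooth_family.intros f inv)
  ultimately show ?case
    by (intro bexI[of _ "\<lambda>x. (- 1) * (f' x * (inverse (f x) * inverse (f x)))"]) auto
qed

text \<open>The standard smooth transition from 0 to 1 across [0, 1]. The denominator never
  vanishes, because y and 1 - y are not both nonpositive.\<close>

definition smooth_step :: "real \<Rightarrow> real" where
  "smooth_step y = flat_exp 1 y * inverse (flat_exp 1 y + flat_exp 1 (1 - y))"

lemma flat_exp_1: "0 \<le> flat_exp 1 y" "y > 0 \<Longrightarrow> 0 < flat_exp 1 y" "y \<le> 0 \<Longrightarrow> flat_exp 1 y = 0"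
  by (auto simp: flat_exp_def)

lemma flat_exp_1_mono: "x \<le> y \<Longrightarrow> flat_exp 1 x \<le> flat_exp 1 y"
  by (auto simp: flat_exp_def frac_le)

lemma smooth_step_denom: "flat_exp 1 y + flat_exp 1 (1 - y) > 0"
  using flat_exp_1(1,2)[of y] flat_exp_1(1,2)[of "1 - y"] by (cases "y > 0") force+

lemma smooth_step_values:
  "y \<le> 0 \<Longrightarrow> smooth_step y = 0" "1 \<le> y \<Longrightarrow> smooth_step y = 1"
  "0 \<le> smooth_step y" "smooth_step y \<le> 1"
  using smooth_step_denom[of y] flat_exp_1[of y] flat_exp_1[of "1 - y"]
  by (auto simp: smooth_step_def field_simps)

lemma smooth_step_mono: assumes "x \<le> y" shows "smooth_step x \<le> smooth_step y"
proof -
  have "flat_exp 1 x * flat_exp 1 (1 - y) \<le> flat_exp 1 y * flat_exp 1 (1 - x)"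
    using assms flat_exp_1(1) by (intro mult_mono flat_exp_1_mono) auto
  then show ?thesis
    using smooth_step_denom[of x] smooth_step_denom[of y]
    by (simp add: smooth_step_def field_simps)
qed

lemma smooth_step_smooth: "(\<lambda>x. smooth_step ((x - r) / d)) \<in> smooth_family"
proof -
  have "(\<lambda>x. flat_exp 1 (- r / d + (1 / d) * x) * inverse (flat_exp 1 (- r / d + (1 / d) * x) + flat_exp 1 ((1 + r / d) + (- 1 / d) * x)))
      \<in> smooth_family"
  proof (intro smooth_family.mult smooth_family.inv smooth_family.add smooth_family.flat)
    fix x
    show "flat_exp 1 (- r / d + 1 / d * x) + flat_exp 1 (1 + r / d + - 1 / d * x) \<noteq> 0"
      using smooth_step_denom[of "- r / d + 1 / d * x"] by (simp add: algebra_simps)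
  qed
  moreover have "- r / d + (1 / d) * x = (x - r) / d" "(1 + r / d) + (- 1 / d) * x = 1 - (x - r) / d" for x
    by (simp_all add: diff_divide_distrib)
  ultimately show ?thesis unfolding smooth_step_def by (simp only:)
qed


lemma smooth_family_cont: "f \<in> smooth_family \<Longrightarrow> continuous_on A f"
  using smooth_family_deriv DERIV_isCont continuous_at_imp_continuous_on by metis

section \<open>From a bounded weak second derivative to a Lipschitz first derivative\<close>

lemma weighted_average_bound:
  fixes f k :: "real \<Rightarrow> real"
  assumes "continuous_on {a..c} f" "continuous_on {a..c} k"
    and k: "(k has_integral 1) {a..c}" "\<And>x. x \<in> {a..c} \<Longrightarrow> 0 \<le> k x"
    and osc: "\<And>x. x \<in> {a..c} \<Longrightarrow> k x \<noteq> 0 \<Longrightarrow> \<bar>f x - v\<bar> \<le> e"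
  shows "\<bar>integral {a..c} (\<lambda>x. f x * k x) - v\<bar> \<le> e"
proof -
  have i: "(\<lambda>x. f x * k x) integrable_on {a..c}" "(\<lambda>x. (f x - v) * k x) integrable_on {a..c}"
    by (intro integrable_continuous_interval continuous_intros assms)+
  have "((\<lambda>x. f x * k x - v * k x) has_integral integral {a..c} (\<lambda>x. f x * k x) - v * 1) {a..c}"
    by (intro has_integral_diff has_integral_mult_right k integrable_integral i)
  then have "integral {a..c} (\<lambda>x. (f x - v) * k x) = integral {a..c} (\<lambda>x. f x * k x) - v"
    by (simp add: left_diff_distrib integral_unique)
  moreover have "norm (integral {a..c} (\<lambda>x. (f x - v) * k x)) \<le> integral {a..c} (\<lambda>x. e * k x)"
  proof (rule integral_norm_bound_integral[OF i(2)])
    show "(\<lambda>x. e * k x) integrable_on {a..c}"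
      using has_integral_mult_right[OF k(1), of e] by blast
    show "norm ((f x - v) * k x) \<le> e * k x" if "x \<in> {a..c}" for x
      using osc[OF that] k(2)[OF that] by (cases "k x = 0") (auto simp: abs_mult intro: mult_right_mono)
  qed
  moreover have "integral {a..c} (\<lambda>x. e * k x) = e"
    using integral_unique[OF has_integral_mult_right[OF k(1), of e]] by (metis mult.right_neutral)
  ultimately show ?thesis by (metis real_norm_def)
qed

text \<open>The derivative of the test function is a difference of two nearly concentrated unit
  masses at r and s, so pairing b with its second derivative gives b'(s) - b'(r) up to the
  oscillation of b' near these points. The test function itself has modulus at most 1 and support in
  an interval barely longer than [r, s], so the pairing with the weak derivative is at most M times
  that length.\<close>

lemma weak_second_deriv_lipschitz:
  fixes b b' :: "real \<Rightarrow> real"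
  assumes der: "\<And>t. t > 0 \<Longrightarrow> (b has_real_derivative b' t) (at t)"
    and cont: "continuous_on {0<..} b'"
    and weak: "weak_deriv_Linf_le {0<..} [1, 1] b M"
    and rs: "0 < r" "r \<le> s"
  shows "\<bar>b' s - b' r\<bar> \<le> M * (s - r)"
proof (cases "r = s")
  case False
  then have "r < s" "0 < s" using rs by auto
  obtain g where g: "has_weak_deriv {0<..} [1, 1] b g" and "Linf_norm {0<..} g \<le> ereal M"
    using weak by (auto simp: weak_deriv_Linf_le_def)
  then have gM: "AE x in lebesgue_on {0<..}. \<bar>g x\<bar> \<le> M"
    using esssup_AE[of "\<lambda>x. ereal \<bar>g x\<bar>" "lebesgue_on {0<..}"] unfolding Linf_norm_def
    by (elim eventually_mono) (metis ereal_less_eq(3) order_trans)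
  \<comment> \<open>A negative M would make the half line a null set. The sign is needed to multiply
    the bound |\<psi>| \<le> 1 by M.\<close>
  have M: "M \<ge> 0"
  proof (rule ccontr)
    assume "\<not> M \<ge> 0"
    with gM have "AE x in lebesgue_on {0<..}. (x::real) \<notin> UNIV"
      by (elim eventually_mono) (use abs_ge_zero order_trans in blast)
    then have "AE x in lebesgue. (x::real) \<in> {0<..} \<longrightarrow> False"
      by (subst (asm) AE_restrict_space_iff) auto
    then have "AE x in lebesgue. x \<notin> {0<..(1::real)}"
      by (elim eventually_mono) auto
    then have "{0<..(1::real)} \<in> null_sets lebesgue"
      by (subst AE_iff_null_sets) auto
    then show False by (auto simp: null_sets_def)
  qed
  have approx: "\<bar>b' s - b' r\<bar> \<le> M * (s - r) + (M + 2) * e" if "e > 0" for e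
  proof -
    have "isCont b' r" "isCont b' s"
      using cont rs \<open>0 < s\<close> by (auto simp: continuous_on_eq_continuous_at)
    then obtain d1 d2 where d: "d1 > 0" "d2 > 0"
      and d1: "\<And>x. \<bar>x - r\<bar> < d1 \<Longrightarrow> \<bar>b' x - b' r\<bar> < e" and d2: "\<And>x. \<bar>x - s\<bar> < d2 \<Longrightarrow> \<bar>b' x - b' s\<bar> < e"
      unfolding continuous_at_eps_delta using \<open>e > 0\<close> by (metis dist_real_def)
    \<comment> \<open>\<delta> is the width of the transition layers: below d1 and d2 it controls
      the oscillation of b' across them, and below e the part of the support beyond s.\<close>
    define \<delta> where "\<delta> = min e (min d1 d2 / 2)"
    have \<delta>: "0 < \<delta>" "\<delta> \<le> e" "\<delta> < d1" "\<delta> < d2" using d \<open>e > 0\<close> by (auto simp: \<delta>_def)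
    define c where "c = s + \<delta>"
    have c: "r < c" using \<open>r < s\<close> \<delta> by (simp add: c_def)
    define h where "h = (\<lambda>z x. smooth_step ((x - z) / \<delta>))"
    have hfam: "h z \<in> smooth_family" for z unfolding h_def by (rule smooth_step_smooth)
    then have "\<forall>z. \<exists>k. k \<in> smooth_family \<and> (\<forall>x. (h z has_real_derivative k x) (at x))"
      using smooth_family_deriv by blast
    then obtain k where kfam: "\<And>z. k z \<in> smooth_family" and hk: "\<And>z x. (h z has_real_derivative k z x) (at x)"
      by metis
    have h0: "h z x = 0" if "x \<le> z" for z x
      using that \<delta> by (auto simp: h_def smooth_step_values divide_nonpos_pos)
    have h1: "h z x = 1" if "z + \<delta> \<le> x" for z x
      using that \<delta> by (auto simp: h_def smooth_step_values field_simps)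
    have k0: "k z x = 0" if "x \<notin> {z..z+\<delta>}" for z x
    proof (cases "x < z")
      case True
      then show ?thesis
        using derivative_of_locally_constant[OF hk, of "{..<z}" x z 0] h0 by auto
    next
      case False
      then show ?thesis
        using derivative_of_locally_constant[OF hk, of "{z+\<delta><..}" x z 1] h1 that by auto
    qed
    have kpos: "k z x \<ge> 0" for z x
    proof (rule mono_on_imp_deriv_nonneg[OF _ hk])
      show "mono_on UNIV (h z)"
        using \<delta> by (auto simp: h_def mono_on_def intro!: smooth_step_mono divide_right_mono)
    qed simp
    have kint: "(k z has_integral 1) {r..c}" if "r \<le> z" "z + \<delta> \<le> c" for z
    proof -
      have "(k z has_integral h z c - h z r) {r..c}"
        using c hk by (intro fundamental_theorem_of_calculus)
          (auto simp: has_real_derivative_iff_has_vector_derivative[symmetric] intro: has_field_derivative_at_within)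
      then show ?thesis using h0[of r z] h1[of z c] that by simp
    qed
    have cb': "continuous_on {r..c} b'"
      using rs by (intro continuous_on_subset[OF cont]) auto
    have avg: "\<bar>integral {r..c} (\<lambda>x. b' x * k z x) - b' z\<bar> \<le> e"
      if "r \<le> z" "z + \<delta> \<le> c" "\<And>x. \<bar>x - z\<bar> \<le> \<delta> \<Longrightarrow> \<bar>b' x - b' z\<bar> \<le> e" for z
    proof (rule weighted_average_bound[OF cb' smooth_family_cont[OF kfam] kint[OF that(1,2)] kpos])
      fix x assume "k z x \<noteq> 0"
      then have "x \<in> {z..z+\<delta>}" using k0 by blast
      then show "\<bar>b' x - b' z\<bar> \<le> e" by (intro that(3)) auto
    qed
    have avr: "\<bar>integral {r..c} (\<lambda>x. b' x * k r x) - b' r\<bar> \<le> e"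
      using d1 \<delta> \<open>r < s\<close> by (intro avg) (auto simp: c_def intro: less_imp_le)
    have avs: "\<bar>integral {r..c} (\<lambda>x. b' x * k s x) - b' s\<bar> \<le> e"
      using d2 \<delta> \<open>r < s\<close> by (intro avg) (auto simp: c_def intro: less_imp_le)
    define \<psi> where "\<psi> = (\<lambda>x. h r x + (- 1) * h s x)"
    define \<psi>' where "\<psi>' = (\<lambda>x. k r x + (- 1) * k s x)"
    have fam: "\<psi> \<in> smooth_family" "\<psi>' \<in> smooth_family"
      unfolding \<psi>_def \<psi>'_def by (intro smooth_family.add smooth_family.mult smooth_family.const hfam kfam)+
    have d\<psi>: "(\<psi> has_real_derivative \<psi>' x) (at x)" for x
      unfolding \<psi>_def \<psi>'_def by (intro DERIV_add DERIV_cmult hk)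
    obtain \<psi>'' where fam'': "\<psi>'' \<in> smooth_family" and d\<psi>': "\<And>x. (\<psi>' has_real_derivative \<psi>'' x) (at x)"
      using smooth_family_deriv[OF fam(2)] by blast
    have \<psi>0: "\<psi> x = 0" if "x \<notin> {r..c}" for x
      using that h0[of x r] h0[of x s] h1[of r x] h1[of s x] \<open>r < s\<close> by (auto simp: \<psi>_def c_def)
    have \<psi>'0: "\<psi>' x = 0" if "x \<notin> {r..c}" for x
      using derivative_of_locally_constant[OF d\<psi>, of "- {r..c}" x 0] \<psi>0 that by (auto simp: open_Compl)
    have \<psi>''0: "\<psi>'' x = 0" if "x \<notin> {r..c}" for x
      using derivative_of_locally_constant[OF d\<psi>', of "- {r..c}" x 0] \<psi>'0 that by (auto simp: open_Compl)
    \<comment> \<open>The local argument shows \<psi>' = 0 only off [r, c]; continuity carries this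
      to the endpoints, where the boundary terms of the integration by parts have to vanish.\<close>
    have \<psi>'b: "\<psi>' r = 0" "\<psi>' c = 0"
    proof -
      have "closed {x. \<psi>' x = 0}"
        using smooth_family_cont[OF fam(2)] by (intro closed_Collect_eq) auto
      then have "closure (- {r..c}) \<subseteq> {x. \<psi>' x = 0}" using \<psi>'0 by (intro closure_minimal) auto
      moreover have "closure (- {r..c}) = - {r<..<c}" by (simp add: closure_complement)
      ultimately show "\<psi>' r = 0" "\<psi>' c = 0" by auto
    qed
    have h01: "0 \<le> h z x" "h z x \<le> 1" for z x by (auto simp: h_def smooth_step_values)
    have \<psi>1: "\<bar>\<psi> x\<bar> \<le> 1" for x
      using h01[of r x] h01[of s x] by (auto simp: \<psi>_def)
    have clos: "closure {x. \<psi> x \<noteq> 0} \<subseteq> {r..c}"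
    proof (rule closure_minimal)
      show "{x. \<psi> x \<noteq> 0} \<subseteq> {r..c}" using \<psi>0 by blast
    qed simp
    moreover have "compact (closure {x. \<psi> x \<noteq> 0})"
      using compact_Int_closed[OF compact_Icc closed_closure, of r c "{x. \<psi> x \<noteq> 0}"] clos
      by (simp add: inf.absorb2)
    ultimately have "test_function {0<..} \<psi>"
      unfolding test_function_def
      using Ck_on_closed_family[OF smooth_family_deriv fam(1)] rs by auto
    moreover have "iter_pderiv [1, 1] \<psi> = \<psi>''"
      using pderiv_on_UNIV_real(1)[OF d\<psi>] pderiv_on_UNIV_real(1)[OF d\<psi>']
      by (simp add: iter_pderiv_def fun_eq_iff) (metis ext)
    ultimately have I: "(LINT x|lebesgue_on {0<..}. b x * \<psi>'' x) = (LINT x|lebesgue_on {0<..}. g x * \<psi> x)"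
      using g by (auto simp: has_weak_deriv_def)
    have "\<bar>LINT x|lebesgue_on {0<..}. g x * \<psi> x\<bar> \<le> (LINT x|lebesgue_on {0<..}. \<bar>g x * \<psi> x\<bar>)"
      by (rule integral_abs_bound)
    also have "\<dots> \<le> (LINT x|lebesgue_on {0<..}. M * indicator {r..c} x)"
    proof (rule integral_mono_AE')
      show "integrable (lebesgue_on {0<..}) (\<lambda>x. M * indicator {r..c} x)"
      proof (intro integrable_mult_right integrable_real_indicator)
        show "{r..c} \<in> sets (lebesgue_on {0<..})"
          using rs by (subst sets_restrict_space_iff) auto
        have "emeasure (lebesgue_on {0<..}) {r..c} = ennreal (c - r)"
          using rs c by (subst emeasure_restrict_space) auto
        then show "emeasure (lebesgue_on {0<..}) {r..c} < \<infinity>" by simp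
      qed
      show "AE x in lebesgue_on {0<..}. \<bar>g x * \<psi> x\<bar> \<le> M * indicator {r..c} x"
        using gM
      proof eventually_elim
        case (elim x)
        have "\<bar>g x\<bar> * \<bar>\<psi> x\<bar> \<le> M * 1" using elim \<psi>1[of x] M by (intro mult_mono) auto
        then show ?case using \<psi>0[of x] by (auto simp: abs_mult indicator_def)
      qed
    qed (use M in auto)
    also have "\<dots> = M * (c - r)"
    proof -
      have "measure (lebesgue_on {0<..}) {r..c} = c - r"
        using rs c by (subst measure_restrict_space) auto
      then show ?thesis
        using rs Int_absorb2[of "{r..c}" "{0<..}"] by (auto simp: subset_eq)
    qed
    finally have up: "\<bar>LINT x|lebesgue_on {0<..}. g x * \<psi> x\<bar> \<le> M * (c - r)" .
    have cb: "continuous_on {r..c} b"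
    proof (intro continuous_at_imp_continuous_on ballI)
      fix x assume "x \<in> {r..c}"
      then show "isCont b x" using DERIV_isCont[OF der[of x]] rs by auto
    qed
    have "(LINT x|lebesgue_on {0<..}. b x * \<psi>'' x) = (LINT x|lebesgue_on {r..c}. b x * \<psi>'' x)"
    proof -
      have "(LINT x|lebesgue_on {0<..}. b x * \<psi>'' x) = (LINT x|lebesgue. indicator {0<..} x *\<^sub>R (b x * \<psi>'' x))"
        by (subst integral_restrict_space) auto
      also have "\<dots> = (LINT x|lebesgue. indicator {r..c} x *\<^sub>R (b x * \<psi>'' x))"
        using rs \<psi>''0 by (intro Bochner_Integration.integral_cong) (auto simp: indicator_def)
      also have "\<dots> = (LINT x|lebesgue_on {r..c}. b x * \<psi>'' x)"
        by (subst integral_restrict_space) auto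
      finally show ?thesis .
    qed
    also have "\<dots> = integral {r..c} (\<lambda>x. b x * \<psi>'' x)"
      by (intro lebesgue_integral_eq_integral continuous_imp_integrable_real continuous_intros cb smooth_family_cont fam'') auto
    also have "\<dots> = - integral {r..c} (\<lambda>x. b' x * \<psi>' x)"
    proof -
      have "((\<lambda>x. b' x * \<psi>' x + b x * \<psi>'' x) has_integral b c * \<psi>' c - b r * \<psi>' r) {r..c}"
      proof (rule fundamental_theorem_of_calculus)
        fix x assume "x \<in> {r..c}"
        then have "((\<lambda>x. b x * \<psi>' x) has_real_derivative b' x * \<psi>' x + \<psi>'' x * b x) (at x)"
          using rs by (intro DERIV_mult der d\<psi>') auto
        then show "((\<lambda>x. b x * \<psi>' x) has_vector_derivative b' x * \<psi>' x + b x * \<psi>'' x) (at x within {r..c})"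
          by (simp add: has_real_derivative_iff_has_vector_derivative[symmetric] has_field_derivative_at_within mult.commute)
      qed (use c in simp)
      moreover have "(\<lambda>x. b' x * \<psi>' x) integrable_on {r..c}" "(\<lambda>x. b x * \<psi>'' x) integrable_on {r..c}"
        by (intro integrable_continuous_interval continuous_intros cb cb' smooth_family_cont fam fam'')+
      ultimately show ?thesis
        using \<psi>'b integral_add[of "\<lambda>x. b' x * \<psi>' x" "{r..c}" "\<lambda>x. b x * \<psi>'' x"] by (simp add: integral_unique)
    qed
    also have "\<dots> = integral {r..c} (\<lambda>x. b' x * k s x) - integral {r..c} (\<lambda>x. b' x * k r x)"
    proof -
      have "(\<lambda>x. b' x * k z x) integrable_on {r..c}" for z
        by (intro integrable_continuous_interval continuous_intros cb' smooth_family_cont kfam)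
      then show ?thesis
        by (simp add: \<psi>'_def right_diff_distrib integral_diff)
    qed
    finally have "\<bar>integral {r..c} (\<lambda>x. b' x * k s x) - integral {r..c} (\<lambda>x. b' x * k r x)\<bar> \<le> M * (c - r)"
      using I up by simp
    moreover have "M * (c - r) \<le> M * (s - r) + M * e"
    proof -
      have "c - r \<le> s - r + e" using \<delta> by (simp add: c_def)
      from mult_left_mono[OF this M] show ?thesis by (simp add: distrib_left)
    qed
    ultimately show ?thesis using avr avs by (simp add: algebra_simps)
  qed
  have "((\<lambda>e. M * (s - r) + (M + 2) * e) \<longlongrightarrow> M * (s - r) + (M + 2) * 0) (at_right 0)"
    by (intro tendsto_intros)
  then have "\<bar>b' s - b' r\<bar> \<le> M * (s - r) + (M + 2) * 0"
    by (rule tendsto_lowerbound) (use approx eventually_at_right_less[of "0::real"] in \<open>auto elim: eventually_mono\<close>)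
  then show ?thesis by simp
qed simp

section \<open>A maximum principle with doubled variables\<close>

definition periodic_C1 :: "real \<Rightarrow> real \<Rightarrow> (real \<times> real \<Rightarrow> real) \<Rightarrow> (real \<times> real \<Rightarrow> real) \<Rightarrow> bool" where
  "periodic_C1 T L f f' \<longleftrightarrow> continuous_on (strip L) f \<and> continuous_on (strip L) f' \<and>
     (\<forall>t\<ge>0. \<forall>x\<in>{0..L}. ((\<lambda>t. f (t, x)) has_real_derivative f' (t, x)) (at t within {0..}) \<and>
        f (t + T, x) = f (t, x) \<and> f' (t + T, x) = f' (t, x))"

lemma periodic_shift:
  fixes f :: "real \<Rightarrow> real"
  assumes "\<And>t. t \<ge> 0 \<Longrightarrow> f (t + T) = f t" "T > 0" "t \<ge> 0"
  shows "f (t + real n * T) = f t"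
proof (induction n)
  case (Suc n)
  have "f (t + real (Suc n) * T) = f ((t + real n * T) + T)" by (simp add: algebra_simps)
  also have "\<dots> = f t" using assms Suc by simp
  finally show ?case .
qed simp

lemma period_decompose:
  assumes "T > 0" "t \<ge> (0::real)"
  obtains r n where "t = r + real n * T" "0 \<le> r" "r < T"
proof -
  define n where "n = nat \<lfloor>t / T\<rfloor>"
  have "real n = of_int \<lfloor>t / T\<rfloor>" using assms by (simp add: n_def)
  then have "real n \<le> t / T" "t / T < real n + 1" by linarith+
  then have "0 \<le> t - real n * T" "t - real n * T < T" using assms by (auto simp: field_simps)
  then show ?thesis using that[of "t - real n * T" n] by simp
qed

text \<open>Leibniz-style form of "t and t' agree modulo T": it can be instantiated directly with
  any function that is periodic on the half line, without carrying a multiple of T.\<close>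

definition same_phase :: "real \<Rightarrow> real \<Rightarrow> real \<Rightarrow> bool" where
  "same_phase T t t' \<longleftrightarrow> (\<forall>f :: real \<Rightarrow> real. (\<forall>t\<ge>0. f (t + T) = f t) \<longrightarrow> f t' = f t)"

text \<open>Let r and q be the remainders of t and s. If r \<le> q, both are shifted by T; otherwise
  s lies in a later period than t, and shifting q by 2 T still does not increase the distance. This
  wrap needs a window of length 2 T; the window starts at T so that the maximum is found at positive
  times, where t-derivatives are two-sided.\<close>

lemma period_reduce_le:
  assumes "T > 0" "0 \<le> t" "t \<le> (s::real)"
  shows "\<exists>t'\<in>{T..3*T}. \<exists>s'\<in>{T..3*T}. \<bar>t' - s'\<bar> \<le> \<bar>t - s\<bar> \<and> same_phase T t t' \<and> same_phase T s s'"
proof -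
  obtain r n where r: "t = r + real n * T" "0 \<le> r" "r < T" using period_decompose assms by blast
  obtain q k where q: "s = q + real k * T" "0 \<le> q" "q < T" using period_decompose[of T s] assms by auto
  have nk: "n \<le> k"
  proof (rule ccontr)
    assume "\<not> n \<le> k"
    then have "real k + 1 \<le> real n" by linarith
    then have "(real k + 1) * T \<le> real n * T" using assms by (intro mult_right_mono) auto
    then show False using r q assms by (simp add: algebra_simps)
  qed
  have ph: "same_phase T (a + real i * T) (a + real j * T)" if "a \<ge> 0" for a i j
    unfolding same_phase_def
  proof (intro allI impI)
    fix f :: "real \<Rightarrow> real" assume "\<forall>t\<ge>0. f (t + T) = f t"
    then have "f (a + real k * T) = f a" for k using periodic_shift[of f T a] assms that by blast
    then show "f (a + real j * T) = f (a + real i * T)" by simp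
  qed
  have ph1: "same_phase T t (r + T)" "same_phase T s (q + T)" "same_phase T s (q + 2 * T)"
    using ph[of r n 1] ph[of q k 1] ph[of q k 2] r q by auto
  show ?thesis
  proof (cases "r \<le> q")
    case True
    have "real n * T \<le> real k * T" using nk assms by (intro mult_right_mono) auto
    then show ?thesis using True r q assms ph1 by (intro bexI[of _ "r + T"] bexI[of _ "q + T"]) auto
  next
    case False
    have "n \<noteq> k" using False r q assms by auto
    then have "real n + 1 \<le> real k" using nk by linarith
    then have "(real n + 1) * T \<le> real k * T" using assms by (intro mult_right_mono) auto
    then show ?thesis using False r q assms ph1
      by (intro bexI[of _ "r + T"] bexI[of _ "q + 2 * T"]) (auto simp: algebra_simps)
  qed
qed

lemma period_reduce:
  assumes "T > 0" "0 \<le> t" "0 \<le> (s::real)"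
  shows "\<exists>t'\<in>{T..3*T}. \<exists>s'\<in>{T..3*T}. \<bar>t' - s'\<bar> \<le> \<bar>t - s\<bar> \<and> same_phase T t t' \<and> same_phase T s s'"
proof (cases "t \<le> s")
  case False
  then have "\<exists>s'\<in>{T..3*T}. \<exists>t'\<in>{T..3*T}. \<bar>s' - t'\<bar> \<le> \<bar>s - t\<bar> \<and> same_phase T s s' \<and> same_phase T t t'"
    using assms by (intro period_reduce_le) auto
  then show ?thesis by (metis abs_minus_commute)
qed (use assms period_reduce_le in blast)

lemma real_has_deriv_mvt:
  fixes f :: "real \<Rightarrow> real"
  assumes "a < b" "\<And>t. t \<in> {a..b} \<Longrightarrow> (f has_real_derivative f' t) (at t within S)" "{a..b} \<subseteq> S"
  obtains z where "a < z" "z < b" "f b - f a = (b - a) * f' z"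
proof -
  have cont: "continuous_on {a..b} f"
    by (rule DERIV_continuous_on) (rule DERIV_subset[OF assms(2,3)])
  have der: "(f has_derivative (\<lambda>x h. h * f' x) x) (at x)" if "a < x" "x < b" for x
  proof -
    have "(f has_real_derivative f' x) (at x within {a<..<b})"
      using assms(3) that by (intro DERIV_subset[OF assms(2)[of x]]) auto
    then show ?thesis
      using that by (simp add: at_within_open[of x "{a<..<b}"] has_field_derivative_def mult_commute_abs)
  qed
  show ?thesis
    by (rule mvt[OF assms(1) cont der]) (auto intro: that)
qed

lemma lipschitz_from_deriv_bound:
  fixes f :: "real \<Rightarrow> real"
  assumes "\<And>t. t \<in> {a..b} \<Longrightarrow> (f has_real_derivative f' t) (at t within S)" "{a..b} \<subseteq> S"
    and "\<And>t. t \<in> {a..b} \<Longrightarrow> \<bar>f' t\<bar> \<le> B" "a \<le> b"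
  shows "\<bar>f b - f a\<bar> \<le> B * (b - a)"
proof (cases "a = b")
  case False
  then have "a < b" using assms by simp
  then obtain z where z: "a < z" "z < b" "f b - f a = (b - a) * f' z"
    using real_has_deriv_mvt[of a b f f' S] assms by blast
  have "\<bar>(b - a) * f' z\<bar> \<le> (b - a) * B"
    using assms(3)[of z] z by (auto simp: abs_mult)
  then show ?thesis using z by (simp add: mult.commute)
qed simp

lemma periodic_C1_deriv:
  assumes "periodic_C1 T L f f'" "t \<ge> 0" "x \<in> {0..L}"
  shows "((\<lambda>t. f (t, x)) has_real_derivative f' (t, x)) (at t within {0..})"
    "f (t + T, x) = f (t, x)" "f' (t + T, x) = f' (t, x)"
  using assms by (auto simp: periodic_C1_def)

lemma periodic_C1_deriv_at:
  assumes "periodic_C1 T L f f'" "t > 0" "x \<in> {0..L}"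
  shows "((\<lambda>t. f (t, x)) has_real_derivative f' (t, x)) (at t)"
  using periodic_C1_deriv(1)[OF assms(1), of t x] assms(2,3) at_within_interior[of t "{0..}"]
  by simp

lemma periodic_C1_equicont:
  assumes f: "periodic_C1 T L f f'" and "T > 0" "e > 0"
  shows "\<exists>d>0. \<forall>k t x. 0 \<le> k \<and> k \<le> d \<and> t \<ge> 0 \<and> x \<in> {0..L} \<longrightarrow> \<bar>f' (t + k, x) - f' (t, x)\<bar> \<le> e"
proof -
  let ?K = "{0..2*T} \<times> {0..L}"
  have "compact ?K" by (intro compact_Times) auto
  moreover have "continuous_on ?K f'"
    using f by (auto simp: periodic_C1_def strip_def intro: continuous_on_subset)
  ultimately have "uniformly_continuous_on ?K f'" by (rule compact_uniformly_continuous[rotated])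
  then obtain d where d: "d > 0" "\<And>p q. p \<in> ?K \<Longrightarrow> q \<in> ?K \<Longrightarrow> dist q p < d \<Longrightarrow> dist (f' q) (f' p) < e"
    using \<open>e > 0\<close> unfolding uniformly_continuous_on_def by metis
  show ?thesis
  \<comment> \<open>The cap T keeps r + k inside [0, 2 T] for a remainder r < T; d/2 meets the
    strict inequality of uniform continuity.\<close>
  proof (intro exI[of _ "min T (d/2)"] conjI allI impI)
    fix k t x :: real assume *: "0 \<le> k \<and> k \<le> min T (d/2) \<and> t \<ge> 0 \<and> x \<in> {0..L}"
    then obtain r n where r: "t = r + real n * T" "0 \<le> r" "r < T" using period_decompose \<open>T > 0\<close> by blast
    have sh: "f' (z + real n * T, x) = f' (z, x)" if "z \<ge> 0" for z
      by (rule periodic_shift[of "\<lambda>t. f' (t, x)"]) (use f * that \<open>T > 0\<close> in \<open>auto simp: periodic_C1_def\<close>)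
    have "f' (t, x) = f' (r, x)" "f' (t + k, x) = f' (r + k, x)"
      using sh[of r] sh[of "r + k"] r * by (auto simp: algebra_simps)
    moreover have "dist (f' (r + k, x)) (f' (r, x)) < e"
      using * r d(1) by (intro d(2)) (auto simp: dist_Pair_Pair dist_real_def)
    ultimately show "\<bar>f' (t + k, x) - f' (t, x)\<bar> \<le> e" by (simp add: dist_real_def)
  qed (use d \<open>T > 0\<close> in auto)
qed

lemma periodic_C1_difference_quotient:
  assumes f: "periodic_C1 T L f f'" and "T > 0" "e > 0"
  shows "\<exists>d>0. \<forall>k t x. 0 < k \<and> k \<le> d \<and> t \<ge> 0 \<and> x \<in> {0..L} \<longrightarrow>
    \<bar>f' (t + k, x) - f' (t, x)\<bar> \<le> e \<and> \<bar>(f (t + k, x) - f (t, x)) / k - f' (t, x)\<bar> \<le> e"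
proof -
  obtain d where d: "d > 0"
    "\<And>k t x. 0 \<le> k \<Longrightarrow> k \<le> d \<Longrightarrow> t \<ge> 0 \<Longrightarrow> x \<in> {0..L} \<Longrightarrow> \<bar>f' (t + k, x) - f' (t, x)\<bar> \<le> e"
    using periodic_C1_equicont[OF assms] by blast
  have "\<bar>(f (t + k, x) - f (t, x)) / k - f' (t, x)\<bar> \<le> e"
    if "0 < k" "k \<le> d" "t \<ge> 0" "x \<in> {0..L}" for k t x
  proof -
    have "{t..t + k} \<subseteq> {0..}" using that by auto
    moreover have "((\<lambda>t. f (t, x)) has_real_derivative f' (z, x)) (at z within {0..})" if "z \<in> {t..t + k}" for z
      using periodic_C1_deriv(1)[OF f, of z x] that \<open>0 \<le> t\<close> \<open>x \<in> {0..L}\<close> by auto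
    moreover have "t < t + k" using that by simp
    ultimately obtain z where z: "t < z" "z < t + k" "f (t + k, x) - f (t, x) = ((t + k) - t) * f' (z, x)"
      using real_has_deriv_mvt[of t "t + k" "\<lambda>t. f (t, x)" "\<lambda>t. f' (t, x)" "{0..}"] by blast
    then have "(f (t + k, x) - f (t, x)) / k = f' (z, x)" using that by simp
    then show ?thesis using d(2)[of "z - t" t x] z that by auto
  qed
  then show ?thesis using d by (intro exI[of _ d]) auto
qed

text \<open>Stationarity in t and in s gives the same value twice, because \<phi> sees only t - s;
  this coincidence is what doubling the time variable is for. In x the maximum may sit at an end of
  the closed interval, so only one-sided conditions are available, one for each side.\<close>

lemma doubled_max_conditions:
  fixes W :: "real \<Rightarrow> real \<Rightarrow> real"
  assumes le: "\<And>t s y. t \<ge> 0 \<Longrightarrow> s \<ge> 0 \<Longrightarrow> y \<in> {0..L} \<Longrightarrow> W t y - W s y \<le> M * p y * \<phi> (t - s)"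
    and eq: "W t x - W s x = M * p x * \<phi> (t - s)"
    and ts: "t > 0" "s > 0" "x \<in> {0..L}"
    and dt: "((\<lambda>t. W t x) has_real_derivative Wt) (at t)" "((\<lambda>t. W t x) has_real_derivative Ws) (at s)"
    and dx: "(W t has_real_derivative Xt) (at x within {0..L})" "(W s has_real_derivative Xs) (at x within {0..L})"
    and dp: "(p has_real_derivative p') (at x)" and dphi: "(\<phi> has_real_derivative \<phi>') (at (t - s))"
  shows "Wt = M * p x * \<phi>'" "Ws = M * p x * \<phi>'"
    and "x > 0 \<Longrightarrow> Xt - Xs \<ge> M * p' * \<phi> (t - s)" and "x < L \<Longrightarrow> Xt - Xs \<le> M * p' * \<phi> (t - s)"
proof -
  have d1: "((\<lambda>\<tau>. \<phi> (\<tau> - s)) has_real_derivative \<phi>' * (1 - 0)) (at t)"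
    by (rule DERIV_chain2[where f=\<phi> and g="\<lambda>\<tau>. \<tau> - s", OF dphi]) (intro DERIV_diff DERIV_const DERIV_ident)
  have d2: "((\<lambda>\<tau>. \<phi> (t - \<tau>)) has_real_derivative \<phi>' * (0 - 1)) (at s)"
    by (rule DERIV_chain2[where f=\<phi> and g="\<lambda>\<tau>. t - \<tau>", OF dphi]) (intro DERIV_diff DERIV_const DERIV_ident)
  have "((\<lambda>\<tau>. W \<tau> x - W s x - M * p x * \<phi> (\<tau> - s)) has_real_derivative Wt - 0 - M * p x * (\<phi>' * (1 - 0))) (at t)"
    by (intro DERIV_diff dt DERIV_const DERIV_cmult d1 d2)
  then have "Wt - 0 - M * p x * (\<phi>' * (1 - 0)) = 0"
    by (rule DERIV_local_max[OF _ ts(1)]) (use le ts eq in \<open>auto simp: abs_less_iff\<close>)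
  then show "Wt = M * p x * \<phi>'" by simp
  have "((\<lambda>\<tau>. W t x - W \<tau> x - M * p x * \<phi> (t - \<tau>)) has_real_derivative 0 - Ws - M * p x * (\<phi>' * (0 - 1))) (at s)"
    by (intro DERIV_diff dt DERIV_const DERIV_cmult d1 d2)
  then have "0 - Ws - M * p x * (\<phi>' * (0 - 1)) = 0"
    by (rule DERIV_local_max[OF _ ts(2)]) (use le ts eq in \<open>auto simp: abs_less_iff\<close>)
  then show "Ws = M * p x * \<phi>'" by simp
  let ?q = "\<lambda>y. W t y - W s y - M * \<phi> (t - s) * p y" and ?D = "Xt - Xs - M * \<phi> (t - s) * p'"
  have q: "(?q has_real_derivative ?D) (at x within {0..L})"
    by (intro DERIV_diff dx DERIV_cmult has_field_derivative_at_within[OF dp])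
  have q0: "?q y \<le> ?q x" if "y \<in> {0..L}" for y
    using le[of t s y] ts eq that by (simp add: mult.commute mult.left_commute)
  show "Xt - Xs \<ge> M * p' * \<phi> (t - s)" if "x > 0"
  proof (rule ccontr)
    assume "\<not> Xt - Xs \<ge> M * p' * \<phi> (t - s)"
    then have "?D < 0" by (simp add: mult.commute mult.left_commute)
    then obtain d where d: "d > 0" "\<And>h. h > 0 \<Longrightarrow> x - h \<in> {0..L} \<Longrightarrow> h < d \<Longrightarrow> ?q x < ?q (x - h)"
      using has_real_derivative_neg_dec_left[OF q] by blast
    have "?q x < ?q (x - min x d / 2)" using d(1) that ts by (intro d(2)) (auto simp: min_def field_simps)
    moreover have "?q (x - min x d / 2) \<le> ?q x"
      using d(1) that ts by (intro q0) (auto simp: min_def field_simps)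
    ultimately show False by simp
  qed
  show "Xt - Xs \<le> M * p' * \<phi> (t - s)" if "x < L"
  proof (rule ccontr)
    assume "\<not> Xt - Xs \<le> M * p' * \<phi> (t - s)"
    then have "?D > 0" by (simp add: mult.commute mult.left_commute)
    then obtain d where d: "d > 0" "\<And>h. h > 0 \<Longrightarrow> x + h \<in> {0..L} \<Longrightarrow> h < d \<Longrightarrow> ?q x < ?q (x + h)"
      using has_real_derivative_pos_inc_right[OF q] by blast
    have "?q x < ?q (x + min (L - x) d / 2)" using d(1) that ts by (intro d(2)) (auto simp: min_def field_simps)
    moreover have "?q (x + min (L - x) d / 2) \<le> ?q x"
      using d(1) that ts by (intro q0) (auto simp: min_def field_simps)
    ultimately show False by simp
  qed
qed

section \<open>The smoothed penalty and difference quotients of a transport equation\<close>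

definition soft_abs :: "real \<Rightarrow> real \<Rightarrow> real" where
  "soft_abs \<eta> r = sqrt (r\<^sup>2 + \<eta>\<^sup>2)"

text \<open>The lower bounds let the penalty be divided by, dominate |t - s| and dominate errors of
  order \<eta>; the upper bound returns |t - s| in the limit \<eta> \<longrightarrow> 0.\<close>

lemma soft_abs_bounds:
  assumes "\<eta> > 0"
  shows "\<bar>r\<bar> \<le> soft_abs \<eta> r" "\<eta> \<le> soft_abs \<eta> r" "soft_abs \<eta> r \<le> \<bar>r\<bar> + \<eta>" "soft_abs \<eta> r > 0"
    "soft_abs \<eta> (- r) = soft_abs \<eta> r"
proof -
  show "\<bar>r\<bar> \<le> soft_abs \<eta> r" "\<eta> \<le> soft_abs \<eta> r"
    unfolding soft_abs_def by (intro real_le_rsqrt; simp)+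
  then show "soft_abs \<eta> r > 0" using assms by linarith
  show "soft_abs \<eta> r \<le> \<bar>r\<bar> + \<eta>"
    unfolding soft_abs_def using assms by (intro real_le_lsqrt) (auto simp: power2_sum)
qed (simp add: soft_abs_def)

lemma soft_abs_mono: "\<bar>r\<bar> \<le> \<bar>s\<bar> \<Longrightarrow> soft_abs \<eta> r \<le> soft_abs \<eta> s"
  unfolding soft_abs_def by (simp add: abs_le_square_iff)

lemma soft_abs_deriv:
  assumes "\<eta> > 0"
  shows "(soft_abs \<eta> has_real_derivative r / soft_abs \<eta> r) (at r)"
proof -
  have "r\<^sup>2 + \<eta>\<^sup>2 > 0" using assms by (simp add: add_nonneg_pos)
  then show ?thesis
    unfolding soft_abs_def[abs_def] by (auto intro!: derivative_eq_intros simp: field_simps)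
qed

lemma soft_abs_deriv_bound: "\<eta> > 0 \<Longrightarrow> \<bar>r / soft_abs \<eta> r\<bar> \<le> 1"
  using soft_abs_bounds[of \<eta> r] by (simp add: field_simps)

text \<open>The equation is divided by the speed, so u_x has coefficient 1 and x acts as evolution
  variable. Differencing in t then places every variation of the coefficient on w, which is known to
  be bounded.\<close>

locale transport =
  fixes T L :: real and u w X a A F H :: "real \<times> real \<Rightarrow> real"
  assumes T: "T > 0" and L: "L > 0"
    and u: "periodic_C1 T L u w" and a: "periodic_C1 T L a A" and F: "periodic_C1 T L F H"
    and dx: "\<And>t x. t \<ge> 0 \<Longrightarrow> x \<in> {0..L} \<Longrightarrow>
      ((\<lambda>x. u (t, x)) has_real_derivative X (t, x)) (at x within {0..L})"
    and eq: "\<And>t x. t \<ge> 0 \<Longrightarrow> x \<in> {0..L} \<Longrightarrow> X (t, x) + a (t, x) * w (t, x) = F (t, x)"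
begin

definition quot :: "real \<Rightarrow> real \<Rightarrow> real \<Rightarrow> real" where
  "quot k t x = (u (t + k, x) - u (t, x)) / k"

definition quot_source :: "real \<Rightarrow> real \<Rightarrow> real \<Rightarrow> real" where
  "quot_source k t x = (F (t + k, x) - F (t, x)) / k - (a (t + k, x) - a (t, x)) / k * w (t + k, x)"

definition source :: "real \<Rightarrow> real \<Rightarrow> real" where
  "source t x = H (t, x) - A (t, x) * w (t, x)"

lemma quot_dt:
  assumes "t > 0" "k > 0" "x \<in> {0..L}"
  shows "((\<lambda>t. quot k t x) has_real_derivative (w (t + k, x) - w (t, x)) / k) (at t)"
proof -
  have "((\<lambda>t. u (t + k, x)) has_real_derivative w (t + k, x)) (at t)"
    using periodic_C1_deriv_at[OF u, of "t + k" x] assms DERIV_at_within_shift[of "\<lambda>t. u (t, x)" _ k t UNIV]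
    by (simp add: add.commute)
  then show ?thesis
    unfolding quot_def using assms by (intro DERIV_cdivide DERIV_diff periodic_C1_deriv_at[OF u])
qed

lemma quot_dx:
  assumes "t \<ge> 0" "k > 0" "x \<in> {0..L}"
  shows "(quot k t has_real_derivative (X (t + k, x) - X (t, x)) / k) (at x within {0..L})"
  unfolding quot_def using assms by (intro DERIV_cdivide DERIV_diff dx) auto

text \<open>Discrete product rule: the increment of a w is a(t) times the increment of w plus the
  increment of a times w(t + k). The equation for the quotient is therefore exact for each k, with
  only first derivatives of u in it.\<close>

lemma quot_eq:
  assumes "t \<ge> 0" "k > 0" "x \<in> {0..L}"
  shows "(X (t + k, x) - X (t, x)) / k + a (t, x) * ((w (t + k, x) - w (t, x)) / k) = quot_source k t x"
proof -
  have 1: "X (t, x) = F (t, x) - a (t, x) * w (t, x)" "X (t + k, x) = F (t + k, x) - a (t + k, x) * w (t + k, x)"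
    using eq[of t x] eq[of "t + k" x] assms by auto
  have "(X (t + k, x) - X (t, x)) + a (t, x) * (w (t + k, x) - w (t, x)) =
      (F (t + k, x) - F (t, x)) - (a (t + k, x) - a (t, x)) * w (t + k, x)"
    unfolding 1 by (simp add: algebra_simps)
  from arg_cong[OF this, of "\<lambda>z. z / k"] show ?thesis
    by (simp add: quot_source_def add_divide_distrib diff_divide_distrib left_diff_distrib right_diff_distrib)
qed

lemma quot_periodic: "t \<ge> 0 \<Longrightarrow> k > 0 \<Longrightarrow> x \<in> {0..L} \<Longrightarrow> quot k (t + T) x = quot k t x"
  using periodic_C1_deriv(2)[OF u, of t x] periodic_C1_deriv(2)[OF u, of "t + k" x]
  by (simp add: quot_def algebra_simps)

lemma quot_cont:
  assumes "k > 0"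
  shows "continuous_on (strip L) (\<lambda>p. quot k (fst p) (snd p))"
proof -
  have c: "continuous_on (strip L) u" using u by (simp add: periodic_C1_def)
  have "continuous_on (strip L) (\<lambda>p. u (fst p + k, snd p))"
    by (rule continuous_on_compose2[OF c]) (use assms in \<open>auto intro!: continuous_intros simp: strip_def\<close>)
  then show ?thesis
    unfolding quot_def using assms c by (auto intro!: continuous_intros)
qed

text \<open>The error in the source has three parts of size at most e: that of F, an increment of w
  times a quotient of a (of modulus at most 1), and the error of that quotient times w (of modulus
  at most 1).\<close>

lemma quot_approx:
  assumes w1: "\<And>t x. t \<ge> 0 \<Longrightarrow> x \<in> {0..L} \<Longrightarrow> \<bar>w (t, x)\<bar> \<le> 1"
    and alip: "\<And>t s x. t \<ge> 0 \<Longrightarrow> s \<ge> 0 \<Longrightarrow> x \<in> {0..L} \<Longrightarrow> \<bar>a (t, x) - a (s, x)\<bar> \<le> \<bar>t - s\<bar>"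
    and e: "e > 0"
  shows "\<exists>d>0. \<forall>k t x. 0 < k \<and> k \<le> d \<and> t \<ge> 0 \<and> x \<in> {0..L} \<longrightarrow>
    \<bar>quot k t x - w (t, x)\<bar> \<le> e \<and> \<bar>quot_source k t x - source t x\<bar> \<le> 3 * e"
proof -
  obtain d1 where d1: "d1 > 0" "\<And>k t x. 0 < k \<Longrightarrow> k \<le> d1 \<Longrightarrow> t \<ge> 0 \<Longrightarrow> x \<in> {0..L} \<Longrightarrow>
      \<bar>w (t + k, x) - w (t, x)\<bar> \<le> e \<and> \<bar>(u (t + k, x) - u (t, x)) / k - w (t, x)\<bar> \<le> e"
    using periodic_C1_difference_quotient[OF u T e] by blast
  obtain d2 where d2: "d2 > 0" "\<And>k t x. 0 < k \<Longrightarrow> k \<le> d2 \<Longrightarrow> t \<ge> 0 \<Longrightarrow> x \<in> {0..L} \<Longrightarrow>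
      \<bar>(a (t + k, x) - a (t, x)) / k - A (t, x)\<bar> \<le> e"
    using periodic_C1_difference_quotient[OF a T e] by blast
  obtain d3 where d3: "d3 > 0" "\<And>k t x. 0 < k \<Longrightarrow> k \<le> d3 \<Longrightarrow> t \<ge> 0 \<Longrightarrow> x \<in> {0..L} \<Longrightarrow>
      \<bar>(F (t + k, x) - F (t, x)) / k - H (t, x)\<bar> \<le> e"
    using periodic_C1_difference_quotient[OF F T e] by blast
  have "\<bar>quot k t x - w (t, x)\<bar> \<le> e \<and> \<bar>quot_source k t x - source t x\<bar> \<le> 3 * e"
    if k: "0 < k" "k \<le> min d1 (min d2 d3)" "t \<ge> 0" "x \<in> {0..L}" for k t x
  proof -
    define q where "q = (a (t + k, x) - a (t, x)) / k"
    have "\<bar>q\<bar> \<le> 1" using alip[of "t + k" t x] k by (simp add: q_def field_simps)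
    then have 1: "\<bar>q * (w (t + k, x) - w (t, x))\<bar> \<le> 1 * e"
      unfolding abs_mult using d1(2)[of k t x] k by (intro mult_mono) auto
    have 2: "\<bar>(q - A (t, x)) * w (t, x)\<bar> \<le> e * 1"
      unfolding abs_mult using d2(2)[of k t x, folded q_def] w1[of t x] k e by (intro mult_mono) auto
    have "quot_source k t x - source t x = ((F (t + k, x) - F (t, x)) / k - H (t, x))
        - q * (w (t + k, x) - w (t, x)) - (q - A (t, x)) * w (t, x)"
      by (simp add: quot_source_def source_def left_diff_distrib right_diff_distrib flip: q_def)
    moreover have "\<bar>(F (t + k, x) - F (t, x)) / k - H (t, x)\<bar> \<le> e" using d3(2) k by simp
    ultimately have "\<bar>quot_source k t x - source t x\<bar> \<le> 3 * e" using 1 2 by linarith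
    then show ?thesis using d1(2)[of k t x] k by (simp add: quot_def)
  qed
  then show ?thesis using d1 d2 d3 by (intro exI[of _ "min d1 (min d2 d3)"]) auto
qed

text \<open>M is the best constant, that is, the maximum over a compact window of the difference
  divided by p times the penalty. It serves for all times since \<open>period_reduce\<close> never
  increases |t - s|, on which the penalty depends monotonically.\<close>

lemma doubled_maximum_exists:
  assumes k: "k > 0" and \<eta>: "\<eta> > 0" and p: "continuous_on {0..L} p" "\<And>x. x \<in> {0..L} \<Longrightarrow> p x > 0"
  shows "\<exists>M\<ge>0. (\<exists>t\<in>{T..3*T}. \<exists>s\<in>{T..3*T}. \<exists>x\<in>{0..L}. quot k t x - quot k s x = M * p x * soft_abs \<eta> (t - s)) \<and>
    (\<forall>t\<ge>0. \<forall>s\<ge>0. \<forall>x\<in>{0..L}. quot k t x - quot k s x \<le> M * p x * soft_abs \<eta> (t - s))"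
proof -
  let ?K = "({T..3*T} \<times> {T..3*T}) \<times> {0..L}"
  let ?R = "\<lambda>z. (quot k (fst (fst z)) (snd z) - quot k (snd (fst z)) (snd z)) /
    (p (snd z) * soft_abs \<eta> (fst (fst z) - snd (fst z)))"
  have K: "compact ?K" "?K \<noteq> {}" using T L by (auto intro: compact_Times)
  have R: "continuous_on ?K ?R"
  proof (intro continuous_on_divide continuous_on_diff continuous_on_mult)
    have c: "continuous_on ?K (\<lambda>z. quot k (fst (\<pi> z)) (snd (\<pi> z)))"
      if "continuous_on ?K \<pi>" "\<pi> ` ?K \<subseteq> strip L" for \<pi>
      by (rule continuous_on_compose2[OF quot_cont[OF k] that])
    show "continuous_on ?K (\<lambda>z. quot k (fst (fst z)) (snd z))" "continuous_on ?K (\<lambda>z. quot k (snd (fst z)) (snd z))"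
      using T by (auto simp: strip_def intro!: continuous_intros c[of "\<lambda>z. (fst (fst z), snd z)", simplified]
          c[of "\<lambda>z. (snd (fst z), snd z)", simplified])
    show "continuous_on ?K (\<lambda>z. p (snd z))"
      by (rule continuous_on_compose2[OF p(1)]) (auto intro!: continuous_intros)
    show "continuous_on ?K (\<lambda>z. soft_abs \<eta> (fst (fst z) - snd (fst z)))"
      unfolding soft_abs_def by (intro continuous_intros)
    show "\<forall>z\<in>?K. p (snd z) * soft_abs \<eta> (fst (fst z) - snd (fst z)) \<noteq> 0"
    proof
      fix z assume "z \<in> ?K"
      then show "p (snd z) * soft_abs \<eta> (fst (fst z) - snd (fst z)) \<noteq> 0"
        using p(2)[of "snd z"] soft_abs_bounds(4)[OF \<eta>, of "fst (fst z) - snd (fst z)"] by auto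
    qed
  qed
  obtain z where z: "z \<in> ?K" "\<And>y. y \<in> ?K \<Longrightarrow> ?R y \<le> ?R z"
    using continuous_attains_sup[OF K R] by blast
  define M where "M = ?R z"
  \<comment> \<open>On the diagonal t = s the quotient is 0, so its maximum is not negative.\<close>
  have M: "M \<ge> 0" using z(2)[of "((T, T), 0)"] T L by (auto simp: M_def)
  obtain t0 s0 x0 where z0: "z = ((t0, s0), x0)" by (metis prod.collapse)
  have "quot k t0 x0 - quot k s0 x0 = M * p x0 * soft_abs \<eta> (t0 - s0)"
    using p(2)[of x0] z(1) soft_abs_bounds(4)[OF \<eta>, of "t0 - s0"] by (auto simp: M_def z0)
  moreover have "quot k t x - quot k s x \<le> M * p x * soft_abs \<eta> (t - s)"
    if tsx: "t \<ge> 0" "s \<ge> 0" "x \<in> {0..L}" for t s x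
  proof -
    obtain t' s' where t's': "t' \<in> {T..3*T}" "s' \<in> {T..3*T}" "\<bar>t' - s'\<bar> \<le> \<bar>t - s\<bar>"
      "same_phase T t t'" "same_phase T s s'"
      using period_reduce[OF T tsx(1,2)] by blast
    have q: "quot k t' x = quot k t x" "quot k s' x = quot k s x"
      using t's'(4,5)[unfolded same_phase_def, THEN spec[of _ "\<lambda>t. quot k t x"]] quot_periodic[OF _ k tsx(3)] by simp_all
    have "?R ((t', s'), x) \<le> M" using z(2)[of "((t', s'), x)"] t's' tsx by (simp add: M_def)
    then have "quot k t' x - quot k s' x \<le> M * (p x * soft_abs \<eta> (t' - s'))"
      using p(2)[OF tsx(3)] soft_abs_bounds(4)[OF \<eta>, of "t' - s'"] by (simp add: pos_divide_le_eq)
    also have "\<dots> \<le> M * (p x * soft_abs \<eta> (t - s))"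
      using soft_abs_mono[OF t's'(3)] M p(2)[OF tsx(3)] by (intro mult_left_mono) auto
    finally show ?thesis using q by (simp add: mult_ac)
  qed
  moreover have "t0 \<in> {T..3*T}" "s0 \<in> {T..3*T}" "x0 \<in> {0..L}" using z(1) by (auto simp: z0)
  ultimately show ?thesis using M by blast
qed

text \<open>The time derivatives of the quotient at t and s have the common value V, so subtracting
  the two transport equations cancels them except for V times the increment of a. That term is at
  most 2 \<epsilon> M times the penalty: |V| \<le> M p, p \<le> 2, and the penalty dominates |t -
  s|. What remains is the x-derivative, controlled by p'.\<close>

lemma quot_source_at_maximum:
  assumes k: "k > 0" and \<eta>: "\<eta> > 0" and M: "M \<ge> 0"
    and dom: "\<And>t s x. t \<ge> 0 \<Longrightarrow> s \<ge> 0 \<Longrightarrow> x \<in> {0..L} \<Longrightarrow> quot k t x - quot k s x \<le> M * p x * soft_abs \<eta> (t - s)"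
    and ts: "t > 0" "s > 0" "x \<in> {0..L}"
    and at: "quot k t x - quot k s x = M * p x * soft_abs \<eta> (t - s)"
    and p: "(p has_real_derivative p') (at x)" "0 \<le> p x" "p x \<le> 2"
    and alip: "\<bar>a (t, x) - a (s, x)\<bar> \<le> \<epsilon> * \<bar>t - s\<bar>" "0 \<le> \<epsilon>"
  shows "x > 0 \<Longrightarrow> p' * (M * soft_abs \<eta> (t - s)) - 2 * \<epsilon> * (M * soft_abs \<eta> (t - s)) \<le> quot_source k t x - quot_source k s x"
    and "x < L \<Longrightarrow> quot_source k t x - quot_source k s x \<le> p' * (M * soft_abs \<eta> (t - s)) + 2 * \<epsilon> * (M * soft_abs \<eta> (t - s))"
proof -
  let ?\<phi> = "soft_abs \<eta> (t - s)"
  define V where "V = M * p x * ((t - s) / ?\<phi>)"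
  note \<phi> = soft_abs_bounds[OF \<eta>, of "t - s"]
  note mc = doubled_max_conditions[OF dom at ts quot_dt[OF ts(1) k ts(3)] quot_dt[OF ts(2) k ts(3)]
      quot_dx[OF less_imp_le[OF ts(1)] k ts(3)] quot_dx[OF less_imp_le[OF ts(2)] k ts(3)] p(1) soft_abs_deriv[OF \<eta>]]
  have wt: "(w (t + k, x) - w (t, x)) / k = V" "(w (s + k, x) - w (s, x)) / k = V"
    unfolding V_def by ((rule mc(1); assumption), (rule mc(2); assumption))
  have "quot_source k t x = (X (t + k, x) - X (t, x)) / k + a (t, x) * V"
    "quot_source k s x = (X (s + k, x) - X (s, x)) / k + a (s, x) * V"
    using quot_eq[of t k x] quot_eq[of s k x] ts k unfolding wt by simp_all
  then have split: "quot_source k t x - quot_source k s x =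
      ((X (t + k, x) - X (t, x)) / k - (X (s + k, x) - X (s, x)) / k) + V * (a (t, x) - a (s, x))"
    by (simp add: algebra_simps)
  have "\<bar>a (t, x) - a (s, x)\<bar> \<le> \<epsilon> * ?\<phi>" using alip(1) mult_left_mono[OF \<phi>(1) alip(2)] by linarith
  then have "(M * p x) * (\<bar>(t - s) / ?\<phi>\<bar> * \<bar>a (t, x) - a (s, x)\<bar>) \<le> (M * 2) * (1 * (\<epsilon> * ?\<phi>))"
    using M p soft_abs_deriv_bound[OF \<eta>, of "t - s"] \<phi> alip(2) by (intro mult_mono mult_nonneg_nonneg) auto
  then have drift: "\<bar>V * (a (t, x) - a (s, x))\<bar> \<le> 2 * \<epsilon> * (M * ?\<phi>)"
    using M p by (simp add: V_def abs_mult mult_ac)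
  have collect: "a \<le> r + q" "r' \<le> b \<Longrightarrow> r' - q \<le> a" if "a = b + v" "b \<le> r" "\<bar>v\<bar> \<le> q" for a b v r r' q :: real
    using that by linarith+
  show "p' * (M * ?\<phi>) - 2 * \<epsilon> * (M * ?\<phi>) \<le> quot_source k t x - quot_source k s x" if "x > 0"
    using mc(3)[OF _ _ _ that] by (intro collect(2)[OF split order_refl drift]) (simp add: mult_ac)
  show "quot_source k t x - quot_source k s x \<le> p' * (M * ?\<phi>) + 2 * \<epsilon> * (M * ?\<phi>)" if "x < L"
    using mc(4)[OF _ _ _ that] by (intro collect(1)[OF split _ drift]) (simp add: mult_ac)
qed

end

section \<open>The coupled system and its weighted maximum estimate\<close>

lemma reflection_bound:
  fixes V :: real
  assumes "U = d / k + \<kappa> * V" "d \<le> D * k * r" "k > 0" "r \<le> f" "0 \<le> D" "\<bar>V\<bar> \<le> v"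
  shows "U \<le> D * f + \<bar>\<kappa>\<bar> * v"
proof -
  have "d / k \<le> D * r" using assms(2,3) by (simp add: field_simps)
  moreover have "D * r \<le> D * f" using assms by (intro mult_left_mono)
  moreover have "\<bar>\<kappa> * V\<bar> \<le> \<bar>\<kappa>\<bar> * v" unfolding abs_mult using assms by (intro mult_left_mono) auto
  ultimately show ?thesis using assms(1) by linarith
qed

text \<open>In \<open>source1\<close> and \<open>source2\<close>, Y bounds the very differences to
  be estimated, so it may only carry the small factor \<epsilon>. The damping term is not small and
  is kept exactly, to be used through its sign; this sign is opposite in the two components because
  they travel in opposite directions. C and D collect what is merely Lipschitz in the sources and
  the boundary data. The conditions on \<delta> and m keep the weights near 1, beat the damping
  remainder (m) and leave a margin at either reflection.\<close>

locale doubling =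
  t1: transport T L u1 w1 X1 a1 A1 F1 H1 + t2: transport T L u2 w2 X2 a2 A2 F2 H2
  for T L u1 w1 X1 a1 A1 F1 H1 u2 w2 X2 a2 A2 F2 H2 +
  fixes \<kappa>1 \<kappa>2 \<epsilon> C D K \<delta> m :: real and c1 c2 :: "real \<times> real \<Rightarrow> real" and b1 b2 :: "real \<Rightarrow> real"
  assumes eps: "0 \<le> \<epsilon>" "\<epsilon> \<le> 1" "8 * \<epsilon> \<le> \<delta>"
    and const: "0 \<le> C" "0 \<le> D" "0 \<le> K" "0 < \<delta>" "m \<ge> 2 * K + 1"
      "\<delta> * exp (m * L) \<le> 1 / 2" "4 * (\<delta> * exp (m * L)) \<le> 1 - \<bar>\<kappa>1\<bar>" "\<delta> \<le> 1 - \<bar>\<kappa>2\<bar>"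
    and alip: "\<And>t s x. t \<ge> 0 \<Longrightarrow> s \<ge> 0 \<Longrightarrow> x \<in> {0..L} \<Longrightarrow> \<bar>a1 (t, x) - a1 (s, x)\<bar> \<le> \<epsilon> * \<bar>t - s\<bar>"
      "\<And>t s x. t \<ge> 0 \<Longrightarrow> s \<ge> 0 \<Longrightarrow> x \<in> {0..L} \<Longrightarrow> \<bar>a2 (t, x) - a2 (s, x)\<bar> \<le> \<epsilon> * \<bar>t - s\<bar>"
    and wbound: "\<And>t x. t \<ge> 0 \<Longrightarrow> x \<in> {0..L} \<Longrightarrow> \<bar>w1 (t, x)\<bar> \<le> 1"
      "\<And>t x. t \<ge> 0 \<Longrightarrow> x \<in> {0..L} \<Longrightarrow> \<bar>w2 (t, x)\<bar> \<le> 1"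
    and coeff: "\<And>t x. t \<ge> 0 \<Longrightarrow> x \<in> {0..L} \<Longrightarrow> 0 \<le> c1 (t, x) \<and> c1 (t, x) \<le> K"
      "\<And>t x. t \<ge> 0 \<Longrightarrow> x \<in> {0..L} \<Longrightarrow> 0 \<le> c2 (t, x) \<and> c2 (t, x) \<le> K"
    and source1: "\<And>t s x Y. t \<ge> 0 \<Longrightarrow> s \<ge> 0 \<Longrightarrow> x \<in> {0..L} \<Longrightarrow>
        \<bar>w1 (t, x) - w1 (s, x)\<bar> \<le> Y \<Longrightarrow> \<bar>w2 (t, x) - w2 (s, x)\<bar> \<le> Y \<Longrightarrow>
        \<bar>t1.source t x - t1.source s x - c1 (t, x) * ((w1 (t, x) - w1 (s, x)) + (w2 (t, x) - w2 (s, x)))\<bar>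
          \<le> \<epsilon> * Y + C * \<bar>t - s\<bar>"
    and source2: "\<And>t s x Y. t \<ge> 0 \<Longrightarrow> s \<ge> 0 \<Longrightarrow> x \<in> {0..L} \<Longrightarrow>
        \<bar>w1 (t, x) - w1 (s, x)\<bar> \<le> Y \<Longrightarrow> \<bar>w2 (t, x) - w2 (s, x)\<bar> \<le> Y \<Longrightarrow>
        \<bar>t2.source t x - t2.source s x + c2 (t, x) * ((w1 (t, x) - w1 (s, x)) + (w2 (t, x) - w2 (s, x)))\<bar>
          \<le> \<epsilon> * Y + C * \<bar>t - s\<bar>"
    and boundary: "\<And>t. t \<ge> 0 \<Longrightarrow> u2 (t, 0) = b2 t + \<kappa>2 * u1 (t, 0)"
      "\<And>t. t \<ge> 0 \<Longrightarrow> u1 (t, L) = b1 t + \<kappa>1 * u2 (t, L)"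
    and data: "\<And>t s k. t > 0 \<Longrightarrow> s > 0 \<Longrightarrow> k > 0 \<Longrightarrow> (b1 (t + k) - b1 t) - (b1 (s + k) - b1 s) \<le> D * k * \<bar>t - s\<bar>"
      "\<And>t s k. t > 0 \<Longrightarrow> s > 0 \<Longrightarrow> k > 0 \<Longrightarrow> (b2 (t + k) - b2 t) - (b2 (s + k) - b2 s) \<le> D * k * \<bar>t - s\<bar>"
begin

text \<open>A strict supersolution of the linearised system: the damping K (w1 + w2) is compensated
  because p2 - p1 grows at a rate larger than 2 K, and the boundary reflections because the
  weights are close to 1.\<close>

definition p1 :: "real \<Rightarrow> real" where "p1 x = 1 - \<delta> * exp (m * x)"
definition p2 :: "real \<Rightarrow> real" where "p2 x = 1 + \<delta> * exp (m * x)"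

lemma exp_bounds:
  assumes "x \<in> {0..L}"
  shows "1 \<le> exp (m * x)" "\<delta> * exp (m * x) \<le> 1 / 2"
proof -
  have m: "m \<ge> 1" using const by linarith
  show "1 \<le> exp (m * x)" using m assms by simp
  have "exp (m * x) \<le> exp (m * L)" using m assms by simp
  then have "\<delta> * exp (m * x) \<le> \<delta> * exp (m * L)" using const by (intro mult_left_mono) auto
  then show "\<delta> * exp (m * x) \<le> 1 / 2" using const by linarith
qed

lemma p_bounds:
  assumes "x \<in> {0..L}"
  shows "1 / 2 \<le> p1 x" "p1 x \<le> 1" "1 \<le> p2 x" "p2 x \<le> 2"
  using exp_bounds[OF assms] const by (auto simp: p1_def p2_def)

lemma p_deriv:
  "(p1 has_real_derivative - m * (\<delta> * exp (m * x))) (at x)"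
  "(p2 has_real_derivative m * (\<delta> * exp (m * x))) (at x)"
  unfolding p1_def[abs_def] p2_def[abs_def] by (auto intro!: derivative_eq_intros)

text \<open>At its inflow end a component is bounded through the reflection, with a margin from 1 -
  |\<kappa>|; everywhere else through the equation, with a margin \<delta> P from the growth of its
  weight. The outflow ends are no special case, since the one-sided x-derivative has the required
  sign there. Division by the penalty removes t and s.\<close>

lemma doubled_maximum_bound:
  assumes k: "k > 0" and e: "e > 0" and \<eta>: "\<eta> > 0" and M: "M \<ge> 0"
    and ap1: "\<And>t x. t \<ge> 0 \<Longrightarrow> x \<in> {0..L} \<Longrightarrow>
      \<bar>t1.quot k t x - w1 (t, x)\<bar> \<le> e \<and> \<bar>t1.quot_source k t x - t1.source t x\<bar> \<le> 3 * e"
    and ap2: "\<And>t x. t \<ge> 0 \<Longrightarrow> x \<in> {0..L} \<Longrightarrow>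
      \<bar>t2.quot k t x - w2 (t, x)\<bar> \<le> e \<and> \<bar>t2.quot_source k t x - t2.source t x\<bar> \<le> 3 * e"
    and dom1: "\<And>t s x. t \<ge> 0 \<Longrightarrow> s \<ge> 0 \<Longrightarrow> x \<in> {0..L} \<Longrightarrow>
      t1.quot k t x - t1.quot k s x \<le> M * p1 x * soft_abs \<eta> (t - s)"
    and dom2: "\<And>t s x. t \<ge> 0 \<Longrightarrow> s \<ge> 0 \<Longrightarrow> x \<in> {0..L} \<Longrightarrow>
      t2.quot k t x - t2.quot k s x \<le> M * p2 x * soft_abs \<eta> (t - s)"
    and ts: "t > 0" "s > 0" "x \<in> {0..L}"
    and att: "t1.quot k t x - t1.quot k s x = M * p1 x * soft_abs \<eta> (t - s) \<or>
      t2.quot k t x - t2.quot k s x = M * p2 x * soft_abs \<eta> (t - s)"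
  shows "M * (\<delta> / 2) \<le> C + D + e / \<eta> * (4 * K + 8)"
proof -
  let ?\<phi> = "soft_abs \<eta> (t - s)"
  define P where "P = M * ?\<phi>"
  define E where "E = \<delta> * exp (m * x)"
  define Z1 where "Z1 = w1 (t, x) - w1 (s, x)"
  define Z2 where "Z2 = w2 (t, x) - w2 (s, x)"
  note \<phi> = soft_abs_bounds[OF \<eta>, of "t - s"]
  have P: "P \<ge> 0" using M \<phi> by (simp add: P_def)
  have E: "\<delta> \<le> E" "E \<le> 1 / 2" using exp_bounds[OF ts(3)] const by (auto simp: E_def)
  have p: "p1 x = 1 - E" "p2 x = 1 + E" by (auto simp: p1_def p2_def E_def)
  have sym: "soft_abs \<eta> (s - t) = ?\<phi>" using soft_abs_bounds(5)[OF \<eta>, of "t - s"] by simp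
  have q1: "\<bar>t1.quot k t x - t1.quot k s x\<bar> \<le> p1 x * P"
    using dom1[of t s x] dom1[of s t x] ts by (auto simp: P_def sym abs_le_iff mult_ac)
  have q2: "\<bar>t2.quot k t x - t2.quot k s x\<bar> \<le> p2 x * P"
    using dom2[of t s x] dom2[of s t x] ts by (auto simp: P_def sym abs_le_iff mult_ac)
  have z1: "\<bar>Z1 - (t1.quot k t x - t1.quot k s x)\<bar> \<le> 2 * e"
    using ap1[of t x] ap1[of s x] ts unfolding Z1_def by linarith
  have z2: "\<bar>Z2 - (t2.quot k t x - t2.quot k s x)\<bar> \<le> 2 * e"
    using ap2[of t x] ap2[of s x] ts unfolding Z2_def by linarith
  \<comment> \<open>A common bound for both differences of w: the weights are at most 2, and passing
    from quotients to w costs e at each of the two times.\<close>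
  define Y where "Y = 2 * P + 2 * e"
  have "p1 x * P \<le> 2 * P" "p2 x * P \<le> 2 * P" using P E const by (auto simp: p intro!: mult_right_mono)
  then have Y: "\<bar>Z1\<bar> \<le> Y" "\<bar>Z2\<bar> \<le> Y" using q1 q2 z1 z2 unfolding Y_def by linarith+
  have eY: "\<epsilon> * Y \<le> 2 * \<epsilon> * P + 2 * e"
    using eps e mult_right_mono[of \<epsilon> 1 "2 * e"] by (simp add: Y_def algebra_simps)
  have Cd: "C * \<bar>t - s\<bar> \<le> C * ?\<phi>" using const \<phi> by (intro mult_left_mono) auto
  \<comment> \<open>The quadratic terms amount to 4 \<epsilon> P \<le> \<delta> P / 2 and are
    absorbed, which leaves the factor \<delta> / 2. Errors of order e turn into (e / \<eta>) times
    the penalty, as the penalty is at least \<eta>.\<close>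
  have concl: ?thesis if "\<delta> * P \<le> 4 * \<epsilon> * P + 4 * e * K + 8 * e + C * ?\<phi>"
  proof -
    have "8 * \<epsilon> * P \<le> \<delta> * P" using eps P by (intro mult_right_mono) auto
    then have "\<delta> / 2 * P \<le> C * ?\<phi> + e * (4 * K + 8)" using that by (simp add: algebra_simps)
    also have "e * (4 * K + 8) \<le> (e / \<eta> * (4 * K + 8)) * ?\<phi>"
    proof -
      have "(e / \<eta> * (4 * K + 8)) * \<eta> \<le> (e / \<eta> * (4 * K + 8)) * ?\<phi>"
        using \<phi> e \<eta> const by (intro mult_left_mono) auto
      then show ?thesis using \<eta> by simp
    qed
    finally have "(M * (\<delta> / 2)) * ?\<phi> \<le> (C + e / \<eta> * (4 * K + 8)) * ?\<phi>"
      by (simp add: P_def algebra_simps)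
    then have "M * (\<delta> / 2) \<le> C + e / \<eta> * (4 * K + 8)" using \<phi>(4) by simp
    then show ?thesis using const by linarith
  qed
  have concl': ?thesis if "M * \<delta> \<le> D"
  proof -
    have "M * (\<delta> / 2) \<le> M * \<delta>" using M const by (intro mult_left_mono) auto
    moreover have "0 \<le> e / \<eta> * (4 * K + 8)" using e \<eta> const by simp
    ultimately show ?thesis using that const by linarith
  qed
  from att show ?thesis
  proof
    assume at: "t2.quot k t x - t2.quot k s x = M * p2 x * ?\<phi>"
    show ?thesis
    proof (cases "x = 0")
      case True
      have u2q: "t2.quot k \<tau> 0 = (b2 (\<tau> + k) - b2 \<tau>) / k + \<kappa>2 * t1.quot k \<tau> 0" if "\<tau> > 0" for \<tau>
        using boundary(1)[of \<tau>] boundary(1)[of "\<tau> + k"] that k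
        by (simp add: t1.quot_def t2.quot_def field_simps)
      have "p2 0 * P = ((b2 (t + k) - b2 t) - (b2 (s + k) - b2 s)) / k + \<kappa>2 * (t1.quot k t 0 - t1.quot k s 0)"
        using at u2q[OF ts(1)] u2q[OF ts(2)] True by (simp add: P_def algebra_simps diff_divide_distrib add_divide_distrib)
      moreover have "p1 0 * P \<le> 1 * P" using P p_bounds(2)[OF ts(3)] True by (intro mult_right_mono) auto
      then have "\<bar>t1.quot k t 0 - t1.quot k s 0\<bar> \<le> P" using q1 True by simp
      ultimately have "p2 0 * P \<le> D * ?\<phi> + \<bar>\<kappa>2\<bar> * P"
        by (rule reflection_bound[OF _ data(2)[OF ts(1,2) k] k \<phi>(1) const(2)])
      \<comment> \<open>At x = 0 the weights help: the outgoing component carries a weight at most 1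
        and the reflected one a weight at least 1, so the margin is at least 1 -
        |\<kappa>2|.\<close>
      moreover have "1 * P \<le> p2 0 * P" using P p_bounds(3)[OF ts(3)] True by (intro mult_right_mono) auto
      moreover have "\<delta> * P \<le> (1 - \<bar>\<kappa>2\<bar>) * P" using P const by (intro mult_right_mono) auto
      ultimately have "\<delta> * P \<le> D * ?\<phi>" by (simp add: algebra_simps)
      then have "(M * \<delta>) * ?\<phi> \<le> D * ?\<phi>" by (simp add: P_def mult_ac)
      then show ?thesis using \<phi>(4) by (intro concl') simp
    next
      case False
      then have x: "x > 0" using ts by simp
      have n1: "m * E * P - 2 * \<epsilon> * P \<le> t2.quot_source k t x - t2.quot_source k s x"
        using t2.quot_source_at_maximum(1)[OF k \<eta> M dom2 ts at p_deriv(2) _ _ alip(2) eps(1)] ts x p_bounds[OF ts(3)]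
        by (simp add: P_def E_def mult_ac)
      have n2: "t2.quot_source k t x - t2.quot_source k s x \<le> t2.source t x - t2.source s x + 6 * e"
        using ap2[of t x] ap2[of s x] ts by linarith
      have n3: "t2.source t x - t2.source s x \<le> - (c2 (t, x) * (Z1 + Z2)) + \<epsilon> * Y + C * \<bar>t - s\<bar>"
        using source2[of t s x Y] Y ts unfolding Z1_def Z2_def by linarith
      have "p2 x * P = t2.quot k t x - t2.quot k s x" using at by (simp add: P_def mult_ac)
      \<comment> \<open>The second component attains the maximum and has the larger weight, so it
        dominates the first: the sum Z1 + Z2 is nonnegative up to the approximation error, and the
        damping term has the good sign.\<close>
      moreover have "p1 x * P \<le> p2 x * P" using E P const p by (intro mult_right_mono) auto
      ultimately have "Z1 + Z2 \<ge> - (4 * e)" using q1 z1 z2 by linarith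
      moreover have c: "0 \<le> c2 (t, x)" "c2 (t, x) \<le> K" using coeff(2)[of t x] ts by auto
      ultimately have "c2 (t, x) * (Z1 + Z2) \<ge> c2 (t, x) * (- (4 * e))" by (intro mult_left_mono)
      moreover have "c2 (t, x) * (4 * e) \<le> K * (4 * e)" using c e by (intro mult_right_mono) auto
      ultimately have n4: "- (c2 (t, x) * (Z1 + Z2)) \<le> 4 * e * K" by (simp add: algebra_simps)
      have "1 * \<delta> \<le> m * E" using const E by (intro mult_mono) auto
      then have n5: "\<delta> * P \<le> m * E * P" using P by (intro mult_right_mono) auto
      show ?thesis
        using n1 n2 n3 n4 n5 eY Cd by (intro concl) linarith
    qed
  next
    assume at: "t1.quot k t x - t1.quot k s x = M * p1 x * ?\<phi>"
    show ?thesis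
    proof (cases "x = L")
      case True
      have u1q: "t1.quot k \<tau> L = (b1 (\<tau> + k) - b1 \<tau>) / k + \<kappa>1 * t2.quot k \<tau> L" if "\<tau> > 0" for \<tau>
        using boundary(2)[of \<tau>] boundary(2)[of "\<tau> + k"] that k
        by (simp add: t1.quot_def t2.quot_def field_simps)
      have "p1 L * P = ((b1 (t + k) - b1 t) - (b1 (s + k) - b1 s)) / k + \<kappa>1 * (t2.quot k t L - t2.quot k s L)"
        using at u1q[OF ts(1)] u1q[OF ts(2)] True by (simp add: P_def algebra_simps diff_divide_distrib add_divide_distrib)
      moreover have "\<bar>t2.quot k t L - t2.quot k s L\<bar> \<le> p2 L * P" using q2 True by simp
      ultimately have "p1 L * P \<le> D * ?\<phi> + \<bar>\<kappa>1\<bar> * (p2 L * P)"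
        by (rule reflection_bound[OF _ data(1)[OF ts(1,2) k] k \<phi>(1) const(2)])
      then have up: "(p1 L - \<bar>\<kappa>1\<bar> * p2 L) * P \<le> D * ?\<phi>" by (simp add: algebra_simps)
      have EL: "E = \<delta> * exp (m * L)" using True by (simp add: E_def)
      \<comment> \<open>At x = L the reflection goes from weight 1 + E to weight 1 - E. The margin
        is 1 - |\<kappa>1| - E - |\<kappa>1| E, at least 4 E - 2 E, which still exceeds
        \<delta>.\<close>
      have E4: "4 * E \<le> 1 - \<bar>\<kappa>1\<bar>" using const(7) EL by simp
      then have "\<bar>\<kappa>1\<bar> \<le> 1" using E const(4) by linarith
      then have "\<bar>\<kappa>1\<bar> * E \<le> 1 * E" using E const(4) by (intro mult_right_mono) auto
      moreover have "p1 L - \<bar>\<kappa>1\<bar> * p2 L = 1 - E - \<bar>\<kappa>1\<bar> - \<bar>\<kappa>1\<bar> * E"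
        using p True by (simp add: distrib_left)
      ultimately have "\<delta> \<le> p1 L - \<bar>\<kappa>1\<bar> * p2 L"
        using E4 E(1) const(4) by linarith
      then have "\<delta> * P \<le> (p1 L - \<bar>\<kappa>1\<bar> * p2 L) * P" using P by (intro mult_right_mono)
      with up have "(M * \<delta>) * ?\<phi> \<le> D * ?\<phi>" by (simp add: P_def mult_ac)
      then show ?thesis using \<phi>(4) by (intro concl') simp
    next
      case False
      then have x: "x < L" using ts by simp
      have n1: "t1.quot_source k t x - t1.quot_source k s x \<le> - (m * E * P) + 2 * \<epsilon> * P"
        using t1.quot_source_at_maximum(2)[OF k \<eta> M dom1 ts at p_deriv(1) _ _ alip(1) eps(1)] ts x p_bounds[OF ts(3)]
        by (simp add: P_def E_def mult_ac)
      have n2: "t1.quot_source k t x - t1.quot_source k s x \<ge> t1.source t x - t1.source s x - 6 * e"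
        using ap1[of t x] ap1[of s x] ts by linarith
      have n3: "t1.source t x - t1.source s x \<ge> c1 (t, x) * (Z1 + Z2) - \<epsilon> * Y - C * \<bar>t - s\<bar>"
        using source1[of t s x Y] Y ts unfolding Z1_def Z2_def by linarith
      have "p1 x * P = t1.quot k t x - t1.quot k s x" using at by (simp add: P_def mult_ac)
      \<comment> \<open>Here the maximising component has the smaller weight, so Z1 + Z2 may be as
        low as -2 E P. The damping then costs 2 K E P, against the gain m E P with m \<ge> 2 K +
        1.\<close>
      moreover have "p2 x * P - p1 x * P = 2 * E * P" by (simp add: p algebra_simps)
      ultimately have "- (Z1 + Z2) \<le> 2 * E * P + 4 * e" using q2 z1 z2 by linarith
      moreover have c: "0 \<le> c1 (t, x)" "c1 (t, x) \<le> K" using coeff(1)[of t x] ts by auto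
      ultimately have "c1 (t, x) * - (Z1 + Z2) \<le> c1 (t, x) * (2 * E * P + 4 * e)"
        by (intro mult_left_mono)
      also have "\<dots> \<le> K * (2 * E * P + 4 * e)"
        using c(2) E P e const(4) by (intro mult_right_mono) auto
      finally have "c1 (t, x) * - (Z1 + Z2) \<le> K * (2 * E * P + 4 * e)" .
      then have n4: "- (c1 (t, x) * (Z1 + Z2)) \<le> 2 * K * (E * P) + 4 * e * K" by (simp add: algebra_simps)
      have "(2 * K + 1) * (E * P) \<le> m * (E * P)" using const E P by (intro mult_right_mono) auto
      moreover have "\<delta> * P \<le> E * P" using E P by (intro mult_right_mono)
      ultimately have n5: "\<delta> * P \<le> m * E * P - 2 * K * (E * P)" by (simp add: algebra_simps)
      show ?thesis
        using n1 n2 n3 n4 n5 eY Cd by (intro concl) linarith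
    qed
  qed
qed


lemma time_lipschitz_aux:
  assumes ts: "t \<ge> 0" "s \<ge> 0" "x \<in> {0..L}"
  shows "w1 (t, x) - w1 (s, x) \<le> 4 / \<delta> * (C + D) * \<bar>t - s\<bar> \<and>
    w2 (t, x) - w2 (s, x) \<le> 4 / \<delta> * (C + D) * \<bar>t - s\<bar>"
proof -
  have T: "T > 0" and L: "L > 0" using t1.T t1.L by auto
  have alip': "\<bar>a1 (t, x) - a1 (s, x)\<bar> \<le> \<bar>t - s\<bar>" "\<bar>a2 (t, x) - a2 (s, x)\<bar> \<le> \<bar>t - s\<bar>"
    if "t \<ge> 0" "s \<ge> 0" "x \<in> {0..L}" for t s x
    using alip[OF that] mult_right_mono[OF eps(2), of "\<bar>t - s\<bar>"] by auto
  have bound: "w1 (t, x) - w1 (s, x) \<le> 4 / \<delta> * (C + D + \<eta> * (4 * K + 8)) * (\<bar>t - s\<bar> + \<eta>) + 2 * \<eta>\<^sup>2 \<and>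
    w2 (t, x) - w2 (s, x) \<le> 4 / \<delta> * (C + D + \<eta> * (4 * K + 8)) * (\<bar>t - s\<bar> + \<eta>) + 2 * \<eta>\<^sup>2"
    if \<eta>: "\<eta> > 0" for \<eta>
  proof -
    \<comment> \<open>The estimate contains e / \<eta> and e; with e = \<eta>^2 both vanish as
      \<eta> tends to 0. The step k is chosen after \<eta>, and the bound does not depend on
      it.\<close>
    define e where "e = \<eta>\<^sup>2"
    have e: "e > 0" using \<eta> by (simp add: e_def)
    obtain d1 where d1: "d1 > 0" "\<And>k t x. 0 < k \<Longrightarrow> k \<le> d1 \<Longrightarrow> t \<ge> 0 \<Longrightarrow> x \<in> {0..L} \<Longrightarrow>
        \<bar>t1.quot k t x - w1 (t, x)\<bar> \<le> e \<and> \<bar>t1.quot_source k t x - t1.source t x\<bar> \<le> 3 * e"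
      using t1.quot_approx[OF wbound(1) alip'(1) e] by blast
    obtain d2 where d2: "d2 > 0" "\<And>k t x. 0 < k \<Longrightarrow> k \<le> d2 \<Longrightarrow> t \<ge> 0 \<Longrightarrow> x \<in> {0..L} \<Longrightarrow>
        \<bar>t2.quot k t x - w2 (t, x)\<bar> \<le> e \<and> \<bar>t2.quot_source k t x - t2.source t x\<bar> \<le> 3 * e"
      using t2.quot_approx[OF wbound(2) alip'(2) e] by blast
    define k where "k = min d1 d2"
    have k: "k > 0" "k \<le> d1" "k \<le> d2" using d1 d2 by (auto simp: k_def)
    have pc: "continuous_on {0..L} p1" "continuous_on {0..L} p2"
      unfolding p1_def[abs_def] p2_def[abs_def] by (intro continuous_intros)+
    have p0: "p1 x > 0" "p2 x > 0" if "x \<in> {0..L}" for x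
      using p_bounds[OF that] by linarith+
    obtain M1 where M1: "M1 \<ge> 0" "\<And>t s x. t \<ge> 0 \<Longrightarrow> s \<ge> 0 \<Longrightarrow> x \<in> {0..L} \<Longrightarrow>
        t1.quot k t x - t1.quot k s x \<le> M1 * p1 x * soft_abs \<eta> (t - s)"
      and at1: "\<exists>t\<in>{T..3*T}. \<exists>s\<in>{T..3*T}. \<exists>x\<in>{0..L}. t1.quot k t x - t1.quot k s x = M1 * p1 x * soft_abs \<eta> (t - s)"
      using t1.doubled_maximum_exists[OF k(1) \<eta> pc(1) p0(1)] by blast
    obtain M2 where M2: "M2 \<ge> 0" "\<And>t s x. t \<ge> 0 \<Longrightarrow> s \<ge> 0 \<Longrightarrow> x \<in> {0..L} \<Longrightarrow>
        t2.quot k t x - t2.quot k s x \<le> M2 * p2 x * soft_abs \<eta> (t - s)"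
      and at2: "\<exists>t\<in>{T..3*T}. \<exists>s\<in>{T..3*T}. \<exists>x\<in>{0..L}. t2.quot k t x - t2.quot k s x = M2 * p2 x * soft_abs \<eta> (t - s)"
      using t2.doubled_maximum_exists[OF k(1) \<eta> pc(2) p0(2)] by blast
    \<comment> \<open>The larger of the two best constants dominates both components and is attained
      by the one it comes from; this produces the disjunction in
      \<open>doubled_maximum_bound\<close>.\<close>
    define M where "M = max M1 M2"
    have M0: "M \<ge> 0" using M1(1) by (simp add: M_def)
    have raise: "N * p * soft_abs \<eta> r \<le> M * p * soft_abs \<eta> r" if "N \<le> M" "p > 0" for N p r
      using that soft_abs_bounds(4)[OF \<eta>, of r] by (intro mult_right_mono) auto
    have dom1: "t1.quot k t x - t1.quot k s x \<le> M * p1 x * soft_abs \<eta> (t - s)"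
      if "t \<ge> 0" "s \<ge> 0" "x \<in> {0..L}" for t s x
      by (rule order_trans[OF M1(2)[OF that] raise[OF _ p0(1)[OF that(3)]]]) (simp add: M_def)
    have dom2: "t2.quot k t x - t2.quot k s x \<le> M * p2 x * soft_abs \<eta> (t - s)"
      if "t \<ge> 0" "s \<ge> 0" "x \<in> {0..L}" for t s x
      by (rule order_trans[OF M2(2)[OF that] raise[OF _ p0(2)[OF that(3)]]]) (simp add: M_def)
    obtain t0 s0 x0 where pt: "t0 \<in> {T..3*T}" "s0 \<in> {T..3*T}" "x0 \<in> {0..L}" and
      att': "t1.quot k t0 x0 - t1.quot k s0 x0 = M * p1 x0 * soft_abs \<eta> (t0 - s0) \<or>
        t2.quot k t0 x0 - t2.quot k s0 x0 = M * p2 x0 * soft_abs \<eta> (t0 - s0)"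
    proof (cases "M = M1")
      case True
      then show ?thesis using at1 that by blast
    next
      case False
      then have "M = M2" by (auto simp: M_def)
      then show ?thesis using at2 that by blast
    qed
    have "M * (\<delta> / 2) \<le> C + D + e / \<eta> * (4 * K + 8)"
      by (rule doubled_maximum_bound[OF k(1) e \<eta> M0 d1(2)[OF k(1,2)] d2(2)[OF k(1,3)] dom1 dom2 _ _ pt(3) att'])
        (use pt T in auto)
    also have "e / \<eta> = \<eta>" using \<eta> by (simp add: e_def power2_eq_square)
    \<comment> \<open>The factor 2 is the upper bound of the weights; with the \<delta> / 2 of the
      maximum estimate it gives the 4 / \<delta> of the result.\<close>
    finally have Mb: "M * 2 \<le> 4 / \<delta> * (C + D + \<eta> * (4 * K + 8))"
      using const by (simp add: field_simps)
    have step: "M * p * soft_abs \<eta> (t - s) \<le> 4 / \<delta> * (C + D + \<eta> * (4 * K + 8)) * (\<bar>t - s\<bar> + \<eta>)"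
      if "0 \<le> p" "p \<le> 2" for p
    proof -
      have "M * p \<le> 4 / \<delta> * (C + D + \<eta> * (4 * K + 8))"
        using Mb mult_left_mono[OF that(2) M0] by linarith
      moreover have "0 \<le> M * p" using that M0 by simp
      ultimately show ?thesis
        using soft_abs_bounds(3,4)[OF \<eta>, of "t - s"]
        by (intro mult_mono'[of "M * p" _ "soft_abs \<eta> (t - s)"]) auto
    qed
    have "w1 (t, x) - w1 (s, x) \<le> M * p1 x * soft_abs \<eta> (t - s) + 2 * e"
      using dom1[OF ts] d1(2)[OF k(1,2) ts(1,3)] d1(2)[OF k(1,2) ts(2,3)] by linarith
    moreover have "w2 (t, x) - w2 (s, x) \<le> M * p2 x * soft_abs \<eta> (t - s) + 2 * e"
      using dom2[OF ts] d2(2)[OF k(1,3) ts(1,3)] d2(2)[OF k(1,3) ts(2,3)] by linarith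
    ultimately show ?thesis
      using step[of "p1 x"] step[of "p2 x"] p_bounds[OF ts(3)] unfolding e_def by linarith
  qed
  have lim: "((\<lambda>\<eta>. 4 / \<delta> * (C + D + \<eta> * (4 * K + 8)) * (\<bar>t - s\<bar> + \<eta>) + 2 * \<eta>\<^sup>2) \<longlongrightarrow>
      4 / \<delta> * (C + D + 0 * (4 * K + 8)) * (\<bar>t - s\<bar> + 0) + 2 * 0\<^sup>2) (at_right 0)"
    by (intro tendsto_intros)
  have "v \<le> 4 / \<delta> * (C + D) * \<bar>t - s\<bar>"
    if "\<And>\<eta>. \<eta> > 0 \<Longrightarrow> v \<le> 4 / \<delta> * (C + D + \<eta> * (4 * K + 8)) * (\<bar>t - s\<bar> + \<eta>) + 2 * \<eta>\<^sup>2" for v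
    using tendsto_lowerbound[OF lim, of v] eventually_mono[OF eventually_at_right_less[of "0::real"] that] by simp
  then show ?thesis using bound by blast
qed

lemma time_lipschitz:
  assumes "t \<ge> 0" "s \<ge> 0" "x \<in> {0..L}"
  shows "\<bar>w1 (t, x) - w1 (s, x)\<bar> \<le> 4 / \<delta> * (C + D) * \<bar>t - s\<bar>"
    "\<bar>w2 (t, x) - w2 (s, x)\<bar> \<le> 4 / \<delta> * (C + D) * \<bar>t - s\<bar>"
  using time_lipschitz_aux[OF assms] time_lipschitz_aux[OF assms(2,1,3)]
  by (auto simp: abs_le_iff abs_minus_commute)

end

section \<open>Lipschitz bounds for periodic solutions\<close>

lemma abs_mult_diff_le:
  fixes x y :: real
  assumes "\<bar>x - x'\<bar> \<le> p" "\<bar>y\<bar> \<le> b" "\<bar>x'\<bar> \<le> a" "\<bar>y - y'\<bar> \<le> q"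
  shows "\<bar>x * y - x' * y'\<bar> \<le> p * b + a * q"
proof -
  have "x * y - x' * y' = (x - x') * y + x' * (y - y')" by (simp add: algebra_simps)
  moreover have "\<bar>(x - x') * y\<bar> \<le> p * b" unfolding abs_mult using assms by (intro mult_mono') auto
  moreover have "\<bar>x' * (y - y')\<bar> \<le> a * q" unfolding abs_mult using assms by (intro mult_mono') auto
  ultimately show ?thesis by linarith
qed

lemma at_within_atLeast_nonbot: "t \<ge> 0 \<Longrightarrow> at t within {0..} \<noteq> (bot :: real filter)"
proof
  assume "t \<ge> 0" "at t within {0..} = bot"
  then have "t \<notin> closure ({0..} - {t})" by (simp add: at_within_eq_bot_iff)
  moreover have "closure {t<..} \<subseteq> closure ({0..} - {t})" using \<open>t \<ge> 0\<close> by (intro closure_mono) auto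
  ultimately show False by auto
qed

lemma strip_fst_set: "x \<in> {0..L} \<Longrightarrow> {t. (t, x) \<in> strip L} = {0..}"
  and strip_snd_set: "t \<ge> 0 \<Longrightarrow> {x. (t, x) \<in> strip L} = {0..L}"
  by (auto simp: strip_def)

lemma Ck_on_Suc_cont:
  fixes S :: "(real \<times> real) set"
  assumes "Ck_on (Suc k) S f" and b: "b \<in> {(1, 0), (0, 1)}"
  shows "Ck_on k S (pderiv_on S b f)" "continuous_on S f" "continuous_on S (pderiv_on S b f)"
proof -
  have "b \<in> Basis" using b by (auto simp: Basis_prod_def)
  then show 1: "Ck_on k S (pderiv_on S b f)" using assms by simp
  show "continuous_on S f" using assms by simp
  show "continuous_on S (pderiv_on S b f)" using 1 by (cases k) auto
qed

text \<open>What needs proof is that the derivative is periodic too. At t = 0 only a one-sided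
  derivative exists, so the two-sided derivative at t + T is shifted back and restricted to the half
  line before uniqueness applies.\<close>

lemma periodic_C1_of_Ck_on:
  assumes Ck: "Ck_on (Suc k) (strip L) f" and T: "T > 0"
    and per: "\<And>t x. (t, x) \<in> strip L \<Longrightarrow> f (t + T, x) = f (t, x)"
  shows "periodic_C1 T L f (pderiv_on (strip L) (1, 0) f)"
proof -
  let ?f' = "pderiv_on (strip L) (1, 0) f"
  have der: "((\<lambda>t. f (t, x)) has_real_derivative ?f' (t, x)) (at t within {0..})"
    if "t \<ge> 0" "x \<in> {0..L}" for t x
    using Ck_on_Suc_fst[OF Ck, of t x] that by (auto simp: strip_fst_set) (auto simp: strip_def)
  have "?f' (t + T, x) = ?f' (t, x)" if "t \<ge> 0" "x \<in> {0..L}" for t x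
  proof -
    have "((\<lambda>t. f (t, x)) has_real_derivative ?f' (t + T, x)) (at (t + T))"
      using der[of "t + T" x] that T at_within_interior[of "t + T" "{0..}"] by simp
    then have "((\<lambda>t. f (t + T, x)) has_real_derivative ?f' (t + T, x)) (at t)"
      using DERIV_at_within_shift[of "\<lambda>t. f (t, x)" _ T t UNIV] by (simp add: add.commute)
    then have "((\<lambda>t. f (t + T, x)) has_real_derivative ?f' (t + T, x)) (at t within {0..})"
      by (rule has_field_derivative_at_within)
    then have "((\<lambda>t. f (t, x)) has_real_derivative ?f' (t + T, x)) (at t within {0..})"
      by (rule has_field_derivative_transform_within[OF _ zero_less_one]) (use that per in \<open>auto simp: strip_def\<close>)
    then show ?thesis
      using der[OF that] vector_derivative_unique_within[OF at_within_atLeast_nonbot[OF that(1)]]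
      unfolding has_real_derivative_iff_has_vector_derivative by blast
  qed
  then show ?thesis
    unfolding periodic_C1_def using der per Ck_on_Suc_cont[OF Ck, of "(1, 0)"] by (auto simp: strip_def)
qed

lemma sup_norm_bound:
  assumes "sup_norm S f \<le> ereal K" "p \<in> S"
  shows "\<bar>f p\<bar> \<le> K"
proof -
  have "ereal \<bar>f p\<bar> \<le> sup_norm S f" unfolding sup_norm_def using assms(2) by (intro SUP_upper)
  then show ?thesis using assms(1) order_trans ereal_less_eq(3) by blast
qed

lemma C1_norm_bounds:
  fixes S :: "(real \<times> real) set"
  assumes "C1_norm S u \<le> ereal K" "p \<in> S"
  shows "\<bar>u p\<bar> \<le> K" "\<bar>pderiv_on S (1, 0) u p\<bar> \<le> K" "\<bar>pderiv_on S (0, 1) u p\<bar> \<le> K"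
proof -
  have "(1, 0) \<in> (Basis :: (real \<times> real) set)" "(0, 1) \<in> (Basis :: (real \<times> real) set)"
    by (auto simp: Basis_prod_def)
  then have "sup_norm S (pderiv_on S (1, 0) u) \<le> C1_norm S u" "sup_norm S (pderiv_on S (0, 1) u) \<le> C1_norm S u"
    "sup_norm S u \<le> C1_norm S u"
    unfolding C1_norm_def by (auto intro: max.coboundedI2 SUP_upper)
  then show "\<bar>u p\<bar> \<le> K" "\<bar>pderiv_on S (1, 0) u p\<bar> \<le> K" "\<bar>pderiv_on S (0, 1) u p\<bar> \<le> K"
    using assms by (auto intro!: sup_norm_bound[of S] elim: order_trans)
qed

lemma strip_lipschitz_fst:
  assumes der: "\<And>t x. t \<ge> 0 \<Longrightarrow> x \<in> {0..L} \<Longrightarrow> ((\<lambda>t. f (t, x)) has_real_derivative f' (t, x)) (at t within {0..})"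
    and b: "\<And>p. p \<in> strip L \<Longrightarrow> \<bar>f' p\<bar> \<le> B" and ts: "t \<ge> 0" "s \<ge> 0" "x \<in> {0..L}"
  shows "\<bar>f (t, x) - f (s, x)\<bar> \<le> B * \<bar>t - s\<bar>"
proof -
  have *: "\<bar>f (s, x) - f (t, x)\<bar> \<le> B * \<bar>s - t\<bar>" if "t \<ge> 0" "t \<le> s" for t s
    using lipschitz_from_deriv_bound[of t s "\<lambda>t. f (t, x)" "\<lambda>t. f' (t, x)" "{0..}" B] that ts(3) der b
    by (auto simp: strip_def)
  show ?thesis
    using *[of t s] *[of s t] ts by (cases "t \<le> s") (auto simp: abs_minus_commute)
qed

lemma strip_lipschitz_snd:
  assumes der: "\<And>t x. t \<ge> 0 \<Longrightarrow> x \<in> {0..L} \<Longrightarrow> ((\<lambda>x. f (t, x)) has_real_derivative f' (t, x)) (at x within {0..L})"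
    and b: "\<And>x. x \<in> {0..L} \<Longrightarrow> \<bar>f' (t, x)\<bar> \<le> B" and xy: "t \<ge> 0" "x \<in> {0..L}" "y \<in> {0..L}"
  shows "\<bar>f (t, x) - f (t, y)\<bar> \<le> B * \<bar>x - y\<bar>"
proof -
  have *: "\<bar>f (t, y) - f (t, x)\<bar> \<le> B * \<bar>y - x\<bar>" if "x \<le> y" "x \<in> {0..L}" "y \<in> {0..L}" for x y
    using lipschitz_from_deriv_bound[of x y "\<lambda>x. f (t, x)" "\<lambda>x. f' (t, x)" "{0..L}" B] that xy(1) der b
    by auto
  show ?thesis
    using *[of x y] *[of y x] xy by (cases "x \<le> y") (auto simp: abs_minus_commute)
qed

text \<open>As a function of the shift z, b(t + z) - b(s + z) has slope at most |M| |t - s|, by the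
  Lipschitz bound for b'; z runs from 0 to k. The modulus of M is taken because a nonnegative
  constant is wanted.\<close>

lemma boundary_datum_second_difference:
  assumes Ck: "Ck_on 1 {0..} b" and weak: "weak_deriv_Linf_le {0<..} [1, 1] b M"
    and tsk: "t > 0" "s > 0" "k > 0"
  shows "(b (t + k) - b t) - (b (s + k) - b s) \<le> \<bar>M\<bar> * k * \<bar>t - s\<bar>"
proof -
  define b' where "b' = pderiv_on {0..} 1 b"
  have der: "(b has_real_derivative b' t) (at t)" if "t > 0" for t
    using Ck_on_Suc_real[of 0 "{0..}" b t] Ck that at_within_interior[of t "{0..}"] by (simp add: b'_def)
  have cont: "continuous_on {0<..} b'"
  proof -
    have "continuous_on {0..} b'" using Ck by (simp add: b'_def)
    then show ?thesis by (rule continuous_on_subset) auto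
  qed
  have lip: "\<bar>b' r - b' q\<bar> \<le> \<bar>M\<bar> * \<bar>r - q\<bar>" if "r > 0" "q > 0" for r q
  proof -
    have "\<bar>b' r - b' q\<bar> \<le> M * \<bar>r - q\<bar>"
      using weak_second_deriv_lipschitz[OF der cont weak, of q r] weak_second_deriv_lipschitz[OF der cont weak, of r q] that
      by (cases "q \<le> r") (auto simp: abs_minus_commute)
    also have "\<dots> \<le> \<bar>M\<bar> * \<bar>r - q\<bar>" by (intro mult_right_mono) auto
    finally show ?thesis .
  qed
  have "\<bar>(\<lambda>z. b (t + z) - b (s + z)) k - (\<lambda>z. b (t + z) - b (s + z)) 0\<bar> \<le> (\<bar>M\<bar> * \<bar>t - s\<bar>) * (k - 0)"
  proof (rule lipschitz_from_deriv_bound[of 0 k _ "\<lambda>z. b' (t + z) - b' (s + z)" UNIV])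
    fix z assume z: "z \<in> {0..k}"
    have sh: "((\<lambda>z. b (r + z)) has_real_derivative b' (r + z)) (at z)" if "r > 0" for r
      using der[of "r + z"] that z DERIV_at_within_shift[of b _ r z UNIV] by simp
    show "((\<lambda>z. b (t + z) - b (s + z)) has_real_derivative b' (t + z) - b' (s + z)) (at z)"
      by (intro DERIV_diff sh tsk)
    show "\<bar>b' (t + z) - b' (s + z)\<bar> \<le> \<bar>M\<bar> * \<bar>t - s\<bar>"
      using lip[of "t + z" "s + z"] tsk z by simp
  qed (use tsk in auto)
  then show ?thesis by (simp add: mult_ac) 
qed


section \<open>Lipschitz estimate for the time-differentiated source\<close>

lemma abs_add_le: "\<bar>x\<bar> \<le> p \<Longrightarrow> \<bar>y\<bar> \<le> q \<Longrightarrow> \<bar>x + y\<bar> \<le> p + q" for x y :: real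
  by linarith

lemma abs_add_diff_le: "\<bar>x - x'\<bar> \<le> p \<Longrightarrow> \<bar>y - y'\<bar> \<le> q \<Longrightarrow> \<bar>(x + y) - (x' + y')\<bar> \<le> p + q" for x y :: real
  by linarith

text \<open>This is the t-derivative of a \<beta> (u1 + u2)/2 minus (the t-derivative of a) times w, where a is
  the reciprocal of the speed \<alpha> u1 + \<alpha>' u2 + const.\<close>

definition time_source :: "real \<Rightarrow> real \<Rightarrow> real \<Rightarrow> real \<Rightarrow> real \<Rightarrow> real \<Rightarrow> real \<Rightarrow> real \<Rightarrow> real \<Rightarrow> real \<Rightarrow> real" where
  "time_source \<alpha> \<alpha>' a \<beta> \<beta>t u1 u2 w1 w2 w =
     (- (a * a * (\<alpha> * w1 + \<alpha>' * w2))) * (\<beta> * (u1 + u2) / 2 - w) + (a * \<beta>t * (u1 + u2) / 2 + a * \<beta> * (w1 + w2) / 2)"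

text \<open>The coefficients of d in \<open>time_source_diff\<close>: the first two summands stem
  from the quadratic term, the third from the term with \<beta>t, the last from freezing a \<beta>
  in the damping term.\<close>

definition source_const :: "real \<Rightarrow> real \<Rightarrow> real \<Rightarrow> real \<Rightarrow> real" where
  "source_const A\<^sub>0 P b B = 4 * A\<^sub>0 * P * (b + 1) + 2 * A\<^sub>0\<^sup>2 * P * (1 + b) + (1 + A\<^sub>0 * B + A\<^sub>0) + (b + A\<^sub>0)"

text \<open>By the equation, \<beta> (u1 + u2)/2 - w is the speed times u_x. The combination occurs
  twice: as a factor of the quadratic term in \<open>time_source\<close>, and when X is recovered
  from w.\<close>

lemma flux_diff:
  fixes \<beta> :: real
  assumes "\<bar>\<beta>\<bar> \<le> b" "\<bar>\<beta>'\<bar> \<le> b" "\<bar>\<beta> - \<beta>'\<bar> \<le> d"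
    and "\<bar>u1\<bar> \<le> K" "\<bar>u2\<bar> \<le> K" "\<bar>w\<bar> \<le> K" "K \<le> 1"
    and "\<bar>u1 - u1'\<bar> \<le> d" "\<bar>u2 - u2'\<bar> \<le> d" "\<bar>w - w'\<bar> \<le> Y"
  shows "\<bar>\<beta> * (u1 + u2) / 2 - w\<bar> \<le> (b + 1) * K"
    "\<bar>(\<beta> * (u1 + u2) / 2 - w) - (\<beta>' * (u1' + u2') / 2 - w')\<bar> \<le> (1 + b) * d + Y"
proof -
  have s: "\<bar>u1 + u2\<bar> \<le> 2 * K" "\<bar>(u1 + u2) - (u1' + u2')\<bar> \<le> 2 * d"
    using abs_add_le[OF assms(4,5)] abs_add_diff_le[OF assms(8,9)] by simp_all
  then have s2: "\<bar>u1 + u2\<bar> \<le> 2" using assms(7) by linarith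
  have half: "\<bar>(x / 2 - w) - (x' / 2 - w')\<bar> \<le> e + Y" if "\<bar>x - x'\<bar> \<le> 2 * e" "\<bar>w - w'\<bar> \<le> Y" for x x' e :: real
    using that by linarith
  have "\<bar>\<beta> * (u1 + u2)\<bar> \<le> b * (2 * K)" unfolding abs_mult using assms(1) s by (intro mult_mono') auto
  then show "\<bar>\<beta> * (u1 + u2) / 2 - w\<bar> \<le> (b + 1) * K" using assms(6) by (simp add: distrib_right)
  have "\<bar>\<beta> * (u1 + u2) - \<beta>' * (u1' + u2')\<bar> \<le> d * 2 + b * (2 * d)"
    by (rule abs_mult_diff_le[OF assms(3) s2 assms(2) s(2)])
  then show "\<bar>(\<beta> * (u1 + u2) / 2 - w) - (\<beta>' * (u1' + u2') / 2 - w')\<bar> \<le> (1 + b) * d + Y"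
    using half[OF _ assms(10), of "\<beta> * (u1 + u2)" "\<beta>' * (u1' + u2')" "(1 + b) * d"] by (simp add: algebra_simps)
qed

text \<open>The only term linear in the w-differences without a small factor is the damping term,
  which is subtracted exactly. In the quadratic term both factors have size K, so changing one of
  them by Y leaves a factor K in front of Y; every other change is Lipschitz and counted in
  d.\<close>

lemma time_source_diff:
  assumes a: "\<bar>a\<bar> \<le> A\<^sub>0" "\<bar>a'\<bar> \<le> A\<^sub>0" "\<bar>a - a'\<bar> \<le> d"
    and \<beta>: "\<bar>\<beta>\<bar> \<le> b" "\<bar>\<beta>'\<bar> \<le> b" "\<bar>\<beta> - \<beta>'\<bar> \<le> d"
    and \<beta>t: "\<bar>\<beta>t\<bar> \<le> 1" "\<bar>\<beta>t'\<bar> \<le> 1" "\<bar>\<beta>t - \<beta>t'\<bar> \<le> B * d"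
    and u: "\<bar>u1\<bar> \<le> K" "\<bar>u2\<bar> \<le> K" "\<bar>u1'\<bar> \<le> K" "\<bar>u2'\<bar> \<le> K" "\<bar>u1 - u1'\<bar> \<le> d" "\<bar>u2 - u2'\<bar> \<le> d"
    and w: "\<bar>w1\<bar> \<le> K" "\<bar>w2\<bar> \<le> K" "\<bar>w1'\<bar> \<le> K" "\<bar>w2'\<bar> \<le> K" "\<bar>w\<bar> \<le> K" "\<bar>w'\<bar> \<le> K"
      "\<bar>w1 - w1'\<bar> \<le> Y" "\<bar>w2 - w2'\<bar> \<le> Y" "\<bar>w - w'\<bar> \<le> Y"
    and coef: "\<bar>\<alpha>\<bar> \<le> P" "\<bar>\<alpha>'\<bar> \<le> P" and K: "K \<le> 1"
  shows "\<bar>time_source \<alpha> \<alpha>' a \<beta> \<beta>t u1 u2 w1 w2 w - time_source \<alpha> \<alpha>' a' \<beta>' \<beta>t' u1' u2' w1' w2' w'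
      - a * \<beta> / 2 * ((w1 - w1') + (w2 - w2'))\<bar>
    \<le> 4 * A\<^sub>0\<^sup>2 * P * (b + 1) * K * Y + source_const A\<^sub>0 P b B * d"
proof -
  have nn: "0 \<le> A\<^sub>0" "0 \<le> b" "0 \<le> P" "0 \<le> K" "0 \<le> d" "0 \<le> Y"
    using abs_ge_zero order_trans a(1,3) \<beta>(1) coef(1) u(1) w(7) by blast+
  define q where "q = \<beta> * (u1 + u2) / 2 - w"
  define q' where "q' = \<beta>' * (u1' + u2') / 2 - w'"
  define r where "r = \<alpha> * w1 + \<alpha>' * w2"
  define r' where "r' = \<alpha> * w1' + \<alpha>' * w2'"
  have q: "\<bar>q\<bar> \<le> (b + 1) * K" "\<bar>q - q'\<bar> \<le> (1 + b) * d + Y"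
    unfolding q_def q'_def using flux_diff[OF \<beta> u(1,2) w(5) K u(5,6) w(9)] by auto
  have r: "\<bar>r\<bar> \<le> 2 * P * K" "\<bar>r'\<bar> \<le> 2 * P * K" "\<bar>r - r'\<bar> \<le> 2 * P * Y"
  proof -
    have m: "\<bar>x * y\<bar> \<le> P * z" if "\<bar>x\<bar> \<le> P" "\<bar>y\<bar> \<le> z" for x y z :: real
      unfolding abs_mult using that nn by (intro mult_mono') auto
    show "\<bar>r\<bar> \<le> 2 * P * K" "\<bar>r'\<bar> \<le> 2 * P * K"
      using m[OF coef(1) w(1)] m[OF coef(2) w(2)] m[OF coef(1) w(3)] m[OF coef(2) w(4)]
      unfolding r_def r'_def by (auto intro!: order_trans[OF abs_triangle_ineq])
    have "r - r' = \<alpha> * (w1 - w1') + \<alpha>' * (w2 - w2')" by (simp add: r_def r'_def algebra_simps)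
    then show "\<bar>r - r'\<bar> \<le> 2 * P * Y" using m[OF coef(1) w(7)] m[OF coef(2) w(8)] by (auto intro!: order_trans[OF abs_triangle_ineq])
  qed
  have aa: "\<bar>a * a - a' * a'\<bar> \<le> d * A\<^sub>0 + A\<^sub>0 * d" by (rule abs_mult_diff_le[OF a(3,1,2,3)])
  have a'a': "\<bar>a' * a'\<bar> \<le> A\<^sub>0 * A\<^sub>0" unfolding abs_mult using a by (intro mult_mono') auto
  have aar: "\<bar>a * a * r - a' * a' * r'\<bar> \<le> (d * A\<^sub>0 + A\<^sub>0 * d) * (2 * P * K) + (A\<^sub>0 * A\<^sub>0) * (2 * P * Y)"
    by (rule abs_mult_diff_le[OF aa r(1) a'a' r(3)])
  have a'r': "\<bar>a' * a' * r'\<bar> \<le> A\<^sub>0 * A\<^sub>0 * (2 * P * K)"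
    unfolding abs_mult[of "a' * a'"] using a'a' r nn by (intro mult_mono') auto
  have t1: "\<bar>a * a * r * q - a' * a' * r' * q'\<bar> \<le>
      ((d * A\<^sub>0 + A\<^sub>0 * d) * (2 * P * K) + (A\<^sub>0 * A\<^sub>0) * (2 * P * Y)) * ((b + 1) * K) +
      (A\<^sub>0 * A\<^sub>0 * (2 * P * K)) * ((1 + b) * d + Y)"
    by (rule abs_mult_diff_le[OF aar q(1) a'r' q(2)])
  \<comment> \<open>Since K \<le> 1, factors K are dropped in the terms with d; in the terms with Y
    one factor K is kept, since the smallness rests on it.\<close>
  have K2: "K * z \<le> z" if "z \<ge> 0" for z using mult_right_mono[OF K that] by simp
  have "((d * A\<^sub>0 + A\<^sub>0 * d) * (2 * P * K)) * ((b + 1) * K) \<le> 4 * A\<^sub>0 * P * (b + 1) * d"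
  proof -
    have "((d * A\<^sub>0 + A\<^sub>0 * d) * (2 * P * K)) * ((b + 1) * K) = K * (K * (4 * A\<^sub>0 * P * (b + 1) * d))"
      by (simp add: algebra_simps)
    also have "\<dots> \<le> K * (4 * A\<^sub>0 * P * (b + 1) * d)" using nn by (intro mult_left_mono K2) auto
    also have "\<dots> \<le> 4 * A\<^sub>0 * P * (b + 1) * d" using nn by (intro K2) auto
    finally show ?thesis .
  qed
  moreover have "((A\<^sub>0 * A\<^sub>0) * (2 * P * Y)) * ((b + 1) * K) + (A\<^sub>0 * A\<^sub>0 * (2 * P * K)) * Y
      \<le> 4 * A\<^sub>0\<^sup>2 * P * (b + 1) * K * Y"
  proof -
    have "0 \<le> b * (A\<^sub>0\<^sup>2 * P * K * Y)" using nn by simp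
    then show ?thesis by (simp add: algebra_simps power2_eq_square)
  qed
  moreover have "(A\<^sub>0 * A\<^sub>0 * (2 * P * K)) * ((1 + b) * d) \<le> 2 * A\<^sub>0\<^sup>2 * P * (1 + b) * d"
  proof -
    have "(A\<^sub>0 * A\<^sub>0 * (2 * P * K)) * ((1 + b) * d) = K * (2 * A\<^sub>0\<^sup>2 * P * (1 + b) * d)"
      by (simp add: algebra_simps power2_eq_square)
    also have "\<dots> \<le> 2 * A\<^sub>0\<^sup>2 * P * (1 + b) * d" using nn by (intro K2) auto
    finally show ?thesis .
  qed
  ultimately have T1: "\<bar>a * a * r * q - a' * a' * r' * q'\<bar> \<le>
      4 * A\<^sub>0 * P * (b + 1) * d + 4 * A\<^sub>0\<^sup>2 * P * (b + 1) * K * Y + 2 * A\<^sub>0\<^sup>2 * P * (1 + b) * d"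
    using t1 by (simp only: distrib_left distrib_right)
  have s: "\<bar>u1 + u2\<bar> \<le> 2" "\<bar>(u1 + u2) - (u1' + u2')\<bar> \<le> 2 * d"
    using abs_add_le[OF u(1,2)] abs_add_diff_le[OF u(5,6)] K by linarith+
  have ab: "\<bar>a * \<beta>t - a' * \<beta>t'\<bar> \<le> d * 1 + A\<^sub>0 * (B * d)" by (rule abs_mult_diff_le[OF a(3) \<beta>t(1) a(2) \<beta>t(3)])
  have "\<bar>a' * \<beta>t'\<bar> \<le> A\<^sub>0 * 1" unfolding abs_mult using a \<beta>t by (intro mult_mono') auto
  from abs_mult_diff_le[OF ab s(1) this s(2)]
  have T2: "\<bar>a * \<beta>t * (u1 + u2) - a' * \<beta>t' * (u1' + u2')\<bar> \<le> 2 * ((1 + A\<^sub>0 * B + A\<^sub>0) * d)"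
    by (simp add: algebra_simps)
  have "\<bar>a * \<beta> - a' * \<beta>'\<bar> \<le> d * b + A\<^sub>0 * d" by (rule abs_mult_diff_le[OF a(3) \<beta>(1) a(2) \<beta>(3)])
  moreover have "\<bar>w1' + w2'\<bar> \<le> 2" using abs_add_le[OF w(3,4)] K by linarith
  ultimately have T3: "\<bar>(a * \<beta> - a' * \<beta>') * (w1' + w2')\<bar> \<le> (d * b + A\<^sub>0 * d) * 2"
    unfolding abs_mult using nn by (intro mult_mono') auto
  have collect: "\<bar>v\<bar> \<le> e1 + e2 + e3"
    if "v = - x + y / 2 + z / 2" "\<bar>x\<bar> \<le> e1" "\<bar>y\<bar> \<le> 2 * e2" "\<bar>z\<bar> \<le> e3 * 2" for v x y z e1 e2 e3 :: real
    using that by linarith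
  have "time_source \<alpha> \<alpha>' a \<beta> \<beta>t u1 u2 w1 w2 w - time_source \<alpha> \<alpha>' a' \<beta>' \<beta>t' u1' u2' w1' w2' w'
      - a * \<beta> / 2 * ((w1 - w1') + (w2 - w2')) =
    - (a * a * r * q - a' * a' * r' * q') + (a * \<beta>t * (u1 + u2) - a' * \<beta>t' * (u1' + u2')) / 2
      + ((a * \<beta> - a' * \<beta>') * (w1' + w2')) / 2"
    unfolding time_source_def q_def[symmetric] q'_def[symmetric] r_def[symmetric] r'_def[symmetric]
    by (simp add: algebra_simps add_divide_distrib diff_divide_distrib)
  moreover have "source_const A\<^sub>0 P b B * d = 4 * A\<^sub>0 * P * (b + 1) * d + 2 * A\<^sub>0\<^sup>2 * P * (1 + b) * d
      + (1 + A\<^sub>0 * B + A\<^sub>0) * d + (d * b + A\<^sub>0 * d)"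
    by (simp add: source_const_def algebra_simps)
  ultimately show ?thesis using collect[OF _ T1 T2 T3] by (simp only: add_ac)
qed

section \<open>From the quasilinear system to Lipschitz first derivatives\<close>

lemma transport_of_quasilinear:
  assumes T: "T > 0" and L: "L > 0"
    and u1: "periodic_C1 T L u1 w1" and u2: "periodic_C1 T L u2 w2" and u: "periodic_C1 T L u w"
    and \<beta>: "periodic_C1 T L \<beta> \<beta>t"
    and dx: "\<And>t x. t \<ge> 0 \<Longrightarrow> x \<in> {0..L} \<Longrightarrow> ((\<lambda>x. u (t, x)) has_real_derivative X (t, x)) (at x within {0..L})"
    and l: "\<And>p. l p = \<alpha> * (u1 p - c) + \<alpha>' * (u2 p + c)" "\<And>p. p \<in> strip L \<Longrightarrow> l p \<noteq> 0"
    and pde: "\<And>p. p \<in> strip L \<Longrightarrow> w p + l p * X p = \<beta> p / 2 * (u1 p + u2 p)"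
  shows "transport T L u w X (\<lambda>p. inverse (l p)) (\<lambda>p. - (inverse (l p) * inverse (l p) * (\<alpha> * w1 p + \<alpha>' * w2 p)))
    (\<lambda>p. inverse (l p) * (\<beta> p * (u1 p + u2 p) / 2))
    (\<lambda>p. - (inverse (l p) * inverse (l p) * (\<alpha> * w1 p + \<alpha>' * w2 p)) * (\<beta> p * (u1 p + u2 p) / 2)
      + (inverse (l p) * \<beta>t p * (u1 p + u2 p) / 2 + inverse (l p) * \<beta> p * (w1 p + w2 p) / 2))"
proof -
  have cont: "continuous_on (strip L) u1" "continuous_on (strip L) u2" "continuous_on (strip L) w1"
    "continuous_on (strip L) w2" "continuous_on (strip L) \<beta>" "continuous_on (strip L) \<beta>t"
    using u1 u2 \<beta> by (auto simp: periodic_C1_def)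
  have cl: "continuous_on (strip L) l" unfolding l(1)[abs_def] by (intro continuous_intros cont)
  have cinv: "continuous_on (strip L) (\<lambda>p. inverse (l p))" using cl l(2) by (intro continuous_intros) auto
  have dl: "((\<lambda>t. l (t, x)) has_real_derivative \<alpha> * w1 (t, x) + \<alpha>' * w2 (t, x)) (at t within {0..})"
    if "t \<ge> 0" "x \<in> {0..L}" for t x
  proof -
    have "((\<lambda>t. \<alpha> * (u1 (t, x) - c) + \<alpha>' * (u2 (t, x) + c)) has_real_derivative
        \<alpha> * (w1 (t, x) - 0) + \<alpha>' * (w2 (t, x) + 0)) (at t within {0..})"
      by (intro DERIV_add DERIV_diff DERIV_cmult DERIV_const periodic_C1_deriv(1)[OF u1 that] periodic_C1_deriv(1)[OF u2 that])
    then show ?thesis by (simp add: l(1))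
  qed
  have l0: "l (t, x) \<noteq> 0" if "t \<ge> 0" "x \<in> {0..L}" for t x using l(2) that by (auto simp: strip_def)
  have di: "((\<lambda>t. inverse (l (t, x))) has_real_derivative
      - (inverse (l (t, x)) * inverse (l (t, x)) * (\<alpha> * w1 (t, x) + \<alpha>' * w2 (t, x)))) (at t within {0..})"
    if "t \<ge> 0" "x \<in> {0..L}" for t x
    using DERIV_inverse_fun[OF dl[OF that] l0[OF that]] by (simp add: power2_eq_square mult_ac)
  have per: "l (t + T, x) = l (t, x)" "w1 (t + T, x) = w1 (t, x)" "w2 (t + T, x) = w2 (t, x)"
    "u1 (t + T, x) = u1 (t, x)" "u2 (t + T, x) = u2 (t, x)" "\<beta> (t + T, x) = \<beta> (t, x)" "\<beta>t (t + T, x) = \<beta>t (t, x)"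
    if "t \<ge> 0" "x \<in> {0..L}" for t x
    using periodic_C1_deriv(2,3)[OF u1 that] periodic_C1_deriv(2,3)[OF u2 that] periodic_C1_deriv(2,3)[OF \<beta> that]
    by (simp_all add: l(1))
  have ca: "continuous_on (strip L) (\<lambda>p. - (inverse (l p) * inverse (l p) * (\<alpha> * w1 p + \<alpha>' * w2 p)))"
    by (intro continuous_intros cinv cont)
  have cF: "continuous_on (strip L) (\<lambda>p. inverse (l p) * (\<beta> p * (u1 p + u2 p) / 2))"
    "continuous_on (strip L) (\<lambda>p. - (inverse (l p) * inverse (l p) * (\<alpha> * w1 p + \<alpha>' * w2 p)) * (\<beta> p * (u1 p + u2 p) / 2)
      + (inverse (l p) * \<beta>t p * (u1 p + u2 p) / 2 + inverse (l p) * \<beta> p * (w1 p + w2 p) / 2))"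
    by (intro continuous_intros cinv cont ca; simp)+
  show ?thesis
  proof
    show "periodic_C1 T L (\<lambda>p. inverse (l p)) (\<lambda>p. - (inverse (l p) * inverse (l p) * (\<alpha> * w1 p + \<alpha>' * w2 p)))"
      unfolding periodic_C1_def 
      by (intro conjI cinv ca ballI allI impI di) (simp_all only: per)
    have dF: "((\<lambda>t. inverse (l (t, x)) * (\<beta> (t, x) * (u1 (t, x) + u2 (t, x)) / 2)) has_real_derivative
        - (inverse (l (t, x)) * inverse (l (t, x)) * (\<alpha> * w1 (t, x) + \<alpha>' * w2 (t, x))) * (\<beta> (t, x) * (u1 (t, x) + u2 (t, x)) / 2)
        + (inverse (l (t, x)) * \<beta>t (t, x) * (u1 (t, x) + u2 (t, x)) / 2 + inverse (l (t, x)) * \<beta> (t, x) * (w1 (t, x) + w2 (t, x)) / 2))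
        (at t within {0..})" if "t \<ge> 0" "x \<in> {0..L}" for t x
      by (rule DERIV_cong[OF DERIV_mult[OF di[OF that] DERIV_cdivide[OF DERIV_mult[OF periodic_C1_deriv(1)[OF \<beta> that]
            DERIV_add[OF periodic_C1_deriv(1)[OF u1 that] periodic_C1_deriv(1)[OF u2 that]]]]]])
        (simp add: distrib_left distrib_right add_divide_distrib mult_ac)
    show "periodic_C1 T L (\<lambda>p. inverse (l p) * (\<beta> p * (u1 p + u2 p) / 2))
      (\<lambda>p. - (inverse (l p) * inverse (l p) * (\<alpha> * w1 p + \<alpha>' * w2 p)) * (\<beta> p * (u1 p + u2 p) / 2)
      + (inverse (l p) * \<beta>t p * (u1 p + u2 p) / 2 + inverse (l p) * \<beta> p * (w1 p + w2 p) / 2))"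
      unfolding periodic_C1_def 
      by (intro conjI cF ballI allI impI dF) (simp_all only: per)
    show "X (t, x) + inverse (l (t, x)) * w (t, x) = inverse (l (t, x)) * (\<beta> (t, x) * (u1 (t, x) + u2 (t, x)) / 2)"
      if "t \<ge> 0" "x \<in> {0..L}" for t x
    proof -
      have "w (t, x) + l (t, x) * X (t, x) = \<beta> (t, x) / 2 * (u1 (t, x) + u2 (t, x))"
        using pde that by (simp add: strip_def)
      from arg_cong[OF this, of "\<lambda>z. inverse (l (t, x)) * z"] show ?thesis
        using l0[OF that] by (simp add: distrib_left mult.assoc[symmetric] mult.commute[of _ "w (t, x)"])
    qed
  qed (use T L u dx in auto)
qed

locale small_flow =
  fixes T L \<kappa>1 \<kappa>2 A\<^sub>0 b B D P K \<delta> \<alpha> \<alpha>' c :: real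
    and u1 w1 X1 u2 w2 X2 \<beta> \<beta>t \<beta>x :: "real \<times> real \<Rightarrow> real" and b1 b2 :: "real \<Rightarrow> real"
  assumes T: "T > 0" and L: "L > 0"
    and u1: "periodic_C1 T L u1 w1" and u2: "periodic_C1 T L u2 w2" and \<beta>: "periodic_C1 T L \<beta> \<beta>t"
    and dx: "\<And>t x. t \<ge> 0 \<Longrightarrow> x \<in> {0..L} \<Longrightarrow> ((\<lambda>x. u1 (t, x)) has_real_derivative X1 (t, x)) (at x within {0..L})"
      "\<And>t x. t \<ge> 0 \<Longrightarrow> x \<in> {0..L} \<Longrightarrow> ((\<lambda>x. u2 (t, x)) has_real_derivative X2 (t, x)) (at x within {0..L})"
      "\<And>t x. t \<ge> 0 \<Longrightarrow> x \<in> {0..L} \<Longrightarrow> ((\<lambda>x. \<beta> (t, x)) has_real_derivative \<beta>x (t, x)) (at x within {0..L})"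
    and bounds: "\<And>p. p \<in> strip L \<Longrightarrow> \<bar>u1 p\<bar> \<le> K" "\<And>p. p \<in> strip L \<Longrightarrow> \<bar>u2 p\<bar> \<le> K"
      "\<And>p. p \<in> strip L \<Longrightarrow> \<bar>w1 p\<bar> \<le> K" "\<And>p. p \<in> strip L \<Longrightarrow> \<bar>w2 p\<bar> \<le> K"
      "\<And>p. p \<in> strip L \<Longrightarrow> \<bar>X1 p\<bar> \<le> K" "\<And>p. p \<in> strip L \<Longrightarrow> \<bar>X2 p\<bar> \<le> K"
    and \<beta>_bounds: "\<And>p. p \<in> strip L \<Longrightarrow> - b \<le> \<beta> p \<and> \<beta> p \<le> 0" "\<And>p. p \<in> strip L \<Longrightarrow> \<bar>\<beta>t p\<bar> \<le> 1"
      "\<And>p. p \<in> strip L \<Longrightarrow> \<bar>\<beta>x p\<bar> \<le> 1"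
      "\<And>t s x. t \<ge> 0 \<Longrightarrow> s \<ge> 0 \<Longrightarrow> x \<in> {0..L} \<Longrightarrow> \<bar>\<beta>t (t, x) - \<beta>t (s, x)\<bar> \<le> B * \<bar>t - s\<bar>"
    and speeds: "\<And>p. p \<in> strip L \<Longrightarrow> \<alpha> * (u1 p - c) + \<alpha>' * (u2 p + c) < 0"
      "\<And>p. p \<in> strip L \<Longrightarrow> 0 < \<alpha>' * (u1 p - c) + \<alpha> * (u2 p + c)"
      "\<And>p. p \<in> strip L \<Longrightarrow> \<bar>inverse (\<alpha> * (u1 p - c) + \<alpha>' * (u2 p + c))\<bar> \<le> A\<^sub>0"
      "\<And>p. p \<in> strip L \<Longrightarrow> \<bar>inverse (\<alpha>' * (u1 p - c) + \<alpha> * (u2 p + c))\<bar> \<le> A\<^sub>0"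
    and pde: "\<And>p. p \<in> strip L \<Longrightarrow> w1 p + (\<alpha> * (u1 p - c) + \<alpha>' * (u2 p + c)) * X1 p = \<beta> p / 2 * (u1 p + u2 p)"
      "\<And>p. p \<in> strip L \<Longrightarrow> w2 p + (\<alpha>' * (u1 p - c) + \<alpha> * (u2 p + c)) * X2 p = \<beta> p / 2 * (u1 p + u2 p)"
    and boundary: "\<And>t. t \<ge> 0 \<Longrightarrow> u2 (t, 0) = b2 t + \<kappa>2 * u1 (t, 0)"
      "\<And>t. t \<ge> 0 \<Longrightarrow> u1 (t, L) = b1 t + \<kappa>1 * u2 (t, L)"
    and data: "\<And>t s k. t > 0 \<Longrightarrow> s > 0 \<Longrightarrow> k > 0 \<Longrightarrow> (b1 (t + k) - b1 t) - (b1 (s + k) - b1 s) \<le> D * k * \<bar>t - s\<bar>"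
      "\<And>t s k. t > 0 \<Longrightarrow> s > 0 \<Longrightarrow> k > 0 \<Longrightarrow> (b2 (t + k) - b2 t) - (b2 (s + k) - b2 s) \<le> D * k * \<bar>t - s\<bar>"
    and const: "0 \<le> K" "K \<le> 1" "\<bar>\<alpha>\<bar> \<le> P" "\<bar>\<alpha>'\<bar> \<le> P" "0 \<le> A\<^sub>0" "0 \<le> b" "0 \<le> B" "0 \<le> D" "0 < \<delta>"
      "4 * A\<^sub>0\<^sup>2 * P * (b + 1) * K \<le> 1" "8 * (4 * A\<^sub>0\<^sup>2 * P * (b + 1) * K) \<le> \<delta>"
      "\<delta> * exp ((A\<^sub>0 * b + 1) * L) \<le> 1 / 2" "4 * (\<delta> * exp ((A\<^sub>0 * b + 1) * L)) \<le> 1 - \<bar>\<kappa>1\<bar>" "\<delta> \<le> 1 - \<bar>\<kappa>2\<bar>"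
begin

definition a1 :: "real \<times> real \<Rightarrow> real" where "a1 p = inverse (\<alpha> * (u1 p - c) + \<alpha>' * (u2 p + c))"
definition a2 :: "real \<times> real \<Rightarrow> real" where "a2 p = inverse (\<alpha>' * (u1 p - c) + \<alpha> * (u2 p + c))"

lemma P: "0 \<le> P" using const(3) by linarith

text \<open>The direct estimate has the constant \<open>2 * A\<^sub>0\<^sup>2 * P * K\<close>. It is
  enlarged so that the reciprocal speeds and the quadratic source terms share a single small
  parameter in \<open>doubling\<close>.\<close>

lemma inverse_speed_diff:
  assumes "l \<noteq> 0" "l' \<noteq> 0" "\<bar>inverse l\<bar> \<le> A\<^sub>0" "\<bar>inverse l'\<bar> \<le> A\<^sub>0" "\<bar>l - l'\<bar> \<le> 2 * P * K * d" "d \<ge> 0"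
  shows "\<bar>inverse l - inverse l'\<bar> \<le> 4 * A\<^sub>0\<^sup>2 * P * (b + 1) * K * d"
proof -
  have "inverse l - inverse l' = (l' - l) * (inverse l * inverse l')"
    using assms by (simp add: field_simps)
  moreover have "\<bar>(l' - l) * (inverse l * inverse l')\<bar> \<le> (2 * P * K * d) * (A\<^sub>0 * A\<^sub>0)"
    unfolding abs_mult using assms P const by (intro mult_mono) (auto simp: abs_minus_commute)
  moreover have "(2 * P * K * d) * (A\<^sub>0 * A\<^sub>0) \<le> 4 * A\<^sub>0\<^sup>2 * P * (b + 1) * K * d"
  proof -
    have "0 \<le> (A\<^sub>0\<^sup>2 * P * K * d) * (2 + 4 * b)" using assms P const by (intro mult_nonneg_nonneg) auto
    then show ?thesis by (simp add: algebra_simps power2_eq_square)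
  qed
  ultimately show ?thesis by linarith
qed

lemma a_diff:
  assumes p: "p \<in> strip L" "p' \<in> strip L" and d: "\<bar>u1 p - u1 p'\<bar> \<le> K * d" "\<bar>u2 p - u2 p'\<bar> \<le> K * d" "d \<ge> 0"
  shows "\<bar>a1 p - a1 p'\<bar> \<le> 4 * A\<^sub>0\<^sup>2 * P * (b + 1) * K * d" "\<bar>a2 p - a2 p'\<bar> \<le> 4 * A\<^sub>0\<^sup>2 * P * (b + 1) * K * d"
    "\<bar>a1 p - a1 p'\<bar> \<le> d" "\<bar>a2 p - a2 p'\<bar> \<le> d"
proof -
  have l: "\<bar>(\<mu> * (u1 p - c) + \<nu> * (u2 p + c)) - (\<mu> * (u1 p' - c) + \<nu> * (u2 p' + c))\<bar> \<le> 2 * P * K * d"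
    if "\<bar>\<mu>\<bar> \<le> P" "\<bar>\<nu>\<bar> \<le> P" for \<mu> \<nu>
  proof -
    have "\<bar>\<mu> * (u1 p - u1 p')\<bar> \<le> P * (K * d)" "\<bar>\<nu> * (u2 p - u2 p')\<bar> \<le> P * (K * d)"
      unfolding abs_mult using that d P by (intro mult_mono; simp)+
    from abs_add_le[OF this] show ?thesis by (simp add: algebra_simps)
  qed
  show 1: "\<bar>a1 p - a1 p'\<bar> \<le> 4 * A\<^sub>0\<^sup>2 * P * (b + 1) * K * d"
    unfolding a1_def using speeds(1)[OF p(1)] speeds(1)[OF p(2)] speeds(3)[OF p(1)] speeds(3)[OF p(2)] const(3,4) d
    by (intro inverse_speed_diff l) auto
  show 2: "\<bar>a2 p - a2 p'\<bar> \<le> 4 * A\<^sub>0\<^sup>2 * P * (b + 1) * K * d"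
    unfolding a2_def using speeds(2)[OF p(1)] speeds(2)[OF p(2)] speeds(4)[OF p(1)] speeds(4)[OF p(2)] const(3,4) d
    by (intro inverse_speed_diff l) auto
  show "\<bar>a1 p - a1 p'\<bar> \<le> d" "\<bar>a2 p - a2 p'\<bar> \<le> d"
    using 1 2 mult_right_mono[OF const(10) d(3)] by simp_all
qed

lemma u_lipschitz_t:
  assumes "t \<ge> 0" "s \<ge> 0" "x \<in> {0..L}"
  shows "\<bar>u1 (t, x) - u1 (s, x)\<bar> \<le> K * \<bar>t - s\<bar>" "\<bar>u2 (t, x) - u2 (s, x)\<bar> \<le> K * \<bar>t - s\<bar>"
    "\<bar>\<beta> (t, x) - \<beta> (s, x)\<bar> \<le> 1 * \<bar>t - s\<bar>"
  using strip_lipschitz_fst[OF periodic_C1_deriv(1)[OF u1] bounds(3) assms]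
    strip_lipschitz_fst[OF periodic_C1_deriv(1)[OF u2] bounds(4) assms]
    strip_lipschitz_fst[OF periodic_C1_deriv(1)[OF \<beta>] \<beta>_bounds(2) assms] by blast+

lemma u_lipschitz_x:
  assumes "t \<ge> 0" "x \<in> {0..L}" "y \<in> {0..L}"
  shows "\<bar>u1 (t, x) - u1 (t, y)\<bar> \<le> K * \<bar>x - y\<bar>" "\<bar>u2 (t, x) - u2 (t, y)\<bar> \<le> K * \<bar>x - y\<bar>"
    "\<bar>\<beta> (t, x) - \<beta> (t, y)\<bar> \<le> 1 * \<bar>x - y\<bar>"
proof -
  have "(t, z) \<in> strip L" if "z \<in> {0..L}" for z using that assms(1) by (auto simp: strip_def)
  then show "\<bar>u1 (t, x) - u1 (t, y)\<bar> \<le> K * \<bar>x - y\<bar>" "\<bar>u2 (t, x) - u2 (t, y)\<bar> \<le> K * \<bar>x - y\<bar>"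
    "\<bar>\<beta> (t, x) - \<beta> (t, y)\<bar> \<le> 1 * \<bar>x - y\<bar>"
    using bounds(5,6) \<beta>_bounds(3) strip_lipschitz_snd[OF dx(1) _ assms] strip_lipschitz_snd[OF dx(2) _ assms]
      strip_lipschitz_snd[OF dx(3) _ assms] by blast+
qed

lemma K_mult_le: "d \<ge> 0 \<Longrightarrow> z \<le> K * d \<Longrightarrow> z \<le> d"
  using mult_right_mono[OF const(2), of d] by linarith

lemma abs_\<beta>_le: "p \<in> strip L \<Longrightarrow> \<bar>\<beta> p\<bar> \<le> b"
  using \<beta>_bounds(1)[of p] by auto

text \<open>A chain: \<open>lip_t\<close> bounds w in t, the equation turns it into the bound
  \<open>lip_mixed\<close> for X in t, symmetry makes this a bound for w in x, and the equation
  turns it into \<open>lip_x\<close> for X in x.\<close>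

definition lip_t :: real where "lip_t = 4 / \<delta> * (source_const A\<^sub>0 P b B + D)"
definition lip_mixed :: real where "lip_mixed = (b + 1) + A\<^sub>0 * ((1 + b) + lip_t)"
definition lip_x :: real where "lip_x = (b + 1) + A\<^sub>0 * ((1 + b) + lip_mixed)"

lemma w_lipschitz_t:
  assumes tsx: "t \<ge> 0" "s \<ge> 0" "x \<in> {0..L}"
  shows "\<bar>w1 (t, x) - w1 (s, x)\<bar> \<le> lip_t * \<bar>t - s\<bar>" "\<bar>w2 (t, x) - w2 (s, x)\<bar> \<le> lip_t * \<bar>t - s\<bar>"
proof -
  define A1 where "A1 = (\<lambda>p. - (a1 p * a1 p * (\<alpha> * w1 p + \<alpha>' * w2 p)))"
  define A2 where "A2 = (\<lambda>p. - (a2 p * a2 p * (\<alpha>' * w1 p + \<alpha> * w2 p)))"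
  define F1 where "F1 = (\<lambda>p. a1 p * (\<beta> p * (u1 p + u2 p) / 2))"
  define F2 where "F2 = (\<lambda>p. a2 p * (\<beta> p * (u1 p + u2 p) / 2))"
  define H1 where "H1 = (\<lambda>p. - (a1 p * a1 p * (\<alpha> * w1 p + \<alpha>' * w2 p)) * (\<beta> p * (u1 p + u2 p) / 2)
      + (a1 p * \<beta>t p * (u1 p + u2 p) / 2 + a1 p * \<beta> p * (w1 p + w2 p) / 2))"
  define H2 where "H2 = (\<lambda>p. - (a2 p * a2 p * (\<alpha>' * w1 p + \<alpha> * w2 p)) * (\<beta> p * (u1 p + u2 p) / 2)
      + (a2 p * \<beta>t p * (u1 p + u2 p) / 2 + a2 p * \<beta> p * (w1 p + w2 p) / 2))"
  interpret t1: transport T L u1 w1 X1 a1 A1 F1 H1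
    unfolding a1_def[abs_def] A1_def F1_def H1_def
    by (rule transport_of_quasilinear[OF T L u1 u2 u1 \<beta> dx(1) refl _ pde(1)]) (use speeds(1) in force)+
  interpret t2: transport T L u2 w2 X2 a2 A2 F2 H2
    unfolding a2_def[abs_def] A2_def F2_def H2_def
    by (rule transport_of_quasilinear[OF T L u1 u2 u2 \<beta> dx(2) refl _ pde(2)]) (use speeds(2) in force)+
  have S1: "t1.source t x = time_source \<alpha> \<alpha>' (a1 (t, x)) (\<beta> (t, x)) (\<beta>t (t, x)) (u1 (t, x)) (u2 (t, x)) (w1 (t, x)) (w2 (t, x)) (w1 (t, x))" for t x
    using t1.source_def[of t x] unfolding H1_def A1_def time_source_def
    by (simp only: right_diff_distrib mult_minus_left)
  have S2: "t2.source t x = time_source \<alpha>' \<alpha> (a2 (t, x)) (\<beta> (t, x)) (\<beta>t (t, x)) (u1 (t, x)) (u2 (t, x)) (w1 (t, x)) (w2 (t, x)) (w2 (t, x))" for t x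
    using t2.source_def[of t x] unfolding H2_def A2_def time_source_def
    by (simp only: right_diff_distrib mult_minus_left)
  have aA: "\<bar>a1 p\<bar> \<le> A\<^sub>0" "\<bar>a2 p\<bar> \<le> A\<^sub>0" "a1 p \<le> 0" "0 \<le> a2 p" if "p \<in> strip L" for p
    using speeds[OF that] by (auto simp: a1_def a2_def)
  \<comment> \<open>The damping is nonpositive and so is the reciprocal speed of the first family,
    hence the product is nonnegative. The second family has positive speed, so v is minus its
    reciprocal, which accounts for the opposite sign in \<open>source2\<close>.\<close>
  have coef: "0 \<le> v * \<beta> p / 2 \<and> v * \<beta> p / 2 \<le> A\<^sub>0 * b / 2" if "p \<in> strip L" "v \<le> 0" "\<bar>v\<bar> \<le> A\<^sub>0" for v p
  proof -
    have "(- v) * (- \<beta> p) \<le> A\<^sub>0 * b" using \<beta>_bounds(1)[OF that(1)] that by (intro mult_mono') auto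
    moreover have "0 \<le> (- v) * (- \<beta> p)" using \<beta>_bounds(1)[OF that(1)] that by (intro mult_nonneg_nonneg) auto
    ultimately show ?thesis by simp
  qed
  \<comment> \<open>The small parameter is the factor of Y from \<open>time_source_diff\<close>, and
    m = 2 K + 1 holds with equality for K = \<open>A\<^sub>0 * b / 2\<close>.\<close>
  interpret doubling T L u1 w1 X1 a1 A1 F1 H1 u2 w2 X2 a2 A2 F2 H2 \<kappa>1 \<kappa>2 "4 * A\<^sub>0\<^sup>2 * P * (b + 1) * K"
    "source_const A\<^sub>0 P b B" D "A\<^sub>0 * b / 2" \<delta> "A\<^sub>0 * b + 1" "\<lambda>p. a1 p * \<beta> p / 2" "\<lambda>p. (- a2 p) * \<beta> p / 2" b1 b2
  proof
    show "0 \<le> 4 * A\<^sub>0\<^sup>2 * P * (b + 1) * K" using const P by simp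
    show "0 \<le> source_const A\<^sub>0 P b B" unfolding source_const_def using const P by simp
    show "0 \<le> A\<^sub>0 * b / 2" "2 * (A\<^sub>0 * b / 2) + 1 \<le> A\<^sub>0 * b + 1" using const by auto
    fix t s x :: real assume t: "t \<ge> 0" and x: "x \<in> {0..L}"
    then have st: "(t, x) \<in> strip L" by (auto simp: strip_def)
    show "\<bar>w1 (t, x)\<bar> \<le> 1" "\<bar>w2 (t, x)\<bar> \<le> 1" using bounds(3,4)[OF st] const(2) by auto
    show "0 \<le> a1 (t, x) * \<beta> (t, x) / 2 \<and> a1 (t, x) * \<beta> (t, x) / 2 \<le> A\<^sub>0 * b / 2"
      using coef[OF st] aA[OF st] by blast
    show "0 \<le> (- a2 (t, x)) * \<beta> (t, x) / 2 \<and> (- a2 (t, x)) * \<beta> (t, x) / 2 \<le> A\<^sub>0 * b / 2"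
      using aA[OF st] by (intro coef[OF st]) auto
    assume s: "s \<ge> 0"
    then have ss: "(s, x) \<in> strip L" using x by (auto simp: strip_def)
    note ut = u_lipschitz_t[OF t s x]
    have d: "0 \<le> \<bar>t - s\<bar>" by simp
    note ad = a_diff[OF st ss ut(1,2) d]
    show "\<bar>a1 (t, x) - a1 (s, x)\<bar> \<le> 4 * A\<^sub>0\<^sup>2 * P * (b + 1) * K * \<bar>t - s\<bar>"
      "\<bar>a2 (t, x) - a2 (s, x)\<bar> \<le> 4 * A\<^sub>0\<^sup>2 * P * (b + 1) * K * \<bar>t - s\<bar>"
      using ad by auto
    fix Y assume Y: "\<bar>w1 (t, x) - w1 (s, x)\<bar> \<le> Y" "\<bar>w2 (t, x) - w2 (s, x)\<bar> \<le> Y"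
    note \<beta>d = ut(3)[unfolded mult_1]
    note diff = time_source_diff[OF _ _ _ abs_\<beta>_le[OF st] abs_\<beta>_le[OF ss] \<beta>d \<beta>_bounds(2)[OF st] \<beta>_bounds(2)[OF ss]
        \<beta>_bounds(4)[OF t s x] bounds(1)[OF st] bounds(2)[OF st] bounds(1)[OF ss] bounds(2)[OF ss]
        K_mult_le[OF d ut(1)] K_mult_le[OF d ut(2)] bounds(3)[OF st] bounds(4)[OF st] bounds(3)[OF ss] bounds(4)[OF ss]
        _ _ Y _ _ _ const(2)]
    show "\<bar>t1.source t x - t1.source s x - a1 (t, x) * \<beta> (t, x) / 2 * ((w1 (t, x) - w1 (s, x)) + (w2 (t, x) - w2 (s, x)))\<bar>
        \<le> 4 * A\<^sub>0\<^sup>2 * P * (b + 1) * K * Y + source_const A\<^sub>0 P b B * \<bar>t - s\<bar>"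
      unfolding S1 by (rule diff[OF aA(1)[OF st] aA(1)[OF ss] ad(3) bounds(3)[OF st] bounds(3)[OF ss] Y(1) const(3,4)])
    have "\<bar>t2.source t x - t2.source s x - a2 (t, x) * \<beta> (t, x) / 2 * ((w1 (t, x) - w1 (s, x)) + (w2 (t, x) - w2 (s, x)))\<bar>
        \<le> 4 * A\<^sub>0\<^sup>2 * P * (b + 1) * K * Y + source_const A\<^sub>0 P b B * \<bar>t - s\<bar>"
      unfolding S2 by (rule diff[OF aA(2)[OF st] aA(2)[OF ss] ad(4) bounds(4)[OF st] bounds(4)[OF ss] Y(2) const(4,3)])
    then show "\<bar>t2.source t x - t2.source s x + (- a2 (t, x)) * \<beta> (t, x) / 2 * ((w1 (t, x) - w1 (s, x)) + (w2 (t, x) - w2 (s, x)))\<bar>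
        \<le> 4 * A\<^sub>0\<^sup>2 * P * (b + 1) * K * Y + source_const A\<^sub>0 P b B * \<bar>t - s\<bar>"
      by (simp only: mult_minus_left minus_divide_left[symmetric] add_uminus_conv_diff)
  qed (rule const boundary data | assumption)+
  show "\<bar>w1 (t, x) - w1 (s, x)\<bar> \<le> lip_t * \<bar>t - s\<bar>" "\<bar>w2 (t, x) - w2 (s, x)\<bar> \<le> lip_t * \<bar>t - s\<bar>"
    using time_lipschitz[OF tsx] by (auto simp: lip_t_def)
qed

text \<open>Solved for X, the equation is algebraic in u, \<beta> and w, so a modulus of w passes to
  X between any two points; it is applied in the t-direction and in the x-direction.\<close>

lemma X_diff:
  assumes p: "p \<in> strip L" "p' \<in> strip L" and d: "d \<ge> 0"
    "\<bar>u1 p - u1 p'\<bar> \<le> K * d" "\<bar>u2 p - u2 p'\<bar> \<le> K * d" "\<bar>\<beta> p - \<beta> p'\<bar> \<le> 1 * d"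
    and w: "\<bar>w1 p - w1 p'\<bar> \<le> Y * d" "\<bar>w2 p - w2 p'\<bar> \<le> Y * d"
  shows "\<bar>X1 p - X1 p'\<bar> \<le> ((b + 1) + A\<^sub>0 * ((1 + b) + Y)) * d" "\<bar>X2 p - X2 p'\<bar> \<le> ((b + 1) + A\<^sub>0 * ((1 + b) + Y)) * d"
proof -
  have X: "X1 q = a1 q * (\<beta> q * (u1 q + u2 q) / 2 - w1 q)" "X2 q = a2 q * (\<beta> q * (u1 q + u2 q) / 2 - w2 q)"
    if "q \<in> strip L" for q
  proof -
    have aux: "z = inverse l * (r - w)" if "w + l * z = r" "l \<noteq> 0" for l w z r :: real
      using that by (auto simp: field_simps)
    show "X1 q = a1 q * (\<beta> q * (u1 q + u2 q) / 2 - w1 q)"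
      unfolding a1_def using pde(1)[OF that] speeds(1)[OF that] by (intro aux) simp_all
    show "X2 q = a2 q * (\<beta> q * (u1 q + u2 q) / 2 - w2 q)"
      unfolding a2_def using pde(2)[OF that] speeds(2)[OF that] by (intro aux) simp_all
  qed
  note ad = a_diff[OF p d(2,3,1)]
  note fl = flux_diff[OF abs_\<beta>_le[OF p(1)] abs_\<beta>_le[OF p(2)] d(4)[unfolded mult_1] bounds(1)[OF p(1)] bounds(2)[OF p(1)] _ const(2)
      K_mult_le[OF d(1,2)] K_mult_le[OF d(1,3)]]
  have bK: "(b + 1) * K \<le> b + 1" using mult_left_mono[OF const(2), of "b + 1"] const by simp
  have "\<bar>X1 p - X1 p'\<bar> \<le> d * (b + 1) + A\<^sub>0 * ((1 + b) * d + Y * d)"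
    unfolding X(1)[OF p(1)] X(1)[OF p(2)]
    using fl(1)[OF bounds(3)[OF p(1)] w(1)] bK speeds(3)[OF p(2)]
    by (intro abs_mult_diff_le ad fl(2)[OF bounds(3)[OF p(1)] w(1)]) (auto simp: a1_def)
  then show "\<bar>X1 p - X1 p'\<bar> \<le> ((b + 1) + A\<^sub>0 * ((1 + b) + Y)) * d" by (simp add: algebra_simps)
  have "\<bar>X2 p - X2 p'\<bar> \<le> d * (b + 1) + A\<^sub>0 * ((1 + b) * d + Y * d)"
    unfolding X(2)[OF p(1)] X(2)[OF p(2)]
    using fl(1)[OF bounds(4)[OF p(1)] w(2)] bK speeds(4)[OF p(2)]
    by (intro abs_mult_diff_le ad fl(2)[OF bounds(4)[OF p(1)] w(2)]) (auto simp: a2_def)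
  then show "\<bar>X2 p - X2 p'\<bar> \<le> ((b + 1) + A\<^sub>0 * ((1 + b) + Y)) * d" by (simp add: algebra_simps)
qed

lemma X_lipschitz_t:
  assumes "t \<ge> 0" "s \<ge> 0" "x \<in> {0..L}"
  shows "\<bar>X1 (t, x) - X1 (s, x)\<bar> \<le> lip_mixed * \<bar>t - s\<bar>" "\<bar>X2 (t, x) - X2 (s, x)\<bar> \<le> lip_mixed * \<bar>t - s\<bar>"
proof -
  have "(t, x) \<in> strip L" "(s, x) \<in> strip L" using assms by (auto simp: strip_def)
  note X_diff[OF this abs_ge_zero u_lipschitz_t[OF assms] w_lipschitz_t[OF assms]]
  then show "\<bar>X1 (t, x) - X1 (s, x)\<bar> \<le> lip_mixed * \<bar>t - s\<bar>" "\<bar>X2 (t, x) - X2 (s, x)\<bar> \<le> lip_mixed * \<bar>t - s\<bar>"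
    unfolding lip_mixed_def by blast+
qed

text \<open>Symmetry of the mixed second difference turns the t-modulus of X into the x-modulus of w.\<close>

lemma mixed_lipschitz:
  assumes f: "periodic_C1 T L f w"
    and dxf: "\<And>t x. t \<ge> 0 \<Longrightarrow> x \<in> {0..L} \<Longrightarrow> ((\<lambda>x. f (t, x)) has_real_derivative X (t, x)) (at x within {0..L})"
    and lip: "\<And>t s x. t \<ge> 0 \<Longrightarrow> s \<ge> 0 \<Longrightarrow> x \<in> {0..L} \<Longrightarrow> \<bar>X (t, x) - X (s, x)\<bar> \<le> M * \<bar>t - s\<bar>"
    and txy: "t \<ge> 0" "x \<in> {0..L}" "y \<in> {0..L}"
  shows "\<bar>w (t, x) - w (t, y)\<bar> \<le> M * \<bar>x - y\<bar>"
proof (rule field_le_epsilon)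
  fix e :: real assume "e > 0"
  then obtain h where h: "h > 0" and q: "\<And>x. x \<in> {0..L} \<Longrightarrow> \<bar>(f (t + h, x) - f (t, x)) / h - w (t, x)\<bar> \<le> e / 2"
    using periodic_C1_difference_quotient[OF f T, of "e / 2"] txy(1) by (metis half_gt_zero order_refl)
  have "\<bar>(\<lambda>(t', x). f (t + h, x) - f (t, x)) (t, x) - (\<lambda>(t', x). f (t + h, x) - f (t, x)) (t, y)\<bar> \<le> (M * h) * \<bar>x - y\<bar>"
  proof (rule strip_lipschitz_snd[where f' = "\<lambda>(t', x). X (t + h, x) - X (t, x)", OF _ _ txy])
    show "((\<lambda>x. (\<lambda>(t', x). f (t + h, x) - f (t, x)) (t', x)) has_real_derivative (\<lambda>(t', x). X (t + h, x) - X (t, x)) (t', x)) (at x within {0..L})"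
      if "x \<in> {0..L}" for t' x
      using that h txy by (auto intro!: DERIV_diff dxf)
    show "\<bar>(\<lambda>(t', x). X (t + h, x) - X (t, x)) (t, x)\<bar> \<le> M * h" if "x \<in> {0..L}" for x
      using lip[of "t + h" t x] that h txy by simp
  qed
  then have "\<bar>(f (t + h, x) - f (t, x)) - (f (t + h, y) - f (t, y))\<bar> \<le> (M * \<bar>x - y\<bar>) * h"
    by (simp add: mult_ac)
  then have "\<bar>((f (t + h, x) - f (t, x)) - (f (t + h, y) - f (t, y))) / h\<bar> \<le> M * \<bar>x - y\<bar>"
    using h by (simp add: pos_divide_le_eq)
  then have "\<bar>(f (t + h, x) - f (t, x)) / h - (f (t + h, y) - f (t, y)) / h\<bar> \<le> M * \<bar>x - y\<bar>"
    by (simp only: diff_divide_distrib)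
  then show "\<bar>w (t, x) - w (t, y)\<bar> \<le> M * \<bar>x - y\<bar> + e"
    using q[OF txy(2)] q[OF txy(3)] by linarith
qed

lemma w_lipschitz_x:
  assumes "t \<ge> 0" "x \<in> {0..L}" "y \<in> {0..L}"
  shows "\<bar>w1 (t, x) - w1 (t, y)\<bar> \<le> lip_mixed * \<bar>x - y\<bar>" "\<bar>w2 (t, x) - w2 (t, y)\<bar> \<le> lip_mixed * \<bar>x - y\<bar>"
  using mixed_lipschitz[OF u1 dx(1) X_lipschitz_t(1) assms] mixed_lipschitz[OF u2 dx(2) X_lipschitz_t(2) assms] by auto

lemma X_lipschitz_x:
  assumes "t \<ge> 0" "x \<in> {0..L}" "y \<in> {0..L}"
  shows "\<bar>X1 (t, x) - X1 (t, y)\<bar> \<le> lip_x * \<bar>x - y\<bar>" "\<bar>X2 (t, x) - X2 (t, y)\<bar> \<le> lip_x * \<bar>x - y\<bar>"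
proof -
  have "(t, x) \<in> strip L" "(t, y) \<in> strip L" using assms by (auto simp: strip_def)
  note X_diff[OF this abs_ge_zero u_lipschitz_x[OF assms] w_lipschitz_x[OF assms]]
  then show "\<bar>X1 (t, x) - X1 (t, y)\<bar> \<le> lip_x * \<bar>x - y\<bar>" "\<bar>X2 (t, x) - X2 (t, y)\<bar> \<le> lip_x * \<bar>x - y\<bar>"
    unfolding lip_x_def by blast+
qed

end

section \<open>Weak derivatives on the strip\<close>

lemma lborel_swap_integral:
  fixes k :: "real \<times> real \<Rightarrow> real"
  assumes [measurable]: "k \<in> borel_measurable borel"
  shows "(\<integral>p. k (prod.swap p) \<partial>lborel) = (\<integral>p. k p \<partial>lborel)"
  using lborel_pair.integral_product_swap[of k] unfolding lborel_prod
  by (simp add: case_prod_unfold prod.swap_def)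

lemma integral_deriv_compact_support:
  fixes \<phi> \<phi>' :: "real \<Rightarrow> real"
  assumes der: "\<And>t. (\<phi> has_real_derivative \<phi>' t) (at t)" and cd: "continuous_on UNIV \<phi>'"
    and supp: "\<And>t. \<phi> t \<noteq> 0 \<Longrightarrow> \<bar>t\<bar> < R"
  shows "(\<integral>t. \<phi>' t \<partial>lborel) = 0"
proof -
  define r where "r = max R 0"
  have d0: "\<phi>' t = 0" if "\<bar>t\<bar> > r" for t
    by (rule derivative_zero_outside[of \<phi> \<phi>' t R]) (use der supp that in \<open>auto simp: r_def\<close>)
  have "(\<phi>' has_integral (\<phi> r - \<phi> (- r))) {- r..r}"
    by (rule fundamental_theorem_of_calculus)
      (use der in \<open>auto simp: r_def has_real_derivative_iff_has_vector_derivative[symmetric] intro: has_field_derivative_at_within\<close>)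
  moreover have "\<phi> r = 0" "\<phi> (- r) = 0" using supp[of r] supp[of "- r"] by (force simp: r_def)+
  moreover have "set_integrable lborel {- r..r} \<phi>'"
    by (rule borel_integrable_atLeastAtMost') (use cd continuous_on_subset in blast)
  ultimately have "(\<integral>t. indicator {- r..r} t *\<^sub>R \<phi>' t \<partial>lborel) = 0"
    using set_borel_integral_eq_integral(2)[of "{- r..r}" \<phi>'] by (simp add: set_lebesgue_integral_def integral_unique)
  moreover have "(\<lambda>t. indicator {- r..r} t *\<^sub>R \<phi>' t) = \<phi>'"
  proof
    fix t show "indicator {- r..r} t *\<^sub>R \<phi>' t = \<phi>' t"
      using d0[of t] by (cases "\<bar>t\<bar> > r") (auto simp: indicator_def)
  qed
  ultimately show ?thesis by (simp only:)
qed

lemma fst_test_integral_deriv: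
  assumes test: "fst_test R \<psi> \<psi>'"
  shows "integrable lborel \<psi>'" "(\<integral>p. \<psi>' p \<partial>lborel) = 0"
proof -
  have c: "continuous_on UNIV \<psi>'" using test by (simp add: fst_test_def)
  show i: "integrable lborel \<psi>'"
    using integrable_continuous_support[OF continuous_on_const c, of R 1] fst_test_zero[OF test] by auto
  have "(\<integral>t. \<psi>' (t, x) \<partial>lborel) = 0" for x
  proof (rule integral_deriv_compact_support[of "\<lambda>t. \<psi> (t, x)" _ R])
    show "continuous_on UNIV (\<lambda>t. \<psi>' (t, x))"
      by (intro continuous_on_compose2[OF c] continuous_intros) auto
  qed (use test in \<open>auto simp: fst_test_def\<close>)
  then show "(\<integral>p. \<psi>' p \<partial>lborel) = 0"
    using lborel_pair.integral_snd[of "\<lambda>t x. \<psi>' (t, x)"] i unfolding lborel_prod by simp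
qed

lemma lebesgue_on_integral_eq:
  fixes h k :: "real \<times> real \<Rightarrow> real"
  assumes "open U" "h \<in> borel_measurable borel" "\<And>p. p \<in> U \<Longrightarrow> k p = h p" "\<And>p. p \<notin> U \<Longrightarrow> h p = 0"
  shows "(LINT p|lebesgue_on U. k p) = (\<integral>p. h p \<partial>lborel)"
proof -
  have "(LINT p|lebesgue_on U. k p) = (LINT p|lebesgue. indicator U p *\<^sub>R k p)"
    using assms(1) by (intro integral_restrict_space) auto
  also have "(\<lambda>p. indicator U p *\<^sub>R k p) = h"
    using assms(3,4) by (auto simp: indicator_def fun_eq_iff)
  also have "(LINT p|lebesgue. h p) = (\<integral>p. h p \<partial>lborel)"
    using assms(2) by (intro integral_completion) simp
  finally show ?thesis .
qed

lemma open_strip_interior: "open (strip_interior L)"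
  unfolding strip_interior_def by (intro open_Times) auto

lemma strip_interior_subset: "strip_interior L \<subseteq> strip L"
  by (auto simp: strip_def strip_interior_def)

lemma test_function_pderiv_facts:
  fixes \<psi> :: "real \<times> real \<Rightarrow> real"
  assumes test: "test_function U \<psi>"
  shows "((\<lambda>t. \<psi> (t, x)) has_real_derivative pderiv_on UNIV (1, 0) \<psi> (t, x)) (at t)"
    "((\<lambda>x. \<psi> (t, x)) has_real_derivative pderiv_on UNIV (0, 1) \<psi> (t, x)) (at x)"
  using Ck_on_Suc_fst[of 0 UNIV \<psi> t x] Ck_on_Suc_snd[of 0 UNIV \<psi> t x] test by (auto simp: test_function_def simp del: Ck_on.simps)

lemma test_function_pderiv:
  fixes \<psi> :: "real \<times> real \<Rightarrow> real"
  assumes test: "test_function U \<psi>" and b: "b \<in> {(1, 0), (0, 1)}"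
  shows "test_function U (pderiv_on UNIV b \<psi>)" "p \<notin> closure {x. \<psi> x \<noteq> 0} \<Longrightarrow> pderiv_on UNIV b \<psi> p = 0"
proof -
  let ?S = "closure {x. \<psi> x \<noteq> 0}"
  have \<psi>0: "\<psi> q = 0" if "q \<notin> ?S" for q using that closure_subset[of "{x. \<psi> x \<noteq> 0}"] by auto
  have z: "pderiv_on UNIV b \<psi> p = 0" if "p \<notin> ?S" for p
  proof -
    obtain t x where p: "p = (t, x)" by (cases p)
    have op: "open {s. (s, x) \<in> - ?S}" "open {y. (t, y) \<in> - ?S}"
      by (intro open_vimage[of "- ?S", unfolded vimage_def] open_Compl closed_closure continuous_intros)+
    have "pderiv_on UNIV (1, 0) \<psi> (t, x) = 0"
      using that p by (intro derivative_of_locally_constant[where c = 0, OF test_function_pderiv_facts(1)[OF test] op(1)]) (auto intro: \<psi>0)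
    moreover have "pderiv_on UNIV (0, 1) \<psi> (t, x) = 0"
      using that p by (intro derivative_of_locally_constant[where c = 0, OF test_function_pderiv_facts(2)[OF test] op(2)]) (auto intro: \<psi>0)
    ultimately show ?thesis using b p by auto
  qed
  then show "p \<notin> ?S \<Longrightarrow> pderiv_on UNIV b \<psi> p = 0" .
  have sub: "closure {x. pderiv_on UNIV b \<psi> x \<noteq> 0} \<subseteq> ?S" using z by (intro closure_minimal) auto
  then have "compact (closure {x. pderiv_on UNIV b \<psi> x \<noteq> 0})"
    using test compact_Int_closed[of ?S "closure {x. pderiv_on UNIV b \<psi> x \<noteq> 0}"]
    by (simp add: test_function_def inf.absorb2)
  moreover have "Ck_on k UNIV (pderiv_on UNIV b \<psi>)" for k
    using test b by (intro Ck_on_Suc_cont) (auto simp: test_function_def simp del: Ck_on.simps)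
  ultimately show "test_function U (pderiv_on UNIV b \<psi>)"
    using sub test unfolding test_function_def by blast
qed

lemma test_function_box:
  fixes \<psi> :: "real \<times> real \<Rightarrow> real"
  assumes "test_function U \<psi>"
  obtains R where "\<And>p. \<psi> p \<noteq> 0 \<Longrightarrow> \<bar>fst p\<bar> < R \<and> \<bar>snd p\<bar> < R"
proof -
  have "bounded (closure {x. \<psi> x \<noteq> 0})" using assms compact_imp_bounded by (auto simp: test_function_def)
  then obtain R where R: "\<And>p. p \<in> closure {x. \<psi> x \<noteq> 0} \<Longrightarrow> norm p \<le> R" unfolding bounded_iff by blast
  have "\<bar>fst p\<bar> < R + 1 \<and> \<bar>snd p\<bar> < R + 1" if "\<psi> p \<noteq> 0" for p
  proof -
    have "norm p \<le> R" using that by (intro R subsetD[OF closure_subset]) simp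
    then show ?thesis using norm_fst_le[of "fst p" "snd p"] norm_snd_le[of "snd p" "fst p"] by simp
  qed
  then show ?thesis using that by blast
qed

lemma test_function_cont:
  fixes \<psi> :: "real \<times> real \<Rightarrow> real"
  assumes "test_function U \<psi>"
  shows "continuous_on A \<psi>"
proof -
  have "Ck_on 0 UNIV \<psi>" using assms by (simp add: test_function_def)
  then show ?thesis using continuous_on_subset by auto
qed

lemma fst_test_of_test_function:
  assumes "test_function U \<psi>" "\<And>p. \<psi> p \<noteq> 0 \<Longrightarrow> \<bar>fst p\<bar> < R \<and> \<bar>snd p\<bar> < R"
  shows "fst_test R \<psi> (pderiv_on UNIV (1, 0) \<psi>)"
    "fst_test R (\<lambda>p. \<psi> (prod.swap p)) (\<lambda>p. pderiv_on UNIV (0, 1) \<psi> (prod.swap p))"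
proof -
  have c: "continuous_on A (pderiv_on UNIV b \<psi>)" if "b \<in> {(1, 0), (0, 1)}" for b A
    using test_function_cont[OF test_function_pderiv(1)[OF assms(1) that]] .
  show "fst_test R \<psi> (pderiv_on UNIV (1, 0) \<psi>)"
    unfolding fst_test_def using assms(2) test_function_pderiv_facts(1)[OF assms(1)] test_function_cont[OF assms(1)] c by auto
  have sw: "continuous_on UNIV (\<lambda>p. f (prod.swap p))" if "continuous_on UNIV f" for f :: "real \<times> real \<Rightarrow> real"
    by (rule continuous_on_compose2[OF that]) (auto intro!: continuous_intros simp: prod.swap_def)
  show "fst_test R (\<lambda>p. \<psi> (prod.swap p)) (\<lambda>p. pderiv_on UNIV (0, 1) \<psi> (prod.swap p))"
    unfolding fst_test_def using assms(2) test_function_pderiv_facts(2)[OF assms(1)]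
    by (auto intro!: sw test_function_cont[OF assms(1)] c)
qed

text \<open>Projecting each coordinate onto the strip is nonexpansive, so the extension keeps the
  constant. It is needed because \<open>bounded_weak_derivative_fst\<close> speaks of functions on
  the whole plane.\<close>

lemma clamp_lipschitz:
  fixes f :: "real \<times> real \<Rightarrow> real"
  assumes "L > 0" and lip: "\<And>t s x y. (t, x) \<in> strip L \<Longrightarrow> (s, y) \<in> strip L \<Longrightarrow> \<bar>f (t, x) - f (s, y)\<bar> \<le> C * (\<bar>t - s\<bar> + \<bar>x - y\<bar>)"
  defines "F \<equiv> \<lambda>p. f (max 0 (fst p), max 0 (min L (snd p)))"
  shows "continuous_on UNIV F" "\<bar>F (t, x) - F (s, x)\<bar> \<le> \<bar>C\<bar> * \<bar>t - s\<bar>" "\<bar>F (t, x) - F (t, y)\<bar> \<le> \<bar>C\<bar> * \<bar>x - y\<bar>"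
    "p \<in> strip L \<Longrightarrow> F p = f p"
proof -
  have main: "\<bar>F (t, x) - F (s, y)\<bar> \<le> \<bar>C\<bar> * (\<bar>t - s\<bar> + \<bar>x - y\<bar>)" for t s x y
  proof -
    have "\<bar>F (t, x) - F (s, y)\<bar> \<le> C * (\<bar>max 0 t - max 0 s\<bar> + \<bar>max 0 (min L x) - max 0 (min L y)\<bar>)"
      unfolding F_def using assms(1) by (simp, intro lip) (auto simp: strip_def)
    also have "\<dots> \<le> \<bar>C\<bar> * (\<bar>max 0 t - max 0 s\<bar> + \<bar>max 0 (min L x) - max 0 (min L y)\<bar>)"
      by (intro mult_right_mono) auto
    also have "\<dots> \<le> \<bar>C\<bar> * (\<bar>t - s\<bar> + \<bar>x - y\<bar>)" by (intro mult_left_mono add_mono) auto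
    finally show ?thesis .
  qed
  show "\<bar>F (t, x) - F (s, x)\<bar> \<le> \<bar>C\<bar> * \<bar>t - s\<bar>" "\<bar>F (t, x) - F (t, y)\<bar> \<le> \<bar>C\<bar> * \<bar>x - y\<bar>"
    using main[of t x s x] main[of t x t y] by auto
  show "p \<in> strip L \<Longrightarrow> F p = f p" by (auto simp: strip_def F_def)
  show "continuous_on UNIV F"
  proof (rule continuous_onI)
    fix p :: "real \<times> real" and e :: real assume e: "0 < e"
    obtain t x where p: "p = (t, x)" by (cases p)
    show "\<exists>d>0. \<forall>q\<in>UNIV. dist q p < d \<longrightarrow> dist (F q) (F p) \<le> e"
    proof (intro exI[of _ "e / (2 * (\<bar>C\<bar> + 1))"] conjI ballI impI)
      fix q :: "real \<times> real" assume q: "dist q p < e / (2 * (\<bar>C\<bar> + 1))"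
      obtain s y where q': "q = (s, y)" by (cases q)
      have "\<bar>s - t\<bar> \<le> dist q p" "\<bar>y - x\<bar> \<le> dist q p"
        using dist_fst_le[of q p] dist_snd_le[of q p] by (auto simp: p q' dist_real_def)
      then have "\<bar>C\<bar> * (\<bar>s - t\<bar> + \<bar>y - x\<bar>) \<le> (\<bar>C\<bar> + 1) * (2 * dist q p)"
        by (intro mult_mono) auto
      also have "\<dots> \<le> e" using q by (simp add: field_simps)
      finally show "dist (F q) (F p) \<le> e" using main[of s y t x] by (simp add: p q' dist_real_def)
    qed (use e in auto)
  qed
qed

text \<open>Test functions and their derivatives vanish off the interior, so the integrals over the
  strip equal integrals over the plane with the clamped extension in place of f.\<close>

lemma strip_weak_derivative:
  fixes f :: "real \<times> real \<Rightarrow> real"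
  assumes L: "L > 0" and lip: "\<And>t s x y. (t, x) \<in> strip L \<Longrightarrow> (s, y) \<in> strip L \<Longrightarrow> \<bar>f (t, x) - f (s, y)\<bar> \<le> C * (\<bar>t - s\<bar> + \<bar>x - y\<bar>)"
    and b: "b \<in> {(1, 0), (0, 1)}"
  shows "\<exists>g. g \<in> borel_measurable borel \<and> (\<forall>p. \<bar>g p\<bar> \<le> 2 * (\<bar>C\<bar> + 1)) \<and>
    (\<forall>\<psi>. test_function (strip_interior L) \<psi> \<longrightarrow>
      (LINT p|lebesgue_on (strip_interior L). f p * pderiv_on UNIV b \<psi> p) =
      - (LINT p|lebesgue_on (strip_interior L). g p * \<psi> p))"
proof -
  let ?U = "strip_interior L"
  define F where "F = (\<lambda>p. f (max 0 (fst p), max 0 (min L (snd p))))"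
  have F: "continuous_on UNIV F" "\<And>t s x. \<bar>F (t, x) - F (s, x)\<bar> \<le> \<bar>C\<bar> * \<bar>t - s\<bar>"
    "\<And>t x y. \<bar>F (t, x) - F (t, y)\<bar> \<le> \<bar>C\<bar> * \<bar>x - y\<bar>" "\<And>p. p \<in> strip L \<Longrightarrow> F p = f p"
    unfolding F_def using clamp_lipschitz[OF L lip] by blast+
  have Fm: "F \<in> borel_measurable borel" using F(1) by (rule borel_measurable_continuous_onI)
  have conv: "(LINT p|lebesgue_on ?U. f p * pderiv_on UNIV b \<psi> p) = (\<integral>p. F p * pderiv_on UNIV b \<psi> p \<partial>lborel)"
    "(LINT p|lebesgue_on ?U. g p * \<psi> p) = (\<integral>p. g p * \<psi> p \<partial>lborel)"
    if test: "test_function ?U \<psi>" and g: "g \<in> borel_measurable borel" for g \<psi>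
  proof -
    have m: "\<psi> \<in> borel_measurable borel" "pderiv_on UNIV b \<psi> \<in> borel_measurable borel"
      using test_function_cont[OF test] test_function_cont[OF test_function_pderiv(1)[OF test b]]
      by (auto intro: borel_measurable_continuous_onI)
    have S: "closure {x. \<psi> x \<noteq> 0} \<subseteq> ?U" using test by (simp add: test_function_def)
    have "\<psi> p = 0" "pderiv_on UNIV b \<psi> p = 0" if "p \<notin> ?U" for p
      using that S closure_subset[of "{x. \<psi> x \<noteq> 0}"] test_function_pderiv(2)[OF test b, of p] by auto
    then show "(LINT p|lebesgue_on ?U. f p * pderiv_on UNIV b \<psi> p) = (\<integral>p. F p * pderiv_on UNIV b \<psi> p \<partial>lborel)"
      "(LINT p|lebesgue_on ?U. g p * \<psi> p) = (\<integral>p. g p * \<psi> p \<partial>lborel)"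
      using Fm g m F(4) strip_interior_subset[of L]
      by (auto intro!: lebesgue_on_integral_eq open_strip_interior borel_measurable_times)
  qed
  show ?thesis
  proof (cases "b = (1, 0)")
    case True
    obtain g where g: "g \<in> borel_measurable borel" "\<And>p. \<bar>g p\<bar> \<le> 2 * (\<bar>C\<bar> + 1)"
      and ibp: "\<And>\<psi> \<psi>' R. fst_test R \<psi> \<psi>' \<Longrightarrow> (\<integral>p. F p * \<psi>' p \<partial>lborel) = - (\<integral>p. g p * \<psi> p \<partial>lborel)"
      using bounded_weak_derivative_fst[OF F(1,2), unfolded abs_idempotent] by blast
    show ?thesis
    proof (intro exI[of _ g] conjI allI impI)
      fix \<psi> assume test: "test_function ?U \<psi>"
      obtain R where R: "\<And>p. \<psi> p \<noteq> 0 \<Longrightarrow> \<bar>fst p\<bar> < R \<and> \<bar>snd p\<bar> < R" using test_function_box[OF test] by blast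
      show "(LINT p|lebesgue_on ?U. f p * pderiv_on UNIV b \<psi> p) = - (LINT p|lebesgue_on ?U. g p * \<psi> p)"
        unfolding conv[OF test g(1)] unfolding True by (rule ibp[OF fst_test_of_test_function(1)[OF test R]])
    qed (use g in auto)
  next
    case False
    then have b: "b = (0, 1)" using b by auto
    \<comment> \<open>For the x-direction the result in the first variable is applied to the
      function with swapped coordinates, and its weak derivative is swapped back.\<close>
    have csw: "continuous_on UNIV (\<lambda>p. F (prod.swap p))"
      by (rule continuous_on_compose2[OF F(1)]) (auto intro!: continuous_intros simp: prod.swap_def)
    have "\<bar>F (prod.swap (t, x)) - F (prod.swap (s, x))\<bar> \<le> \<bar>C\<bar> * \<bar>t - s\<bar>" for t s x using F(3) by simp
    then obtain g where g: "g \<in> borel_measurable borel" "\<And>p. \<bar>g p\<bar> \<le> 2 * (\<bar>C\<bar> + 1)"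
      and ibp: "\<And>\<psi> \<psi>' R. fst_test R \<psi> \<psi>' \<Longrightarrow> (\<integral>p. F (prod.swap p) * \<psi>' p \<partial>lborel) = - (\<integral>p. g p * \<psi> p \<partial>lborel)"
      using bounded_weak_derivative_fst[OF csw, of "\<bar>C\<bar>", unfolded abs_idempotent] by blast
    have swm: "prod.swap \<in> borel_measurable (borel :: (real \<times> real) measure)"
      by (intro borel_measurable_continuous_onI) (auto intro!: continuous_intros simp: prod.swap_def)
    have gs: "(\<lambda>p. g (prod.swap p)) \<in> borel_measurable borel"
      using measurable_compose[OF swm g(1)] by simp
    show ?thesis
    proof (intro exI[of _ "\<lambda>p. g (prod.swap p)"] conjI allI impI)
      fix \<psi> assume test: "test_function ?U \<psi>"
      obtain R where R: "\<And>p. \<psi> p \<noteq> 0 \<Longrightarrow> \<bar>fst p\<bar> < R \<and> \<bar>snd p\<bar> < R" using test_function_box[OF test] by blast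
      have m: "\<psi> \<in> borel_measurable borel" "pderiv_on UNIV (0, 1) \<psi> \<in> borel_measurable borel"
        using test_function_cont[OF test] test_function_cont[OF test_function_pderiv(1)[OF test, of "(0, 1)"]]
        by (auto intro: borel_measurable_continuous_onI)
      have "(\<integral>p. F p * pderiv_on UNIV (0, 1) \<psi> p \<partial>lborel) = (\<integral>p. F (prod.swap p) * pderiv_on UNIV (0, 1) \<psi> (prod.swap p) \<partial>lborel)"
        using lborel_swap_integral[of "\<lambda>p. F p * pderiv_on UNIV (0, 1) \<psi> p"] Fm m by simp
      also have "\<dots> = - (\<integral>p. g p * \<psi> (prod.swap p) \<partial>lborel)"
        by (rule ibp[OF fst_test_of_test_function(2)[OF test R]])
      also have "(\<integral>p. g p * \<psi> (prod.swap p) \<partial>lborel) = (\<integral>p. g (prod.swap p) * \<psi> p \<partial>lborel)"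
        using lborel_swap_integral[of "\<lambda>p. g (prod.swap p) * \<psi> p"] gs m by simp
      finally show "(LINT p|lebesgue_on ?U. f p * pderiv_on UNIV b \<psi> p) = - (LINT p|lebesgue_on ?U. g (prod.swap p) * \<psi> p)"
        unfolding conv[OF test gs] unfolding b .
    qed (use g gs in auto)
  qed
qed

section \<open>Classical integration by parts on the strip\<close>

lemma zero_extension_cont:
  fixes v :: "real \<times> real \<Rightarrow> real"
  assumes "open U" "closed S" "S \<subseteq> U" "continuous_on U v" "\<And>p. p \<in> U - S \<Longrightarrow> v p = 0"
  shows "continuous_on UNIV (\<lambda>p. if p \<in> U then v p else 0)"
proof -
  have "continuous_on U (\<lambda>p. if p \<in> U then v p else 0)"
    using assms(4) by (subst continuous_on_cong[OF refl, where g = v]) auto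
  moreover have "continuous_on (- S) (\<lambda>p. if p \<in> U then v p else 0)"
    using assms(5) by (subst continuous_on_cong[OF refl, where g = "\<lambda>_. 0"]) auto
  ultimately have "continuous_on (U \<union> - S) (\<lambda>p. if p \<in> U then v p else 0)"
    using assms(1,2) by (intro continuous_on_open_Un) auto
  then show ?thesis using assms(3) by (metis Compl_partition double_complement sup.absorb_iff1 sup_assoc sup_commute sup_top_left)
qed

text \<open>A point off U has the complement of S as a neighbourhood, and the extension vanishes on
  it; hence its derivative there is 0, whatever v is outside U.\<close>

lemma zero_extension_deriv:
  fixes v v' :: "real \<Rightarrow> real"
  assumes "open U" "closed S" "S \<subseteq> U" "\<And>t. t \<in> U \<Longrightarrow> (v has_real_derivative v' t) (at t)" "\<And>t. t \<in> U - S \<Longrightarrow> v t = 0"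
  shows "((\<lambda>t. if t \<in> U then v t else 0) has_real_derivative (if t \<in> U then v' t else 0)) (at t)"
proof (cases "t \<in> U")
  case True
  have "((\<lambda>t. if t \<in> U then v t else 0) has_real_derivative v' t) (at t)"
    by (rule has_field_derivative_transform_within_open[OF assms(4)[OF True] assms(1) True]) auto
  then show ?thesis using True by simp
next
  case False
  have "((\<lambda>t. if t \<in> U then v t else 0) has_real_derivative 0) (at t)"
    by (rule has_field_derivative_transform_within_open[OF DERIV_const open_Compl[OF assms(2)], of _ 0])
      (use assms(3,5) False in auto)
  then show ?thesis using False by simp
qed

lemma strip_interior_deriv:
  fixes u :: "real \<times> real \<Rightarrow> real"
  assumes Ck: "Ck_on 1 (strip L) u" and p: "(t, x) \<in> strip_interior L"
  shows "((\<lambda>t. u (t, x)) has_real_derivative pderiv_on (strip L) (1, 0) u (t, x)) (at t)"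
    "((\<lambda>x. u (t, x)) has_real_derivative pderiv_on (strip L) (0, 1) u (t, x)) (at x)"
proof -
  have tx: "t > 0" "0 < x" "x < L" "(t, x) \<in> strip L" using p by (auto simp: strip_interior_def strip_def)
  show "((\<lambda>t. u (t, x)) has_real_derivative pderiv_on (strip L) (1, 0) u (t, x)) (at t)"
    using Ck_on_Suc_fst[of 0 "strip L" u t x] Ck tx at_within_interior[of t "{0..}"] strip_fst_set[of x L] by simp
  show "((\<lambda>x. u (t, x)) has_real_derivative pderiv_on (strip L) (0, 1) u (t, x)) (at x)"
    using Ck_on_Suc_snd[of 0 "strip L" u t x] Ck tx at_within_interior[of x "{0..L}"] strip_snd_set[of t L] by simp
qed

text \<open>The product of u and \<psi>, extended by zero, has a continuous derivative along b on
  the whole plane and bounded support, so the integral of this derivative is 0. Only the product is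
  extended, never u.\<close>

lemma strip_integration_by_parts:
  fixes u \<psi> :: "real \<times> real \<Rightarrow> real"
  assumes Ck: "Ck_on 1 (strip L) u" and test: "test_function (strip_interior L) \<psi>"
    and b: "b \<in> {(1, 0), (0, 1)}"
  shows "(LINT p|lebesgue_on (strip_interior L). u p * pderiv_on UNIV b \<psi> p) =
    - (LINT p|lebesgue_on (strip_interior L). pderiv_on (strip L) b u p * \<psi> p)"
proof -
  let ?U = "strip_interior L"
  let ?ub = "pderiv_on (strip L) b u" and ?\<psi>b = "pderiv_on UNIV b \<psi>"
  define S where "S = closure {x. \<psi> x \<noteq> 0}"
  define Z where "Z = (\<lambda>v p. if p \<in> ?U then v p else (0::real))"
  have SU: "S \<subseteq> ?U" and cS: "compact S" using test by (simp_all add: test_function_def S_def)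
  have clS: "closed S" by (simp add: S_def)
  have \<psi>0: "\<psi> p = 0" "?\<psi>b p = 0" if "p \<notin> S" for p
    using that subsetD[OF closure_subset, of p "{x. \<psi> x \<noteq> 0}"] test_function_pderiv(2)[OF test b, of p]
    unfolding S_def by auto
  have cu: "continuous_on ?U u" "continuous_on ?U ?ub"
    using Ck_on_Suc_cont(2,3)[of 0 "strip L" u b] Ck b
    by (auto intro: continuous_on_subset[OF _ strip_interior_subset])
  have c\<psi>: "continuous_on A \<psi>" "continuous_on A ?\<psi>b" for A
    using test_function_cont[OF test, of A] test_function_cont[OF test_function_pderiv(1)[OF test b], of A] by auto
  have Zc: "continuous_on UNIV (Z v)" if "continuous_on ?U v" "\<And>p. p \<notin> S \<Longrightarrow> v p = 0" for v
    unfolding Z_def using that SU by (intro zero_extension_cont[of _ S] open_strip_interior clS) auto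
  define h where "h = Z (\<lambda>p. u p * \<psi> p)"
  define h' where "h' = Z (\<lambda>p. ?ub p * \<psi> p + ?\<psi>b p * u p)"
  have ch: "continuous_on UNIV h" "continuous_on UNIV h'"
  proof -
    have c1: "continuous_on ?U (\<lambda>p. u p * \<psi> p)"
      by (rule continuous_on_mult[OF cu(1) c\<psi>(1)])
    show "continuous_on UNIV h" unfolding h_def by (rule Zc[OF c1]) (simp add: \<psi>0)
    have c2: "continuous_on ?U (\<lambda>p. ?ub p * \<psi> p + ?\<psi>b p * u p)"
      by (rule continuous_on_add[OF continuous_on_mult[OF cu(2) c\<psi>(1)] continuous_on_mult[OF c\<psi>(2) cu(1)]])
    show "continuous_on UNIV h'"
      unfolding h'_def by (rule Zc[OF c2]) (simp add: \<psi>0)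
  qed
  obtain R where R: "\<And>p. \<psi> p \<noteq> 0 \<Longrightarrow> \<bar>fst p\<bar> < R \<and> \<bar>snd p\<bar> < R" using test_function_box[OF test] by blast
  have hR: "\<bar>fst p\<bar> < R \<and> \<bar>snd p\<bar> < R" if "h p \<noteq> 0" for p
    using that R[of p] by (auto simp: h_def Z_def split: if_splits)
  have int: "integrable lborel h' \<and> (\<integral>p. h' p \<partial>lborel) = 0"
  proof (cases "b = (1, 0)")
    case True
    have "((\<lambda>t. h (t, x)) has_real_derivative h' (t, x)) (at t)" for t x
      unfolding h_def h'_def Z_def
    proof (rule zero_extension_deriv[of "{t. (t, x) \<in> ?U}" "{t. (t, x) \<in> S}" "\<lambda>t. u (t, x) * \<psi> (t, x)", simplified mem_Collect_eq])
      show "open {t. (t, x) \<in> ?U}" "closed {t. (t, x) \<in> S}"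
        by (intro open_vimage[of ?U, unfolded vimage_def] closed_vimage[of S, unfolded vimage_def]
            open_strip_interior clS continuous_intros)+
      show "((\<lambda>t. u (t, x) * \<psi> (t, x)) has_real_derivative ?ub (t, x) * \<psi> (t, x) + ?\<psi>b (t, x) * u (t, x)) (at t)"
        if "(t, x) \<in> ?U" for t
        unfolding True by (intro DERIV_mult strip_interior_deriv[OF Ck that] test_function_pderiv_facts[OF test])
    qed (use SU \<psi>0 in auto)
    then have "fst_test R h h'" using ch hR by (auto simp: fst_test_def)
    then show ?thesis using fst_test_integral_deriv by blast
  next
    case False
    then have b: "b = (0, 1)" using b by auto
    have "((\<lambda>x. h (t, x)) has_real_derivative h' (t, x)) (at x)" for t x
      unfolding h_def h'_def Z_def
    proof (rule zero_extension_deriv[of "{x. (t, x) \<in> ?U}" "{x. (t, x) \<in> S}" "\<lambda>x. u (t, x) * \<psi> (t, x)", simplified mem_Collect_eq])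
      show "open {x. (t, x) \<in> ?U}" "closed {x. (t, x) \<in> S}"
        by (intro open_vimage[of ?U, unfolded vimage_def] closed_vimage[of S, unfolded vimage_def]
            open_strip_interior clS continuous_intros)+
      show "((\<lambda>x. u (t, x) * \<psi> (t, x)) has_real_derivative ?ub (t, x) * \<psi> (t, x) + ?\<psi>b (t, x) * u (t, x)) (at x)"
        if "(t, x) \<in> ?U" for x
        unfolding b by (intro DERIV_mult strip_interior_deriv[OF Ck that] test_function_pderiv_facts[OF test])
    qed (use SU \<psi>0 in auto)
    moreover have "continuous_on UNIV (\<lambda>p. f (prod.swap p))" if "continuous_on UNIV f" for f :: "real \<times> real \<Rightarrow> real"
      by (rule continuous_on_compose2[OF that]) (auto intro!: continuous_intros simp: prod.swap_def)
    ultimately have "fst_test R (\<lambda>p. h (prod.swap p)) (\<lambda>p. h' (prod.swap p))"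
      using ch hR by (auto simp: fst_test_def)
    from fst_test_integral_deriv(2)[OF this] have "(\<integral>p. h' p \<partial>lborel) = 0"
      using lborel_swap_integral[of h'] ch by (simp add: borel_measurable_continuous_onI)
    moreover have "integrable lborel h'"
    proof -
      have "h' p = 0" if "p \<notin> {-R..R} \<times> {-R..R}" for p
      proof -
        have "S \<subseteq> {-R..R} \<times> {-R..R}"
          unfolding S_def
        proof (rule closure_minimal)
          show "{x. \<psi> x \<noteq> 0} \<subseteq> {- R..R} \<times> {- R..R}" using R by (force simp: abs_less_iff)
        qed (intro closed_Times closed_atLeastAtMost)
        then have "p \<notin> S" using that by blast
        then show ?thesis using \<psi>0[of p] by (simp add: h'_def Z_def)
      qed
      then show ?thesis using integrable_continuous_support[OF continuous_on_const ch(2), of R 1] by simp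
    qed
    ultimately show ?thesis by simp
  qed
  have Zi: "integrable lborel (Z v)" if "continuous_on ?U v" "\<And>p. p \<notin> S \<Longrightarrow> v p = 0" for v
  proof -
    have "integrable lborel (\<lambda>p. indicator S p *\<^sub>R Z v p)"
      using Zc[OF that] by (intro borel_integrable_compact cS) (auto intro: continuous_on_subset)
    moreover have "(\<lambda>p. indicator S p *\<^sub>R Z v p) = Z v"
    proof
      fix p show "indicator S p *\<^sub>R Z v p = Z v p" using that(2)[of p] by (cases "p \<in> S") (auto simp: Z_def)
    qed
    ultimately show ?thesis by simp
  qed
  have conv: "(LINT p|lebesgue_on ?U. v p) = (\<integral>p. Z v p \<partial>lborel)"
    if "continuous_on ?U v" "\<And>p. p \<notin> S \<Longrightarrow> v p = 0" for v
    using Zc[OF that] by (intro lebesgue_on_integral_eq open_strip_interior borel_measurable_continuous_onI) (auto simp: Z_def)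
  have 1: "continuous_on ?U (\<lambda>p. u p * ?\<psi>b p)" "continuous_on ?U (\<lambda>p. ?ub p * \<psi> p)"
    by (intro continuous_on_mult cu c\<psi>)+
  have 2: "u p * ?\<psi>b p = 0" "?ub p * \<psi> p = 0" if "p \<notin> S" for p using \<psi>0[OF that] by auto
  have "h' = (\<lambda>p. Z (\<lambda>p. ?ub p * \<psi> p) p + Z (\<lambda>p. u p * ?\<psi>b p) p)"
    by (auto simp: h'_def Z_def)
  then have "(\<integral>p. Z (\<lambda>p. ?ub p * \<psi> p) p \<partial>lborel) + (\<integral>p. Z (\<lambda>p. u p * ?\<psi>b p) p \<partial>lborel) = 0"
    using int Zi[OF 1(1) 2(1)] Zi[OF 1(2) 2(2)] by simp
  moreover have "(LINT p|lebesgue_on ?U. u p * ?\<psi>b p) = (\<integral>p. Z (\<lambda>p. u p * ?\<psi>b p) p \<partial>lborel)"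
    by (rule conv[OF 1(1)]) (rule 2(1))
  moreover have "(LINT p|lebesgue_on ?U. ?ub p * \<psi> p) = (\<integral>p. Z (\<lambda>p. ?ub p * \<psi> p) p \<partial>lborel)"
    by (rule conv[OF 1(2)]) (rule 2(2))
  ultimately show ?thesis by linarith
qed

section \<open>Membership in W^{2,\<infinity>}\<close>

lemma cont_measurable_lebesgue_on:
  fixes f :: "real \<times> real \<Rightarrow> real"
  assumes "open U" "continuous_on U f"
  shows "f \<in> borel_measurable (lebesgue_on U)"
  using assms by (intro continuous_imp_measurable_on_sets_lebesgue) auto

lemma borel_measurable_lebesgue_on:
  fixes f :: "real \<times> real \<Rightarrow> real"
  assumes "f \<in> borel_measurable borel"
  shows "f \<in> borel_measurable (lebesgue_on U)"
  using assms by (intro measurable_restrict_space1 measurable_completion) auto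

lemma locally_integrable_bounded:
  fixes f :: "real \<times> real \<Rightarrow> real"
  assumes "open U" "\<And>K. compact K \<Longrightarrow> K \<subseteq> U \<Longrightarrow> f \<in> borel_measurable (lebesgue_on K)" "\<And>p. p \<in> U \<Longrightarrow> \<bar>f p\<bar> \<le> B"
  shows "locally_integrable U f"
  unfolding locally_integrable_def
proof (intro allI impI)
  fix K assume K: "compact K \<and> K \<subseteq> U"
  then interpret finite_measure "lebesgue_on K"
    by (intro finite_measure_lebesgue_on lmeasurable_compact) auto
  show "integrable (lebesgue_on K) f"
    by (rule integrable_const_bound[of _ B]) (use K assms in \<open>auto intro!: AE_I2\<close>)
qed

lemma Linf_norm_le:
  fixes f :: "real \<times> real \<Rightarrow> real"
  assumes "f \<in> borel_measurable (lebesgue_on U)" "\<And>p. p \<in> U \<Longrightarrow> \<bar>f p\<bar> \<le> B"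
  shows "Linf_norm U f \<le> ereal B"
  unfolding Linf_norm_def using assms by (intro esssup_I AE_I2) auto

text \<open>In \<open>iter_pderiv [a, b]\<close> the derivative along a is applied last. It moves to
  u classically, with the b-derivative of the test function as new test function; the remaining
  derivative then falls on a Lipschitz function, which has a bounded weak derivative. The two signs
  cancel.\<close>

lemma strip_W2_inf:
  fixes u :: "real \<times> real \<Rightarrow> real"
  assumes L: "L > 0" and Ck: "Ck_on 1 (strip L) u"
    and bd: "\<And>p. p \<in> strip L \<Longrightarrow> \<bar>u p\<bar> \<le> K"
      "\<And>b p. b \<in> {(1, 0), (0, 1)} \<Longrightarrow> p \<in> strip L \<Longrightarrow> \<bar>pderiv_on (strip L) b u p\<bar> \<le> K"
    and lip: "\<And>b t s x y. b \<in> {(1, 0), (0, 1)} \<Longrightarrow> (t, x) \<in> strip L \<Longrightarrow> (s, y) \<in> strip L \<Longrightarrow>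
      \<bar>pderiv_on (strip L) b u (t, x) - pderiv_on (strip L) b u (s, y)\<bar> \<le> C * (\<bar>t - s\<bar> + \<bar>x - y\<bar>)"
  shows "Wk_inf 2 (strip_interior L) u"
    "\<And>a b. a \<in> {(1, 0), (0, 1)} \<Longrightarrow> b \<in> {(1, 0), (0, 1)} \<Longrightarrow>
      weak_deriv_Linf_le (strip_interior L) [a, b] u (2 * (\<bar>C\<bar> + 1))"
proof -
  let ?U = "strip_interior L"
  note sub = strip_interior_subset[of L]
  have cont: "continuous_on A u" "b \<in> {(1, 0), (0, 1)} \<Longrightarrow> continuous_on A (pderiv_on (strip L) b u)" if "A \<subseteq> ?U" for A b
  proof -
    have A: "A \<subseteq> strip L" using that sub by simp
    have "Ck_on (Suc 0) (strip L) u" using Ck by simp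
    note Ck_on_Suc_cont(2)[OF this, of "(1, 0)"] Ck_on_Suc_cont(3)[OF this]
    then show "continuous_on A u" "b \<in> {(1, 0), (0, 1)} \<Longrightarrow> continuous_on A (pderiv_on (strip L) b u)"
      using continuous_on_subset[OF _ A] by blast+
  qed
  have cl: "locally_integrable ?U f \<and> Linf_norm ?U f \<le> ereal K"
    if "\<And>A. A \<subseteq> ?U \<Longrightarrow> continuous_on A f" "\<And>p. p \<in> strip L \<Longrightarrow> \<bar>f p\<bar> \<le> K" for f :: "real \<times> real \<Rightarrow> real"
  proof
    show "locally_integrable ?U f"
      using that sub by (intro locally_integrable_bounded[of _ _ K] open_strip_interior continuous_imp_measurable_on_sets_lebesgue)
        (auto intro: lmeasurable_compact fmeasurableD)
    show "Linf_norm ?U f \<le> ereal K"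
      using that sub by (intro Linf_norm_le cont_measurable_lebesgue_on open_strip_interior) auto
  qed
  have u0: "locally_integrable ?U u" "Linf_norm ?U u \<le> ereal K" using cl[OF cont(1) bd(1)] by auto
  have u1: "locally_integrable ?U (pderiv_on (strip L) b u)" "Linf_norm ?U (pderiv_on (strip L) b u) \<le> ereal K"
    if "b \<in> {(1, 0), (0, 1)}" for b
    using cl[OF cont(2)[OF _ that] bd(2)[OF that]] by auto
  show W2: "weak_deriv_Linf_le ?U [a, b] u (2 * (\<bar>C\<bar> + 1))"
    if a: "a \<in> {(1, 0), (0, 1)}" and b: "b \<in> {(1, 0), (0, 1)}" for a b
  proof -
    obtain g where g: "g \<in> borel_measurable borel" "\<And>p. \<bar>g p\<bar> \<le> 2 * (\<bar>C\<bar> + 1)"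
      and ibp: "\<And>\<psi>. test_function ?U \<psi> \<Longrightarrow>
        (LINT p|lebesgue_on ?U. pderiv_on (strip L) a u p * pderiv_on UNIV b \<psi> p) = - (LINT p|lebesgue_on ?U. g p * \<psi> p)"
      using strip_weak_derivative[OF L lip[OF a] b] by blast
    have "(LINT p|lebesgue_on ?U. u p * iter_pderiv [a, b] \<psi> p) = (- 1) ^ length [a, b] * (LINT p|lebesgue_on ?U. g p * \<psi> p)"
      if "test_function ?U \<psi>" for \<psi>
      using strip_integration_by_parts[OF Ck test_function_pderiv(1)[OF that b] a] ibp[OF that]
      by (simp add: iter_pderiv_def)
    moreover have "locally_integrable ?U g"
      using g by (intro locally_integrable_bounded[of _ _ "2 * (\<bar>C\<bar> + 1)"] open_strip_interior borel_measurable_lebesgue_on) auto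
    moreover have "Linf_norm ?U g \<le> ereal (2 * (\<bar>C\<bar> + 1))"
      using g by (intro Linf_norm_le borel_measurable_lebesgue_on) auto
    ultimately show ?thesis
      unfolding weak_deriv_Linf_le_def has_weak_deriv_def using u0 by blast
  qed
  show "Wk_inf 2 ?U u"
    unfolding Wk_inf_def
  proof (intro allI impI)
    fix bs :: "(real \<times> real) list" assume bs: "set bs \<subseteq> Basis \<and> length bs \<le> 2"
    have Basis: "Basis = {(1, 0), (0, 1) :: real \<times> real}" by (auto simp: Basis_prod_def)
    consider "bs = []" | a where "bs = [a]" | a b where "bs = [a, b]"
      using bs by (cases bs; cases "tl bs"; cases "tl (tl bs)") auto
    then show "\<exists>g. has_weak_deriv ?U bs u g \<and> Linf_norm ?U g < \<infinity>"
    proof cases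
      case 1
      then have "has_weak_deriv ?U bs u u" using u0 by (simp add: has_weak_deriv_def iter_pderiv_def)
      then show ?thesis using u0(2) by (intro exI[of _ u]) (auto elim: order.strict_trans1)
    next
      case (2 a)
      then have a: "a \<in> {(1, 0), (0, 1)}" using bs Basis by auto
      have "has_weak_deriv ?U bs u (pderiv_on (strip L) a u)"
        using u0(1) u1(1)[OF a] strip_integration_by_parts[OF Ck _ a] 2 by (auto simp: has_weak_deriv_def iter_pderiv_def)
      then show ?thesis using u1(2)[OF a] by (intro exI[of _ "pderiv_on (strip L) a u"]) (auto elim: order.strict_trans1)
    next
      case (3 a b)
      then have "a \<in> {(1, 0), (0, 1)}" "b \<in> {(1, 0), (0, 1)}" using bs Basis by auto
      from W2[OF this] show ?thesis
        unfolding weak_deriv_Linf_le_def 3 by (metis ereal_infty_less(1) order.strict_trans1 PInfty_neq_ereal(1))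
    qed
  qed
qed

section \<open>Choice of the threshold and conclusion\<close>

lemma second_time_deriv_lipschitz:
  assumes Ck: "Ck_on 2 (strip L) \<beta>" and B: "second_derivs_le L \<beta> B" and ts: "t \<ge> 0" "s \<ge> 0" "x \<in> {0..L}"
  shows "\<bar>pderiv_on (strip L) (1, 0) \<beta> (t, x) - pderiv_on (strip L) (1, 0) \<beta> (s, x)\<bar> \<le> \<bar>B\<bar> * \<bar>t - s\<bar>"
proof -
  let ?\<beta>t = "pderiv_on (strip L) (1, 0) \<beta>"
  have Ck2: "Ck_on (Suc (Suc 0)) (strip L) \<beta>" using Ck by (simp add: numeral_2_eq_2)
  have Ck1: "Ck_on (Suc 0) (strip L) ?\<beta>t" by (rule Ck_on_Suc_cont(1)[OF Ck2]) simp
  have e: "(1, 0) \<in> (Basis :: (real \<times> real) set)" by (simp add: Basis_prod_def)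
  have bd: "\<bar>pderiv_on (strip L) (1, 0) ?\<beta>t p\<bar> \<le> \<bar>B\<bar>" if "p \<in> strip L" for p
    using B e that sup_norm_bound[of "strip L" "pderiv_on (strip L) (1, 0) ?\<beta>t" B p] unfolding second_derivs_le_def
    by (meson abs_ge_self order_trans)
  have der: "((\<lambda>t. ?\<beta>t (t, x)) has_real_derivative pderiv_on (strip L) (1, 0) ?\<beta>t (t, x)) (at t within {0..})"
    if "t \<ge> 0" "x \<in> {0..L}" for t x
    using Ck_on_Suc_fst[OF Ck1, of t x] that strip_fst_set[of x L] by (auto simp: strip_def)
  show ?thesis by (rule strip_lipschitz_fst[OF der bd ts])
qed

text \<open>The conditions of \<open>small_flow\<close> on the size K of the solution. They alone
  restrict \<epsilon> through K = \<open>C\<^sub>E * \<epsilon>\<close>, once \<delta> is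
  fixed.\<close>

definition small_bound :: "real \<Rightarrow> real \<Rightarrow> real \<Rightarrow> real \<Rightarrow> real \<Rightarrow> bool" where
  "small_bound A\<^sub>0 P b \<delta> K \<longleftrightarrow> 0 \<le> K \<and> K \<le> 1 \<and> 4 * A\<^sub>0\<^sup>2 * P * (b + 1) * K \<le> 1 \<and> 8 * (4 * A\<^sub>0\<^sup>2 * P * (b + 1) * K) \<le> \<delta>"

lemma small_bound_exists:
  assumes "P \<ge> 0" "b \<ge> 0" "\<delta> > (0::real)"
  shows "\<exists>\<theta>>0. \<forall>K. 0 \<le> K \<and> K \<le> \<theta> \<longrightarrow> small_bound A\<^sub>0 P b \<delta> K"
proof -
  \<comment> \<open>The summand 1 keeps Q positive, so the divisions by Q are safe even if P =
    0.\<close>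
  define Q where "Q = 4 * A\<^sub>0\<^sup>2 * P * (b + 1) + 1"
  have Q: "Q \<ge> 1" using assms by (simp add: Q_def)
  show ?thesis
  proof (intro exI[of _ "min 1 (min (1 / Q) (\<delta> / (8 * Q)))"] conjI allI impI)
    fix K assume K: "0 \<le> K \<and> K \<le> min 1 (min (1 / Q) (\<delta> / (8 * Q)))"
    then have "Q * K \<le> 1" "8 * (Q * K) \<le> \<delta>" using Q by (auto simp: field_simps)
    moreover have "4 * A\<^sub>0\<^sup>2 * P * (b + 1) * K \<le> Q * K" using K by (intro mult_right_mono) (auto simp: Q_def)
    ultimately show "small_bound A\<^sub>0 P b \<delta> K" using K unfolding small_bound_def by auto
  qed (use Q assms in auto)
qed

lemma periodic_solution_small_flow:
  fixes \<gamma> \<rho> L T \<beta>\<^sub>0 \<kappa>\<^sub>1 \<kappa>\<^sub>2 A\<^sub>0 \<epsilon> K B M \<delta> :: real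
  assumes basic: "\<gamma> > 1" "L > 0" "T > 0" "\<beta>\<^sub>0 < 0" "A\<^sub>0 > 0" "\<epsilon> \<le> 1"
    and speeds: "\<And>v. \<bar>fst v\<bar> \<le> K \<Longrightarrow> \<bar>snd v\<bar> \<le> K \<Longrightarrow>
      lam1 \<gamma> (v + background \<gamma> \<rho>) < 0 \<and> 0 < lam2 \<gamma> (v + background \<gamma> \<rho>) \<and>
      \<bar>inverse (lam1 \<gamma> (v + background \<gamma> \<rho>))\<bar> \<le> A\<^sub>0 \<and> \<bar>inverse (lam2 \<gamma> (v + background \<gamma> \<rho>))\<bar> \<le> A\<^sub>0"
    and \<delta>: "0 < \<delta>" "\<delta> * exp ((A\<^sub>0 * - \<beta>\<^sub>0 + 1) * L) \<le> 1 / 2"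
      "4 * (\<delta> * exp ((A\<^sub>0 * - \<beta>\<^sub>0 + 1) * L)) \<le> 1 - \<bar>\<kappa>\<^sub>1\<bar>" "\<delta> \<le> 1 - \<bar>\<kappa>\<^sub>2\<bar>"
    and small: "small_bound A\<^sub>0 (\<gamma> + 3) (- \<beta>\<^sub>0) \<delta> K"
    and damp: "damping L T \<beta>\<^sub>0 \<epsilon> \<beta>" "second_derivs_le L \<beta> B"
    and data: "boundary_datum T \<epsilon> b1" "boundary_datum T \<epsilon> b2"
      "weak_deriv_Linf_le {0<..} [1, 1] b1 M" "weak_deriv_Linf_le {0<..} [1, 1] b2 M"
    and sol: "periodic_solution \<gamma> \<rho> L T \<kappa>\<^sub>1 \<kappa>\<^sub>2 K \<beta> b1 b2 f1 f2 u1 u2"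
  shows "small_flow T L \<kappa>\<^sub>1 \<kappa>\<^sub>2 A\<^sub>0 (- \<beta>\<^sub>0) \<bar>B\<bar> \<bar>M\<bar> (\<gamma> + 3) K \<delta> ((\<gamma> + 1) / 2) ((3 - \<gamma>) / 2) (snd (background \<gamma> \<rho>))
    u1 (pderiv_on (strip L) (1, 0) u1) (pderiv_on (strip L) (0, 1) u1)
    u2 (pderiv_on (strip L) (1, 0) u2) (pderiv_on (strip L) (0, 1) u2)
    \<beta> (pderiv_on (strip L) (1, 0) \<beta>) (pderiv_on (strip L) (0, 1) \<beta>) b1 b2"
proof -
  define c where "c = snd (background \<gamma> \<rho>)"
  have bg: "background \<gamma> \<rho> = (- c, c)" by (simp add: c_def background_def Let_def)
  have lam: "lam1 \<gamma> ((x, y) + background \<gamma> \<rho>) = (\<gamma> + 1) / 2 * (x - c) + (3 - \<gamma>) / 2 * (y + c)"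
    "lam2 \<gamma> ((x, y) + background \<gamma> \<rho>) = (3 - \<gamma>) / 2 * (x - c) + (\<gamma> + 1) / 2 * (y + c)" for x y
    by (simp_all add: bg lam1_def lam2_def)
  have Ck: "Ck_on (Suc 0) (strip L) u1" "Ck_on (Suc 0) (strip L) u2" "Ck_on (Suc (Suc 0)) (strip L) \<beta>"
    using sol damp(1) by (auto simp: periodic_solution_def damping_def numeral_2_eq_2 simp del: Ck_on.simps)
  have per: "u1 (t + T, x) = u1 (t, x)" "u2 (t + T, x) = u2 (t, x)" "\<beta> (t + T, x) = \<beta> (t, x)" if "(t, x) \<in> strip L" for t x
    using sol damp(1) that unfolding periodic_solution_def damping_def by blast+
  have C1: "C1_norm (strip L) u1 \<le> ereal K" "C1_norm (strip L) u2 \<le> ereal K"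
    using sol by (auto simp: periodic_solution_def)
  have dx: "((\<lambda>x. f (t, x)) has_real_derivative pderiv_on (strip L) (0, 1) f (t, x)) (at x within {0..L})"
    if "Ck_on (Suc k) (strip L) f" "t \<ge> 0" "x \<in> {0..L}" for f t x k
    using Ck_on_Suc_snd[OF that(1), of t x] that(2,3) strip_snd_set[of t L] by (auto simp: strip_def)
  note sp = speeds[of "(u1 p, u2 p)" for p, unfolded lam fst_conv snd_conv, OF C1_norm_bounds(1)[OF C1(1)] C1_norm_bounds(1)[OF C1(2)]]
  have ib: "ibvp \<gamma> \<rho> L \<kappa>\<^sub>1 \<kappa>\<^sub>2 \<beta> b1 b2 f1 f2 u1 u2" using sol by (simp add: periodic_solution_def)
  have pde: "pderiv_on (strip L) (1, 0) u1 p + ((\<gamma> + 1) / 2 * (u1 p - c) + (3 - \<gamma>) / 2 * (u2 p + c)) * pderiv_on (strip L) (0, 1) u1 p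
        = \<beta> p / 2 * (u1 p + u2 p)"
      "pderiv_on (strip L) (1, 0) u2 p + ((3 - \<gamma>) / 2 * (u1 p - c) + (\<gamma> + 1) / 2 * (u2 p + c)) * pderiv_on (strip L) (0, 1) u2 p
        = \<beta> p / 2 * (u1 p + u2 p)" if "p \<in> strip L" for p
    using ib that unfolding ibvp_def lam by blast+
  have dam: "- (- \<beta>\<^sub>0) \<le> \<beta> p \<and> \<beta> p \<le> 0" "\<bar>pderiv_on (strip L) (1, 0) \<beta> p\<bar> \<le> 1" "\<bar>pderiv_on (strip L) (0, 1) \<beta> p\<bar> \<le> 1" if "p \<in> strip L" for p
    using damp(1) that basic(6) unfolding damping_def minus_minus by (blast intro: order_trans)+
  have bC: "Ck_on 1 {0..} b1" "Ck_on 1 {0..} b2" using data(1,2) by (simp_all add: boundary_datum_def del: Ck_on.simps One_nat_def)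
  have pC: "periodic_C1 T L u1 (pderiv_on (strip L) (1, 0) u1)" "periodic_C1 T L u2 (pderiv_on (strip L) (1, 0) u2)"
    "periodic_C1 T L \<beta> (pderiv_on (strip L) (1, 0) \<beta>)"
    using per by (intro periodic_C1_of_Ck_on[OF Ck(1) basic(3)] periodic_C1_of_Ck_on[OF Ck(2) basic(3)]
        periodic_C1_of_Ck_on[OF Ck(3) basic(3)]; simp)+
  have bdry: "t \<ge> 0 \<Longrightarrow> u2 (t, 0) = b2 t + \<kappa>\<^sub>2 * u1 (t, 0)" "t \<ge> 0 \<Longrightarrow> u1 (t, L) = b1 t + \<kappa>\<^sub>1 * u2 (t, L)" for t
    using ib unfolding ibvp_def by blast+
  have "Ck_on 2 (strip L) \<beta>" using damp(1) by (simp only: damping_def)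
  note \<beta>tt = second_time_deriv_lipschitz[OF this damp(2)]
  \<comment> \<open>\<gamma> + 3 is a crude common bound for the two coefficients of the
    speeds.\<close>
  have num: "\<bar>(\<gamma> + 1) / 2\<bar> \<le> \<gamma> + 3" "\<bar>(3 - \<gamma>) / 2\<bar> \<le> \<gamma> + 3" "0 \<le> A\<^sub>0" "0 \<le> - \<beta>\<^sub>0"
    using basic by auto
  note sm = small[unfolded small_bound_def]
  show ?thesis
    unfolding c_def[symmetric]
    by (rule small_flow.intro)
      (rule basic pC dx[OF Ck(1)] dx[OF Ck(2)] dx[OF Ck(3)] C1_norm_bounds[OF C1(1)] C1_norm_bounds[OF C1(2)] dam \<beta>tt
        sp[THEN conjunct1] sp[THEN conjunct2, THEN conjunct1] sp[THEN conjunct2, THEN conjunct2, THEN conjunct1]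
        sp[THEN conjunct2, THEN conjunct2, THEN conjunct2] pde bdry
        boundary_datum_second_difference[OF bC(1) data(3)] boundary_datum_second_difference[OF bC(2) data(4)]
        num abs_ge_zero \<delta> sm[THEN conjunct1] sm[THEN conjunct2, THEN conjunct1] sm[THEN conjunct2, THEN conjunct2, THEN conjunct1]
        sm[THEN conjunct2, THEN conjunct2, THEN conjunct2] | assumption)+
qed

context small_flow
begin

lemma lip_const_nonneg: "0 \<le> lip_t" "0 \<le> lip_mixed" "0 \<le> lip_x"
proof -
  have "0 \<le> source_const A\<^sub>0 P b B" unfolding source_const_def using const P by simp
  then show t: "0 \<le> lip_t" unfolding lip_t_def using const by simp
  then show m: "0 \<le> lip_mixed" unfolding lip_mixed_def using const by simp
  then show "0 \<le> lip_x" unfolding lip_x_def using const by simp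
qed

lemma two_step_lipschitz:
  fixes f :: "real \<times> real \<Rightarrow> real"
  assumes "\<And>t s x. t \<ge> 0 \<Longrightarrow> s \<ge> 0 \<Longrightarrow> x \<in> {0..L} \<Longrightarrow> \<bar>f (t, x) - f (s, x)\<bar> \<le> C1 * \<bar>t - s\<bar>"
    and "\<And>t x y. t \<ge> 0 \<Longrightarrow> x \<in> {0..L} \<Longrightarrow> y \<in> {0..L} \<Longrightarrow> \<bar>f (t, x) - f (t, y)\<bar> \<le> C2 * \<bar>x - y\<bar>"
    and "C1 \<le> C" "C2 \<le> C" and p: "(t, x) \<in> strip L" "(s, y) \<in> strip L"
  shows "\<bar>f (t, x) - f (s, y)\<bar> \<le> C * (\<bar>t - s\<bar> + \<bar>x - y\<bar>)"
proof -
  have "\<bar>f (t, x) - f (s, x)\<bar> \<le> C1 * \<bar>t - s\<bar>" "\<bar>f (s, x) - f (s, y)\<bar> \<le> C2 * \<bar>x - y\<bar>"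
    using assms p by (auto simp: strip_def)
  moreover have "C1 * \<bar>t - s\<bar> \<le> C * \<bar>t - s\<bar>" "C2 * \<bar>x - y\<bar> \<le> C * \<bar>x - y\<bar>"
    using assms by (auto intro!: mult_right_mono)
  ultimately show ?thesis unfolding distrib_left by linarith
qed

lemma full_lipschitz:
  assumes "(t, x) \<in> strip L" "(s, y) \<in> strip L"
  shows "\<bar>w1 (t, x) - w1 (s, y)\<bar> \<le> (lip_t + lip_mixed + lip_x) * (\<bar>t - s\<bar> + \<bar>x - y\<bar>)"
    "\<bar>w2 (t, x) - w2 (s, y)\<bar> \<le> (lip_t + lip_mixed + lip_x) * (\<bar>t - s\<bar> + \<bar>x - y\<bar>)"
    "\<bar>X1 (t, x) - X1 (s, y)\<bar> \<le> (lip_t + lip_mixed + lip_x) * (\<bar>t - s\<bar> + \<bar>x - y\<bar>)"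
    "\<bar>X2 (t, x) - X2 (s, y)\<bar> \<le> (lip_t + lip_mixed + lip_x) * (\<bar>t - s\<bar> + \<bar>x - y\<bar>)"
  using two_step_lipschitz[OF w_lipschitz_t(1) w_lipschitz_x(1) _ _ assms]
    two_step_lipschitz[OF w_lipschitz_t(2) w_lipschitz_x(2) _ _ assms]
    two_step_lipschitz[OF X_lipschitz_t(1) X_lipschitz_x(1) _ _ assms]
    two_step_lipschitz[OF X_lipschitz_t(2) X_lipschitz_x(2) _ _ assms] lip_const_nonneg by auto

end

theorem theorem2p3:
  fixes \<gamma> \<rho> L T \<beta>\<^sub>0 \<kappa>\<^sub>1 \<kappa>\<^sub>2 A\<^sub>0 \<epsilon>\<^sub>1 C\<^sub>E M\<^sub>2 :: real
    and \<Psi> :: "(real \<times> real) set"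
  assumes "\<gamma> > 1" and "\<rho> > 0" and "L > 0" and "T > 0" and "\<beta>\<^sub>0 < 0"
    and "\<bar>\<kappa>\<^sub>1\<bar> < 1" and "\<bar>\<kappa>\<^sub>2\<bar> < 1"
    and "0 \<in> interior \<Psi>"
    and "\<And>v. v \<in> \<Psi> \<Longrightarrow> lam1 \<gamma> (v + background \<gamma> \<rho>) < 0 \<and> 0 < lam2 \<gamma> (v + background \<gamma> \<rho>)"
    and "A\<^sub>0 > 0"
    and "\<And>v. v \<in> \<Psi> \<Longrightarrow> \<bar>inverse (lam1 \<gamma> (v + background \<gamma> \<rho>))\<bar> \<le> A\<^sub>0 \<and>
                        \<bar>inverse (lam2 \<gamma> (v + background \<gamma> \<rho>))\<bar> \<le> A\<^sub>0"
    and "existence_property \<gamma> \<rho> L T \<beta>\<^sub>0 \<kappa>\<^sub>1 \<kappa>\<^sub>2 \<epsilon>\<^sub>1 C\<^sub>E"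
  shows "\<exists>\<epsilon>\<^sub>4. 0 < \<epsilon>\<^sub>4 \<and> \<epsilon>\<^sub>4 < \<epsilon>\<^sub>1 \<and>
    (\<forall>B. \<exists>C\<^sub>R>0. \<forall>\<epsilon> \<beta> b1 b2 f1 f2 u1 u2.
       0 < \<epsilon> \<and> \<epsilon> < \<epsilon>\<^sub>4 \<and>
       damping L T \<beta>\<^sub>0 \<epsilon> \<beta> \<and> second_derivs_le L \<beta> B \<and>
       boundary_datum T \<epsilon> b1 \<and> boundary_datum T \<epsilon> b2 \<and>
       Wk_inf 2 {0<..} b1 \<and> Wk_inf 2 {0<..} b2 \<and>
       weak_deriv_Linf_le {0<..} [1, 1] b1 M\<^sub>2 \<and> weak_deriv_Linf_le {0<..} [1, 1] b2 M\<^sub>2 \<and>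
       periodic_solution \<gamma> \<rho> L T \<kappa>\<^sub>1 \<kappa>\<^sub>2 (C\<^sub>E * \<epsilon>) \<beta> b1 b2 f1 f2 u1 u2 \<longrightarrow>
       (\<forall>u\<in>{u1, u2}.
          Wk_inf 2 (strip_interior L) u \<and>
          weak_deriv_Linf_le (strip_interior L) [(1, 0), (1, 0)] u ((1 + A\<^sub>0)\<^sup>2 * C\<^sub>R) \<and>
          weak_deriv_Linf_le (strip_interior L) [(1, 0), (0, 1)] u ((1 + A\<^sub>0)\<^sup>2 * C\<^sub>R) \<and>
          weak_deriv_Linf_le (strip_interior L) [(0, 1), (0, 1)] u ((1 + A\<^sub>0)\<^sup>2 * C\<^sub>R)))"
proof -
  define b where "b = - \<beta>\<^sub>0"
  define m where "m = A\<^sub>0 * b + 1"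
  \<comment> \<open>The exponential factor is cancelled at x = L, where the weights deviate most
    from 1. The minimum lists the three margins: 1/2 for positivity of the smaller weight, and one
    for each reflection.\<close>
  define \<delta> where "\<delta> = exp (- (m * L)) * min (1 / 2) (min ((1 - \<bar>\<kappa>\<^sub>1\<bar>) / 4) (1 - \<bar>\<kappa>\<^sub>2\<bar>))"
  have b: "b > 0" using assms by (simp add: b_def)
  have mL: "m * L > 0" using assms b by (simp add: m_def add_pos_pos)
  have \<delta>0: "\<delta> > 0" using assms by (simp add: \<delta>_def)
  have \<delta>e: "\<delta> * exp (m * L) = min (1 / 2) (min ((1 - \<bar>\<kappa>\<^sub>1\<bar>) / 4) (1 - \<bar>\<kappa>\<^sub>2\<bar>))"
    by (simp add: \<delta>_def exp_minus field_simps)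
  have "\<delta> * 1 \<le> \<delta> * exp (m * L)" using mL \<delta>0 by (intro mult_left_mono) auto
  then have \<delta>: "\<delta> * exp (m * L) \<le> 1 / 2" "4 * (\<delta> * exp (m * L)) \<le> 1 - \<bar>\<kappa>\<^sub>1\<bar>" "\<delta> \<le> 1 - \<bar>\<kappa>\<^sub>2\<bar>"
    unfolding \<delta>e by (auto simp: min_def split: if_splits)
  obtain r where r: "r > 0" "ball 0 r \<subseteq> \<Psi>" using assms(8) by (auto simp: mem_interior)
  obtain \<theta> where \<theta>: "\<theta> > 0" "\<And>K. 0 \<le> K \<Longrightarrow> K \<le> \<theta> \<Longrightarrow> small_bound A\<^sub>0 (\<gamma> + 3) b \<delta> K"
    using small_bound_exists[of "\<gamma> + 3" b \<delta> A\<^sub>0] assms b \<delta>0 by auto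
  have CE: "C\<^sub>E > 0" "\<epsilon>\<^sub>1 > 0" using assms(12) by (auto simp: existence_property_def)
  \<comment> \<open>Halving makes the threshold strictly smaller than that of the existence
    property; 1 bounds the first derivatives of the damping; \<theta> makes the quadratic terms
    absorbable; r / 4 keeps the solution in \<Psi>. B is not involved, so the threshold precedes
    it.\<close>
  define \<epsilon>\<^sub>4 where "\<epsilon>\<^sub>4 = min (\<epsilon>\<^sub>1 / 2) (min 1 (min \<theta> (r / 4) / C\<^sub>E))"
  have e4: "0 < \<epsilon>\<^sub>4" "\<epsilon>\<^sub>4 < \<epsilon>\<^sub>1" using CE \<theta> r by (auto simp: \<epsilon>\<^sub>4_def)
  have speeds: "lam1 \<gamma> (v + background \<gamma> \<rho>) < 0 \<and> 0 < lam2 \<gamma> (v + background \<gamma> \<rho>) \<and>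
      \<bar>inverse (lam1 \<gamma> (v + background \<gamma> \<rho>))\<bar> \<le> A\<^sub>0 \<and> \<bar>inverse (lam2 \<gamma> (v + background \<gamma> \<rho>))\<bar> \<le> A\<^sub>0"
    if v: "\<bar>fst v\<bar> \<le> K" "\<bar>snd v\<bar> \<le> K" and "K \<le> r / 4" for v K
  proof -
    \<comment> \<open>The two components add up to at most r / 2, which puts v inside the open
      ball.\<close>
    have "norm v \<le> \<bar>fst v\<bar> + \<bar>snd v\<bar>" using norm_Pair_le[of "fst v" "snd v"] by simp
    then have "v \<in> ball 0 r" using that r(1) by simp
    then have "v \<in> \<Psi>" using r by blast
    then show ?thesis using assms(9,11) by blast
  qed
  have "\<exists>C\<^sub>R>0. \<forall>\<epsilon> \<beta> b1 b2 f1 f2 u1 u2.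
       0 < \<epsilon> \<and> \<epsilon> < \<epsilon>\<^sub>4 \<and>
       damping L T \<beta>\<^sub>0 \<epsilon> \<beta> \<and> second_derivs_le L \<beta> B \<and>
       boundary_datum T \<epsilon> b1 \<and> boundary_datum T \<epsilon> b2 \<and>
       Wk_inf 2 {0<..} b1 \<and> Wk_inf 2 {0<..} b2 \<and>
       weak_deriv_Linf_le {0<..} [1, 1] b1 M\<^sub>2 \<and> weak_deriv_Linf_le {0<..} [1, 1] b2 M\<^sub>2 \<and>
       periodic_solution \<gamma> \<rho> L T \<kappa>\<^sub>1 \<kappa>\<^sub>2 (C\<^sub>E * \<epsilon>) \<beta> b1 b2 f1 f2 u1 u2 \<longrightarrow>
       (\<forall>u\<in>{u1, u2}.
          Wk_inf 2 (strip_interior L) u \<and>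
          weak_deriv_Linf_le (strip_interior L) [(1, 0), (1, 0)] u ((1 + A\<^sub>0)\<^sup>2 * C\<^sub>R) \<and>
          weak_deriv_Linf_le (strip_interior L) [(1, 0), (0, 1)] u ((1 + A\<^sub>0)\<^sup>2 * C\<^sub>R) \<and>
          weak_deriv_Linf_le (strip_interior L) [(0, 1), (0, 1)] u ((1 + A\<^sub>0)\<^sup>2 * C\<^sub>R))" for B
  proof -
    \<comment> \<open>Outside the locale the constants show their parameters: \<epsilon>, K and the
      solution are not among them, so \<open>C\<^sub>R\<close> is uniform over all data with the
      given bounds.\<close>
    define \<Lambda> where "\<Lambda> = small_flow.lip_t A\<^sub>0 b \<bar>B\<bar> \<bar>M\<^sub>2\<bar> (\<gamma> + 3) \<delta> + small_flow.lip_mixed A\<^sub>0 b \<bar>B\<bar> \<bar>M\<^sub>2\<bar> (\<gamma> + 3) \<delta>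
      + small_flow.lip_x A\<^sub>0 b \<bar>B\<bar> \<bar>M\<^sub>2\<bar> (\<gamma> + 3) \<delta>"
    define R where "R = 2 * (\<bar>\<Lambda>\<bar> + 1)"
    have R0: "R > 0" by (simp add: R_def)
    \<comment> \<open>As \<open>(1 + A\<^sub>0)\<^sup>2\<close> is at least 1, R itself serves as
      \<open>C\<^sub>R\<close>: the dependence on \<open>A\<^sub>0\<close> is already contained in
      it.\<close>
    have "1 * R \<le> (1 + A\<^sub>0)\<^sup>2 * R"
      using R0 assms(10) one_le_power[of "1 + A\<^sub>0" 2] by (intro mult_right_mono) auto
    then have mono: "weak_deriv_Linf_le U bs u ((1 + A\<^sub>0)\<^sup>2 * R)" if "weak_deriv_Linf_le U bs u R"
      for U bs and u :: "real \<times> real \<Rightarrow> real"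
      using that unfolding weak_deriv_Linf_le_def by (auto elim!: order_trans)
    show ?thesis
    proof (intro exI[of _ R] conjI R0 allI impI ballI)
      fix \<epsilon> \<beta> b1 b2 f1 f2 u1 u2 u
      assume hyp: "0 < \<epsilon> \<and> \<epsilon> < \<epsilon>\<^sub>4 \<and>
         damping L T \<beta>\<^sub>0 \<epsilon> \<beta> \<and> second_derivs_le L \<beta> B \<and>
         boundary_datum T \<epsilon> b1 \<and> boundary_datum T \<epsilon> b2 \<and>
         Wk_inf 2 {0<..} b1 \<and> Wk_inf 2 {0<..} b2 \<and>
         weak_deriv_Linf_le {0<..} [1, 1] b1 M\<^sub>2 \<and> weak_deriv_Linf_le {0<..} [1, 1] b2 M\<^sub>2 \<and>
         periodic_solution \<gamma> \<rho> L T \<kappa>\<^sub>1 \<kappa>\<^sub>2 (C\<^sub>E * \<epsilon>) \<beta> b1 b2 f1 f2 u1 u2"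
        and u: "u \<in> {u1, u2}"
      define K where "K = C\<^sub>E * \<epsilon>"
      have "\<epsilon> \<le> 1" "\<epsilon> \<le> min \<theta> (r / 4) / C\<^sub>E" using hyp by (auto simp: \<epsilon>\<^sub>4_def)
      then have \<epsilon>: "\<epsilon> \<le> 1" and K: "0 \<le> K" "K \<le> \<theta>" "K \<le> r / 4"
        using CE hyp by (auto simp: K_def field_simps)
      have sol: "periodic_solution \<gamma> \<rho> L T \<kappa>\<^sub>1 \<kappa>\<^sub>2 K \<beta> b1 b2 f1 f2 u1 u2" using hyp by (simp add: K_def)
      interpret small_flow T L \<kappa>\<^sub>1 \<kappa>\<^sub>2 A\<^sub>0 b "\<bar>B\<bar>" "\<bar>M\<^sub>2\<bar>" "\<gamma> + 3" K \<delta> "(\<gamma> + 1) / 2" "(3 - \<gamma>) / 2" "snd (background \<gamma> \<rho>)"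
        u1 "pderiv_on (strip L) (1, 0) u1" "pderiv_on (strip L) (0, 1) u1"
        u2 "pderiv_on (strip L) (1, 0) u2" "pderiv_on (strip L) (0, 1) u2"
        \<beta> "pderiv_on (strip L) (1, 0) \<beta>" "pderiv_on (strip L) (0, 1) \<beta>" b1 b2
        unfolding b_def
        by (rule periodic_solution_small_flow[where \<epsilon> = \<epsilon>])
          (use assms \<epsilon> speeds K \<delta>0 \<delta> \<theta>(2) hyp sol in \<open>auto simp: b_def m_def\<close>)
      have Ck: "Ck_on 1 (strip L) u" using sol u unfolding periodic_solution_def by blast
      have lip: "\<bar>pderiv_on (strip L) a u (t, x) - pderiv_on (strip L) a u (s, y)\<bar> \<le> \<Lambda> * (\<bar>t - s\<bar> + \<bar>x - y\<bar>)"
        if "a \<in> {(1, 0), (0, 1)}" "(t, x) \<in> strip L" "(s, y) \<in> strip L" for a t s x y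
        unfolding \<Lambda>_def using full_lipschitz[OF that(2,3)] that(1) u by auto
      have bd: "\<bar>u p\<bar> \<le> K" if "p \<in> strip L" for p using u bounds(1,2)[OF that] by auto
      have bd': "\<bar>pderiv_on (strip L) a u p\<bar> \<le> K" if "a \<in> {(1, 0), (0, 1)}" "p \<in> strip L" for a p
        using u bounds(3-6)[OF that(2)] that(1) by auto
      note W = strip_W2_inf[OF assms(3) Ck bd bd' lip]
      show "Wk_inf 2 (strip_interior L) u" by (rule W(1))
      show "weak_deriv_Linf_le (strip_interior L) [(1, 0), (1, 0)] u ((1 + A\<^sub>0)\<^sup>2 * R)"
        "weak_deriv_Linf_le (strip_interior L) [(1, 0), (0, 1)] u ((1 + A\<^sub>0)\<^sup>2 * R)"
        "weak_deriv_Linf_le (strip_interior L) [(0, 1), (0, 1)] u ((1 + A\<^sub>0)\<^sup>2 * R)"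
        using W(2) unfolding R_def[symmetric] by (auto intro!: mono)
    qed
  qed
  then show ?thesis using e4 by blast
qed

end
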